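(* Let $G$ be a connected non-bipartite bicyclic cactus graph on the vertex set $[n]=\{1,\dots,n\}$ and assume that $\operatorname{char}(\mathbb{K})\neq 2$. Then the following are equivalent: (i) $L_G$ is an almost complete intersection; (ii) $\mathcal{I}_G$ is an almost complete intersection; (iii) $G$ is obtained by adding an edge $e$ between two disjoint odd cycles (joining a vertex of one to a vertex of the other).
   Context: All graphs are finite and simple. Let $\mathbb{K}$ be a field and $S=\mathbb{K}[x_1,\dots,x_n,y_1,\dots,y_n]$. For a graph $G$ on $[n]$, the Lovász-Saks-Schrijver (LSS) ideal is $L_G=(x_ix_j+y_iy_j : \{i,j\}\in E(G))\subset S$ and the parity binomial edge ideal is $\mathcal{I}_G=(x_ix_j-y_iy_j : \{i,j\}\in E(G))\subset S$. For a homogeneous ideal $I$, $\mu(I)$ is the cardinality of a minimal homogeneous generating set; $I$ is a complete intersection if $\mu(I)=\operatorname{ht}(I)$, and an almost complete intersection if $\mu(I)=\operatorname{ht}(I)+1$ and $I_{\mathfrak p}$ is a complete intersection (i.e. $\mu(I_{\mathfrak p})=\operatorname{ht}(I_{\mathfrak p})$) for every minimal prime $\mathfrak p$ of $I$. A block of a graph is a maximal (connected) subgraph without a cut vertex. A cactus graph is a graph each of whose blocks is either a cycle or an edge; a bicyclic cactus graph is a cactus graph exactly two of whose blocks are cycles. *)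

theory Defs
  imports
    "HOL-Algebra.Algebraic_Closure_Type"
    "HOL-Library.Poly_Mapping"
    "HOL-Library.Extended_Nat"
    "HOL-Computational_Algebra.Fraction_Field"
begin

section \<open>Finite simple graphs\<close>

type_synonym 'a graph = "'a set \<times> 'a set set"

abbreviation verts :: "'a graph \<Rightarrow> 'a set" where "verts \<equiv> fst"
abbreviation edges :: "'a graph \<Rightarrow> 'a set set" where "edges \<equiv> snd"

definition simple_graph :: "'a graph \<Rightarrow> bool" where
  "simple_graph G \<longleftrightarrow> finite (verts G) \<and> (\<forall>e\<in>edges G. e \<subseteq> verts G \<and> card e = 2)"

definition subgraph :: "'a graph \<Rightarrow> 'a graph \<Rightarrow> bool" where
  "subgraph H G \<longleftrightarrow> simple_graph H \<and> verts H \<subseteq> verts G \<and> edges H \<subseteq> edges G"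

definition delete_vertex :: "'a graph \<Rightarrow> 'a \<Rightarrow> 'a graph" where
  "delete_vertex G v = (verts G - {v}, {e \<in> edges G. v \<notin> e})"

definition joined :: "'a graph \<Rightarrow> ('a \<times> 'a) set" where
  "joined G = {(u, v). {u, v} \<in> edges G}\<^sup>* \<inter> verts G \<times> verts G"

definition components :: "'a graph \<Rightarrow> 'a set set" where
  "components G = verts G // joined G"

definition connected_graph :: "'a graph \<Rightarrow> bool" where
  "connected_graph G \<longleftrightarrow> verts G \<noteq> {} \<and> (\<forall>u\<in>verts G. \<forall>v\<in>verts G. (u, v) \<in> joined G)"

definition cut_vertex :: "'a graph \<Rightarrow> 'a \<Rightarrow> bool" where
  "cut_vertex G v \<longleftrightarrow>
     v \<in> verts G \<and> card (components (delete_vertex G v)) > card (components G)"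

definition nonseparable :: "'a graph \<Rightarrow> bool" where
  "nonseparable G \<longleftrightarrow> connected_graph G \<and> (\<nexists>v. cut_vertex G v)"

definition is_block :: "'a graph \<Rightarrow> 'a graph \<Rightarrow> bool" where
  "is_block G B \<longleftrightarrow> subgraph B G \<and> nonseparable B \<and>
     (\<forall>H. subgraph H G \<and> nonseparable H \<and> subgraph B H \<longrightarrow> H = B)"

definition is_cycle :: "'a graph \<Rightarrow> bool" where
  "is_cycle C \<longleftrightarrow> (\<exists>k f. k \<ge> 3 \<and> bij_betw f {..<k} (verts C) \<and>
     edges C = {{f i, f (Suc i mod k)} | i. i < k})"

definition is_edge_graph :: "'a graph \<Rightarrow> bool" where
  "is_edge_graph H \<longleftrightarrow> (\<exists>u v. u \<noteq> v \<and> H = ({u, v}, {{u, v}}))"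

definition odd_cycle :: "'a graph \<Rightarrow> bool" where
  "odd_cycle C \<longleftrightarrow> is_cycle C \<and> odd (card (verts C))"

definition cactus :: "'a graph \<Rightarrow> bool" where
  "cactus G \<longleftrightarrow> (\<forall>B. is_block G B \<longrightarrow> is_cycle B \<or> is_edge_graph B)"

definition bicyclic_cactus :: "'a graph \<Rightarrow> bool" where
  "bicyclic_cactus G \<longleftrightarrow> cactus G \<and> card {B. is_block G B \<and> is_cycle B} = 2"

definition bipartite :: "'a graph \<Rightarrow> bool" where
  "bipartite G \<longleftrightarrow> (\<exists>P Q. P \<union> Q = verts G \<and> P \<inter> Q = {} \<and>
     (\<forall>e\<in>edges G. \<exists>u\<in>P. \<exists>v\<in>Q. e = {u, v}))"

definition two_odd_cycles_joined_by_edge :: "'a graph \<Rightarrow> bool" where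
  "two_odd_cycles_joined_by_edge G \<longleftrightarrow>
     (\<exists>C D u v. odd_cycle C \<and> odd_cycle D \<and> verts C \<inter> verts D = {} \<and>
        u \<in> verts C \<and> v \<in> verts D \<and>
        verts G = verts C \<union> verts D \<and> edges G = edges C \<union> edges D \<union> {{u, v}})"


section \<open>The polynomial ring in the variables x_1, ..., x_n, y_1, ..., y_n\<close>

datatype lss_var = XV nat | YV nat

text \<open>
  The order on the variables plays no mathematical role: it is only needed because the
  instance of \<^class>\<open>idom\<close> for \<^type>\<open>poly_mapping\<close> asks for linearly ordered exponents.
\<close>

fun lss_var_key :: "lss_var \<Rightarrow> nat" where
  "lss_var_key (XV i) = 2 * i"
| "lss_var_key (YV i) = 2 * i + 1"

lemma lss_var_key_inject: "lss_var_key v = lss_var_key w \<longleftrightarrow> v = w"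
  by (cases v; cases w; simp; presburger)

instantiation lss_var :: linorder
begin

definition less_eq_lss_var :: "lss_var \<Rightarrow> lss_var \<Rightarrow> bool" where
  "less_eq_lss_var v w \<longleftrightarrow> lss_var_key v \<le> lss_var_key w"

definition less_lss_var :: "lss_var \<Rightarrow> lss_var \<Rightarrow> bool" where
  "less_lss_var v w \<longleftrightarrow> lss_var_key v < lss_var_key w"

instance
  by intro_classes (auto simp: less_eq_lss_var_def less_lss_var_def lss_var_key_inject)

end

text \<open>Exponent vectors are finitely supported functions from variables to naturals.\<close>

type_synonym 'k mpoly = "(lss_var \<Rightarrow>\<^sub>0 nat) \<Rightarrow>\<^sub>0 'k"

definition mvar :: "lss_var \<Rightarrow> 'k::field mpoly" where
  "mvar v = Poly_Mapping.single (Poly_Mapping.single v 1) 1"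

abbreviation xvar :: "nat \<Rightarrow> 'k::field mpoly" where "xvar i \<equiv> mvar (XV i)"
abbreviation yvar :: "nat \<Rightarrow> 'k::field mpoly" where "yvar i \<equiv> mvar (YV i)"

definition indets :: "'k::field mpoly \<Rightarrow> lss_var set" where
  "indets p = (\<Union>m\<in>Poly_Mapping.keys p. Poly_Mapping.keys m)"

definition xy_poly_ring :: "nat \<Rightarrow> 'k::field mpoly ring" where
  "xy_poly_ring n = ring_of_type_algebra
     \<lparr>carrier := {p. indets p \<subseteq> XV ` {1..n} \<union> YV ` {1..n}}\<rparr>"

definition total_deg :: "(lss_var \<Rightarrow>\<^sub>0 nat) \<Rightarrow> nat" where
  "total_deg m = (\<Sum>v\<in>Poly_Mapping.keys m. Poly_Mapping.lookup m v)"

definition homogeneous :: "'k::field mpoly \<Rightarrow> bool" where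
  "homogeneous p \<longleftrightarrow> (\<exists>d. \<forall>m\<in>Poly_Mapping.keys p. total_deg m = d)"


section \<open>Height, localization and complete intersections\<close>

definition prime_height :: "('a, 'b) ring_scheme \<Rightarrow> 'a set \<Rightarrow> enat" where
  "prime_height R p = Sup {enat k | k.
     \<exists>c. (\<forall>i\<le>k. primeideal (c i) R) \<and> (\<forall>i<k. c i \<subset> c (Suc i)) \<and> c k = p}"

definition ht :: "('a, 'b) ring_scheme \<Rightarrow> 'a set \<Rightarrow> enat" where
  "ht R I = Inf {prime_height R p | p. primeideal p R \<and> I \<subseteq> p}"

definition minimal_prime :: "('a, 'b) ring_scheme \<Rightarrow> 'a set \<Rightarrow> 'a set \<Rightarrow> bool" where
  "minimal_prime R I p \<longleftrightarrow> primeideal p R \<and> I \<subseteq> p \<and>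
     (\<forall>q. primeideal q R \<and> I \<subseteq> q \<and> q \<subseteq> p \<longrightarrow> q = p)"

text \<open>
  The rings localized here are subrings of an integral domain \<^typ>\<open>'a\<close>, so that the
  localization at a prime ideal is realized inside the fraction field of \<^typ>\<open>'a\<close>.
\<close>

definition localization :: "'a::idom ring \<Rightarrow> 'a set \<Rightarrow> 'a fract ring" where
  "localization R p = ring_of_type_algebra
     \<lparr>carrier := {Fract a b | a b. a \<in> carrier R \<and> b \<in> carrier R - p}\<rparr>"

definition localized_ideal :: "'a::idom ring \<Rightarrow> 'a set \<Rightarrow> 'a set \<Rightarrow> 'a fract set" where
  "localized_ideal R p I = {Fract a b | a b. a \<in> I \<and> b \<in> carrier R - p}"

text \<open>
  Numbers of generators and heights live in \<^typ>\<open>enat\<close>, so that no junk value arises when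
  there is no finite generating set, respectively no prime ideal above.  In the homogeneous
  case the number of generators is the cardinality of a minimal homogeneous generating set;
  by the graded Nakayama lemma the inclusion-minimal ones all attain the minimum.
\<close>

definition num_gens :: "('a, 'b) ring_scheme \<Rightarrow> 'a set \<Rightarrow> enat" where
  "num_gens R I = Inf {enat (card B) | B. finite B \<and> B \<subseteq> carrier R \<and> Idl\<^bsub>R\<^esub> B = I}"

definition num_hom_gens :: "nat \<Rightarrow> 'k::field mpoly set \<Rightarrow> enat" where
  "num_hom_gens n I = Inf {enat (card B) | B.
     finite B \<and> B \<subseteq> carrier (xy_poly_ring n) \<and> (\<forall>p\<in>B. homogeneous p) \<and> Idl\<^bsub>xy_poly_ring n\<^esub> B = I}"

definition almost_complete_intersection :: "nat \<Rightarrow> 'k::field mpoly set \<Rightarrow> bool" where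
  "almost_complete_intersection n I \<longleftrightarrow>
     num_hom_gens n I = ht (xy_poly_ring n) I + 1 \<and>
     (\<forall>p. minimal_prime (xy_poly_ring n) I p \<longrightarrow>
        num_gens (localization (xy_poly_ring n) p) (localized_ideal (xy_poly_ring n) p I) =
        ht (localization (xy_poly_ring n) p) (localized_ideal (xy_poly_ring n) p I))"


section \<open>The two ideals of a graph\<close>

definition LSS_ideal :: "nat \<Rightarrow> nat graph \<Rightarrow> 'k::field mpoly set" where
  "LSS_ideal n G = Idl\<^bsub>xy_poly_ring n\<^esub>
     {xvar i * xvar j + yvar i * yvar j | i j. {i, j} \<in> edges G}"

definition parity_binomial_edge_ideal :: "nat \<Rightarrow> nat graph \<Rightarrow> 'k::field mpoly set" where
  "parity_binomial_edge_ideal n G = Idl\<^bsub>xy_poly_ring n\<^esub>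
     {xvar i * xvar j - yvar i * yvar j | i j. {i, j} \<in> edges G}"


section \<open>The carriers above are commutative rings\<close>

lemma cring_of_type_algebra_carrier_update:
  fixes A :: "'a::comm_ring_1 set"
  assumes "1 \<in> A" "\<And>a. a \<in> A \<Longrightarrow> - a \<in> A"
    "\<And>a b. a \<in> A \<Longrightarrow> b \<in> A \<Longrightarrow> a + b \<in> A"
    "\<And>a b. a \<in> A \<Longrightarrow> b \<in> A \<Longrightarrow> a * b \<in> A"
  shows "cring (ring_of_type_algebra\<lparr>carrier := A\<rparr>)"
proof -
  interpret R: cring "ring_of_type_algebra :: 'a ring"
    by (rule cring_from_type_algebra)
  have minus: "\<ominus>\<^bsub>ring_of_type_algebra\<^esub> a = - a" for a :: 'a
    by (rule R.minus_equality) (simp_all add: ring_of_type_algebra_def)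
  have "subring A ring_of_type_algebra"
    by (rule R.subringI) (simp_all add: minus, simp_all add: ring_of_type_algebra_def assms)
  then show ?thesis
    using R.subcringI' R.subcring_iff[of A] by (simp add: ring_of_type_algebra_def)
qed

lemma indets_add_subset: "indets (p + q) \<subseteq> indets p \<union> indets q"
  using Poly_Mapping.keys_add[of p q] by (auto simp: indets_def)

lemma indets_uminus: "indets (- p) = indets p"
  by (simp add: indets_def keys_def)

lemma indets_mult_subset: "indets (p * q) \<subseteq> indets p \<union> indets q"
proof
  fix v assume "v \<in> indets (p * q)"
  then obtain m where m: "m \<in> Poly_Mapping.keys (p * q)" "v \<in> Poly_Mapping.keys m"
    by (auto simp: indets_def)
  from m(1) keys_mult[of p q] obtain a b where "a \<in> Poly_Mapping.keys p" "b \<in> Poly_Mapping.keys q" "m = a + b"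
    by blast
  with m(2) Poly_Mapping.keys_add[of a b] show "v \<in> indets p \<union> indets q"
    by (auto simp: indets_def)
qed

lemma cring_xy_poly_ring: "cring (xy_poly_ring n :: 'k::field mpoly ring)"
  unfolding xy_poly_ring_def
proof (rule cring_of_type_algebra_carrier_update)
  show "1 \<in> {p :: 'k mpoly. indets p \<subseteq> XV ` {1..n} \<union> YV ` {1..n}}"
    by (simp add: indets_def)
next
  fix a b :: "'k mpoly"
  assume "a \<in> {p. indets p \<subseteq> XV ` {1..n} \<union> YV ` {1..n}}"
    and "b \<in> {p. indets p \<subseteq> XV ` {1..n} \<union> YV ` {1..n}}"
  then have "indets a \<union> indets b \<subseteq> XV ` {1..n} \<union> YV ` {1..n}"
    by (simp only: mem_Collect_eq Un_subset_iff)
  then show "a + b \<in> {p. indets p \<subseteq> XV ` {1..n} \<union> YV ` {1..n}}"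
    and "a * b \<in> {p. indets p \<subseteq> XV ` {1..n} \<union> YV ` {1..n}}"
    unfolding mem_Collect_eq
    by (rule subset_trans[OF indets_add_subset], rule subset_trans[OF indets_mult_subset])
qed (simp add: indets_uminus)

lemma mvar_in_xy_poly_ring:
  assumes "i \<in> {1..n}"
  shows "xvar i \<in> carrier (xy_poly_ring n)" "yvar i \<in> carrier (xy_poly_ring n)"
  using assms by (auto simp: xy_poly_ring_def indets_def mvar_def)

lemma cring_localization:
  fixes p :: "'k::field mpoly set"
  assumes "primeideal p (xy_poly_ring n)"
  shows "cring (localization (xy_poly_ring n) p)"
proof -
  interpret primeideal p "xy_poly_ring n" by fact
  let ?R = "xy_poly_ring n :: 'k mpoly ring"
  have ops: "x \<otimes>\<^bsub>?R\<^esub> y = x * y" "x \<oplus>\<^bsub>?R\<^esub> y = x + y" "\<one>\<^bsub>?R\<^esub> = 1" "\<zero>\<^bsub>?R\<^esub> = 0" for x y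
    by (simp_all add: xy_poly_ring_def ring_of_type_algebra_def)
  have uminus: "- x \<in> carrier ?R" if "x \<in> carrier ?R" for x
    using that by (simp add: xy_poly_ring_def indets_uminus)
  have plus: "x + y \<in> carrier ?R" if "x \<in> carrier ?R" "y \<in> carrier ?R" for x y
    using a_closed[OF that] by (simp add: ops)
  have times: "x * y \<in> carrier ?R" if "x \<in> carrier ?R" "y \<in> carrier ?R" for x y
    using m_closed[OF that] by (simp add: ops)
  have denom: "x * y \<in> carrier ?R - p" if "x \<in> carrier ?R - p" "y \<in> carrier ?R - p" for x y
    using that I_prime[of x y] times[of x y] by (auto simp: ops)
  have nz: "x \<noteq> 0" if "x \<in> carrier ?R - p" for x
    using that additive_subgroup.zero_closed[OF is_additive_subgroup] by (auto simp: ops)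
  have one: "1 \<in> carrier ?R - p"
    using one_closed one_imp_carrier I_notcarr by (auto simp: ops)
  show ?thesis
    unfolding localization_def
  proof (rule cring_of_type_algebra_carrier_update, goal_cases)
    case 1
    then show ?case using one by (auto simp: One_fract_def)
  next
    case (2 x)
    then obtain a b where "x = Fract a b" "a \<in> carrier ?R" "b \<in> carrier ?R - p" by blast
    then have "- x = Fract (- a) b" "- a \<in> carrier ?R" "b \<in> carrier ?R - p"
      using uminus by simp_all
    then show ?case by blast
  next
    case (3 x y)
    then obtain a b c d where *: "x = Fract a b" "y = Fract c d" "a \<in> carrier ?R" "c \<in> carrier ?R"
      "b \<in> carrier ?R - p" "d \<in> carrier ?R - p" by blast
    then have "x + y = Fract (a * d + c * b) (b * d)"
      using nz[of b] nz[of d] by simp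
    moreover have "a * d + c * b \<in> carrier ?R" "b * d \<in> carrier ?R - p"
      using * denom by (auto intro!: plus times)
    ultimately show ?case by blast
  next
    case (4 x y)
    then obtain a b c d where *: "x = Fract a b" "y = Fract c d" "a \<in> carrier ?R" "c \<in> carrier ?R"
      "b \<in> carrier ?R - p" "d \<in> carrier ?R - p" by blast
    then have "x * y = Fract (a * c) (b * d)" by simp
    moreover have "a * c \<in> carrier ?R" "b * d \<in> carrier ?R - p"
      using * denom by (auto intro!: times)
    ultimately show ?case by blast
  qed
qed

end

theory Submission
  imports Defs "HOL-Computational_Algebra.Polynomial"
begin

text \<open>
  Put \<open>e = 1\<close> for the LSS ideal and \<open>e = - 1\<close> for the parity binomial edge ideal; both are generated by
  the forms \<open>x\<^sub>i x\<^sub>j + e y\<^sub>i y\<^sub>j\<close>, \<open>{i, j}\<close> an edge.  Let \<open>q\<close> be a prime containing the ideal \<open>I\<close> and let \<open>S\<close> be the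
  set of vertices \<open>i\<close> with \<open>x\<^sub>i, y\<^sub>i \<in> q\<close>.  Walking through a component of \<open>G - S\<close> from a root, each vertex
  other than the root yields one relation that is linear in one of its two variables, and the root of
  a non-bipartite component yields \<open>x\<^sup>2 + e y\<^sup>2\<close>.  Together with \<open>x\<^sub>s, y\<^sub>s\<close> for \<open>s \<in> S\<close> these are
  \<open>n + card S - b(S)\<close> elements of \<open>q\<close>, where \<open>b(S)\<close> is the number of bipartite components of \<open>G - S\<close>; their
  Jacobian matrix is triangular with diagonal entries outside \<open>q\<close>, so \<open>q\<close> has at least this height.
  If \<open>q\<close> is minimal over \<open>I\<close>, then \<open>q\<close> is stable under all one-parameter families of substitutions that
  preserve \<open>I\<close>.  Hence the remaining variables are algebraically independent modulo \<open>q\<close>, the height of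
  \<open>q\<close> is exactly \<open>n + card S - b(S)\<close>, and the elements above generate \<open>I\<close> locally at \<open>q\<close>.  So the local
  condition always holds, and \<open>I\<close> is an almost complete intersection iff the number of edges, which is
  \<open>n + 1\<close> here, exceeds the height by one, that is, iff \<open>card S - b(S)\<close> has minimum \<open>0\<close>.

  Two odd cycles joined by an edge carry a permutation of the vertices along edges all of whose cycles
  are odd, which gives \<open>b(S) \<le> card S\<close>.  For every other graph in question there is a set \<open>S\<close> of one or two
  vertices meeting all odd cycles such that \<open>G - S\<close> has more than \<open>card S\<close> components, as follows by
  counting the edges that meet \<open>S\<close>.
\<close>

section \<open>Evaluation homomorphisms\<close>

text \<open>The shape of the minimal primes depends on whether the field contains a square root of
  \<open>- e\<close>, so they are not classified: every step takes an arbitrary prime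
  \<open>q\<close> and only asks which of a few elements it contains. A closed odd walk at
  \<open>i\<close> puts \<open>x_i^2 + e y_i^2\<close> into \<open>q\<close>, while the root of a
  bipartite component stays unconstrained; this is the source of \<open>- b(S)\<close>.
  Characteristic 2 is excluded because this quadric has derivative \<open>2 x_i\<close> and because
  two sign choices must differ modulo \<open>q\<close>. The triangular chain bounds the height of
  every prime over the ideal from below; only the matching upper bound and the local generators need
  minimality. The explicit primes that bound the height of \<open>I\<close> from above are rational
  parametrizations over the bipartite components of \<open>G - S\<close>, as the other components
  may need the square root. Hence \<open>S\<close> has to meet all odd cycles there, even for two
  joined odd cycles, where the empty set has \<open>card S - b(S) = 0\<close> as well. For those, a
  bipartite component is never a union of odd orbits, so the permutation leads out of it into
  \<open>S\<close>, and injectivity gives \<open>b(S) \<le> card S\<close>.\<close>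

definition rhom :: "('a::comm_ring_1 \<Rightarrow> 'b::comm_ring_1) \<Rightarrow> bool" where
  "rhom f \<longleftrightarrow> f 0 = 0 \<and> f 1 = 1 \<and> (\<forall>x y. f (x + y) = f x + f y) \<and> (\<forall>x y. f (x * y) = f x * f y)"

lemma rhomD:
  assumes "rhom f"
  shows "f 0 = 0" "f 1 = 1" "f (x + y) = f x + f y" "f (x * y) = f x * f y"
  using assms by (auto simp: rhom_def)

lemma rhom_uminus: "rhom f \<Longrightarrow> f (- x) = - f x"
  by (metis add.right_inverse minus_unique rhomD(1,3))

lemma rhom_diff: "rhom f \<Longrightarrow> f (x - y) = f x - f y"
  using rhomD(3)[of f x "- y"] rhom_uminus[of f y] by simp

lemma rhom_sum: "rhom f \<Longrightarrow> f (sum g S) = (\<Sum>x\<in>S. f (g x))"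
  by (induction S rule: infinite_finite_induct) (auto simp: rhomD)

abbreviation mconst :: "'k::field \<Rightarrow> 'k mpoly" where
  "mconst c \<equiv> Poly_Mapping.single 0 c"

definition polys :: "lss_var set \<Rightarrow> 'k::field mpoly set" where
  "polys Xs = {p. indets p \<subseteq> Xs}"

lemma mconst_in_polys: "mconst c \<in> polys Xs"
  by (simp add: polys_def indets_def)

lemma mvar_in_polys: "mvar v \<in> polys Xs \<longleftrightarrow> v \<in> Xs"
  by (simp add: polys_def indets_def mvar_def)

lemma zero_in_polys: "0 \<in> polys Xs" and one_in_polys: "1 \<in> polys Xs"
  using mconst_in_polys[of 0] mconst_in_polys[of 1] by simp_all

lemma add_in_polys: "p \<in> polys Xs \<Longrightarrow> q \<in> polys Xs \<Longrightarrow> p + q \<in> polys Xs"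
  using indets_add_subset[of p q] by (auto simp: polys_def)

lemma mult_in_polys: "p \<in> polys Xs \<Longrightarrow> q \<in> polys Xs \<Longrightarrow> p * q \<in> polys Xs"
  using indets_mult_subset[of p q] by (auto simp: polys_def)

lemma uminus_in_polys: "p \<in> polys Xs \<Longrightarrow> - p \<in> polys Xs"
  by (auto simp: polys_def indets_uminus)

lemma diff_in_polys: "p \<in> polys Xs \<Longrightarrow> q \<in> polys Xs \<Longrightarrow> p - q \<in> polys Xs"
  using add_in_polys[of p Xs "- q"] uminus_in_polys[of q Xs] by simp

lemma sum_in_polys: "(\<And>i. i \<in> S \<Longrightarrow> f i \<in> polys Xs) \<Longrightarrow> sum f S \<in> polys Xs"
  by (induction S rule: infinite_finite_induct) (auto simp: zero_in_polys add_in_polys)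

lemma power_in_polys: "p \<in> polys Xs \<Longrightarrow> p ^ k \<in> polys Xs"
  by (induction k) (auto simp: one_in_polys mult_in_polys)

lemma polys_mono: "Xs \<subseteq> Ys \<Longrightarrow> p \<in> polys Xs \<Longrightarrow> p \<in> polys Ys"
  by (auto simp: polys_def)

lemma sum_monomials:
  fixes p :: "'a \<Rightarrow>\<^sub>0 'b::comm_monoid_add"
  shows "p = (\<Sum>m\<in>Poly_Mapping.keys p. Poly_Mapping.single m (Poly_Mapping.lookup p m))"
proof (rule poly_mapping_eqI)
  fix k
  show "Poly_Mapping.lookup p k =
     Poly_Mapping.lookup (\<Sum>m\<in>Poly_Mapping.keys p. Poly_Mapping.single m (Poly_Mapping.lookup p m)) k"
    by (auto simp: lookup_sum lookup_single when_def in_keys_iff)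
qed

lemma single_sum:
  "Poly_Mapping.single (\<Sum>i\<in>S. g i) 1 = (\<Prod>i\<in>S. Poly_Mapping.single (g i) (1::'k::field))"
proof (induction S rule: infinite_finite_induct)
  case (insert x F)
  have "Poly_Mapping.single (g x + sum g F) 1 = Poly_Mapping.single (g x) 1 * Poly_Mapping.single (sum g F) (1::'k)"
    by (simp add: mult_single)
  with insert show ?case by simp
qed auto

lemma single_power:
  "Poly_Mapping.single (Poly_Mapping.single v k) (1::'k::field) = mvar v ^ k"
proof (induction k)
  case (Suc k)
  have "Poly_Mapping.single v (Suc k) = Poly_Mapping.single v 1 + Poly_Mapping.single v k"
    by (simp flip: single_add)
  with Suc show ?case
    by (simp add: mvar_def mult_single flip: power_Suc)
      (metis Suc mult.right_neutral mult_single mvar_def power_Suc)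
qed simp

lemma single_eq_monomial:
  "Poly_Mapping.single m (c::'k::field) =
     mconst c * (\<Prod>v\<in>Poly_Mapping.keys m. mvar v ^ Poly_Mapping.lookup m v)"
proof -
  have "Poly_Mapping.single m (1::'k) = (\<Prod>v\<in>Poly_Mapping.keys m. mvar v ^ Poly_Mapping.lookup m v)"
    by (subst sum_monomials[of m]) (simp only: single_sum single_power)
  moreover have "Poly_Mapping.single m c = mconst c * Poly_Mapping.single m 1"
    by (simp add: mult_single)
  ultimately show ?thesis by simp
qed

text \<open>Membership in \<open>polys Xs\<close> is carried along, so the inductive cases may use
  it. Ring homomorphisms can then be compared on constants and variables alone.\<close>

lemma polys_induct [consumes 1, case_names const var add mult]:
  assumes p: "p \<in> polys Xs"
    and const: "\<And>c. P (mconst c)"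
    and var: "\<And>v. v \<in> Xs \<Longrightarrow> P (mvar v)"
    and add: "\<And>p q. p \<in> polys Xs \<Longrightarrow> q \<in> polys Xs \<Longrightarrow> P p \<Longrightarrow> P q \<Longrightarrow> P (p + q)"
    and mult: "\<And>p q. p \<in> polys Xs \<Longrightarrow> q \<in> polys Xs \<Longrightarrow> P p \<Longrightarrow> P q \<Longrightarrow> P (p * q)"
  shows "P p"
proof -
  define Q where "Q p \<longleftrightarrow> p \<in> polys Xs \<and> P p" for p
  have Q0: "Q 0" "Q 1" using const[of 0] const[of 1] by (simp_all add: Q_def zero_in_polys one_in_polys)
  have Qm: "Q (a * b)" if "Q a" "Q b" for a b
    using that mult by (auto simp: Q_def mult_in_polys)
  have Qa: "Q (a + b)" if "Q a" "Q b" for a b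
    using that add by (auto simp: Q_def add_in_polys)
  have Qpow: "Q (a ^ k)" if "Q a" for a k
    using that by (induction k) (auto simp: Q0 Qm)
  have Qprod: "Q (prod f S)" if "\<And>i. i \<in> S \<Longrightarrow> Q (f i)" for f and S :: "lss_var set"
    using that by (induction S rule: infinite_finite_induct) (auto simp: Q0 Qm)
  have Qsum: "Q (sum f S)" if "\<And>i. i \<in> S \<Longrightarrow> Q (f i)" for f and S :: "(lss_var \<Rightarrow>\<^sub>0 nat) set"
    using that by (induction S rule: infinite_finite_induct) (auto simp: Q0 Qa)
  have "Q p"
  proof (subst sum_monomials[of p], rule Qsum, subst single_eq_monomial, intro Qm Qprod Qpow)
    fix m v assume "m \<in> Poly_Mapping.keys p" "v \<in> Poly_Mapping.keys m"
    then have "v \<in> Xs" using p by (auto simp: polys_def indets_def)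
    then show "Q (mvar v)" using var by (simp add: Q_def mvar_in_polys)
  qed (simp add: Q_def mconst_in_polys const)
  then show ?thesis by (simp add: Q_def)
qed

text \<open>The coefficient map \<open>c\<close> is a parameter because three targets occur: the
  field itself, polynomials in \<open>T\<close> over the ring, and the fraction field.\<close>

definition ev :: "('k::field \<Rightarrow> 'r::comm_ring_1) \<Rightarrow> (lss_var \<Rightarrow> 'r) \<Rightarrow> 'k mpoly \<Rightarrow> 'r" where
  "ev c \<alpha> p = (\<Sum>m\<in>Poly_Mapping.keys p. c (Poly_Mapping.lookup p m) *
     (\<Prod>v\<in>Poly_Mapping.keys m. \<alpha> v ^ Poly_Mapping.lookup m v))"

context
  fixes c :: "'k::field \<Rightarrow> 'r::comm_ring_1" and \<alpha> :: "lss_var \<Rightarrow> 'r"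
  assumes c: "rhom c"
begin

text \<open>Zero coefficients contribute nothing, so the sum may range over any finite superset of
  the support; this gives two polynomials a common index set.\<close>

lemma ev_mono:
  assumes "finite S" "Poly_Mapping.keys p \<subseteq> S"
  shows "ev c \<alpha> p = (\<Sum>m\<in>S. c (Poly_Mapping.lookup p m) *
     (\<Prod>v\<in>Poly_Mapping.keys m. \<alpha> v ^ Poly_Mapping.lookup m v))"
  unfolding ev_def using assms
  by (intro sum.mono_neutral_left) (auto simp: in_keys_iff rhomD[OF c])

lemma ev_add: "ev c \<alpha> (p + q) = ev c \<alpha> p + ev c \<alpha> q"
proof -
  let ?S = "Poly_Mapping.keys p \<union> Poly_Mapping.keys q"
  show ?thesis
    by (simp add: ev_mono[of ?S] Poly_Mapping.keys_add lookup_add rhomD[OF c] distrib_right sum.distrib)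
qed

lemma ev_single:
  "ev c \<alpha> (Poly_Mapping.single m a) = c a * (\<Prod>v\<in>Poly_Mapping.keys m. \<alpha> v ^ Poly_Mapping.lookup m v)"
  by (subst ev_mono[of "{m}"]) auto

lemma ev_mconst: "ev c \<alpha> (mconst a) = c a"
  by (simp add: ev_single)

lemma ev_mvar: "ev c \<alpha> (mvar v) = \<alpha> v"
  by (simp add: ev_single mvar_def rhomD[OF c])

lemma ev_sum: "ev c \<alpha> (sum f S) = (\<Sum>i\<in>S. ev c \<alpha> (f i))"
  using ev_mconst[of 0] by (induction S rule: infinite_finite_induct) (auto simp: ev_add rhomD[OF c])

lemma ev_monomial_add:
  fixes m m' :: "lss_var \<Rightarrow>\<^sub>0 nat"
  shows "(\<Prod>v\<in>Poly_Mapping.keys (m + m'). \<alpha> v ^ Poly_Mapping.lookup (m + m') v) =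
    (\<Prod>v\<in>Poly_Mapping.keys m. \<alpha> v ^ Poly_Mapping.lookup m v) *
    (\<Prod>v\<in>Poly_Mapping.keys m'. \<alpha> v ^ Poly_Mapping.lookup m' v)"
proof -
  let ?S = "Poly_Mapping.keys m \<union> Poly_Mapping.keys m'"
  have *: "(\<Prod>v\<in>Poly_Mapping.keys l. \<alpha> v ^ Poly_Mapping.lookup l v) = (\<Prod>v\<in>?S. \<alpha> v ^ Poly_Mapping.lookup l v)"
    if "Poly_Mapping.keys l \<subseteq> ?S" for l :: "lss_var \<Rightarrow>\<^sub>0 nat"
    using that by (intro prod.mono_neutral_left) (auto simp: in_keys_iff)
  show ?thesis
    unfolding *[OF Un_upper1] *[OF Un_upper2] *[OF Poly_Mapping.keys_add]
    by (simp add: lookup_add power_add prod.distrib)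
qed

lemma ev_mult: "ev c \<alpha> (p * q) = ev c \<alpha> p * ev c \<alpha> q"
proof -
  have "p * q = (\<Sum>m\<in>Poly_Mapping.keys p. Poly_Mapping.single m (Poly_Mapping.lookup p m)) *
     (\<Sum>m\<in>Poly_Mapping.keys q. Poly_Mapping.single m (Poly_Mapping.lookup q m))"
    by (simp flip: sum_monomials)
  then have "ev c \<alpha> (p * q) = ev c \<alpha> \<dots>" by simp
  also have "\<dots> = (\<Sum>m\<in>Poly_Mapping.keys p. \<Sum>m'\<in>Poly_Mapping.keys q.
     ev c \<alpha> (Poly_Mapping.single m (Poly_Mapping.lookup p m)) *
     ev c \<alpha> (Poly_Mapping.single m' (Poly_Mapping.lookup q m')))"
    by (simp only: sum_product ev_sum mult_single ev_single ev_monomial_add rhomD[OF c] mult.assoc mult.left_commute)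
  also have "\<dots> = ev c \<alpha> p * ev c \<alpha> q"
    by (simp only: ev_single ev_def[of c \<alpha> p] ev_def[of c \<alpha> q] sum_product)
  finally show ?thesis .
qed

lemma rhom_ev: "rhom (ev c \<alpha>)"
  using ev_mconst[of 0] ev_mconst[of 1] by (simp add: rhom_def ev_add ev_mult rhomD[OF c])

end

lemma rhom_eqI:
  assumes p: "p \<in> polys Xs" and f: "rhom f" and g: "rhom g"
    and "\<And>a. f (mconst a) = g (mconst a)" "\<And>v. v \<in> Xs \<Longrightarrow> f (mvar v) = g (mvar v)"
  shows "f p = g p"
  using p by (induction rule: polys_induct) (auto simp: assms rhomD[OF f] rhomD[OF g])

lemma rhom_id: "rhom (\<lambda>x. x)"
  by (simp add: rhom_def)

lemma rhom_mconst: "rhom (mconst :: 'k::field \<Rightarrow> 'k mpoly)"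
  by (simp add: rhom_def single_add mult_single)

lemma rhom_comp: "rhom f \<Longrightarrow> rhom g \<Longrightarrow> rhom (\<lambda>x. f (g x))"
  by (simp add: rhom_def)

lemma rhom_pconst: "rhom (\<lambda>a::'a::comm_ring_1. [:a:])"
  by (simp add: rhom_def one_pCons)

lemma rhom_poly: "rhom (\<lambda>F. poly F c)"
  by (simp add: rhom_def)

lemma rhom_coeff_0: "rhom (\<lambda>F. poly.coeff F 0)"
  by (simp add: rhom_def coeff_mult)

section \<open>Prime ideals of subrings and substitutions with a parameter\<close>

text \<open>Subrings, ideals and primes are plain sets under the operations of the ambient type, so
  that computations use \<open>+\<close> and \<open>*\<close> directly;
  \<open>ideal_iff_ideal_in\<close> and \<open>primeideal_iff_prime_in\<close> translate to ring
  records.\<close>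

definition subring_in :: "'a::comm_ring_1 set \<Rightarrow> bool" where
  "subring_in A \<longleftrightarrow> 1 \<in> A \<and> (\<forall>a\<in>A. - a \<in> A) \<and> (\<forall>a\<in>A. \<forall>b\<in>A. a + b \<in> A) \<and> (\<forall>a\<in>A. \<forall>b\<in>A. a * b \<in> A)"

definition ideal_in :: "'a::comm_ring_1 set \<Rightarrow> 'a set \<Rightarrow> bool" where
  "ideal_in A p \<longleftrightarrow> p \<subseteq> A \<and> 0 \<in> p \<and> (\<forall>a\<in>p. \<forall>b\<in>p. a + b \<in> p) \<and> (\<forall>a\<in>A. \<forall>b\<in>p. a * b \<in> p)"

definition prime_in :: "'a::comm_ring_1 set \<Rightarrow> 'a set \<Rightarrow> bool" where
  "prime_in A p \<longleftrightarrow> ideal_in A p \<and> 1 \<notin> p \<and> (\<forall>a\<in>A. \<forall>b\<in>A. a * b \<in> p \<longrightarrow> a \<in> p \<or> b \<in> p)"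

lemma subring_inD:
  assumes "subring_in A"
  shows "1 \<in> A" "0 \<in> A" "a \<in> A \<Longrightarrow> - a \<in> A" "a \<in> A \<Longrightarrow> b \<in> A \<Longrightarrow> a + b \<in> A"
    "a \<in> A \<Longrightarrow> b \<in> A \<Longrightarrow> a * b \<in> A" "a \<in> A \<Longrightarrow> b \<in> A \<Longrightarrow> a - b \<in> A"
proof -
  show *: "1 \<in> A" and m: "\<And>a. a \<in> A \<Longrightarrow> - a \<in> A" and p: "\<And>a b. a \<in> A \<Longrightarrow> b \<in> A \<Longrightarrow> a + b \<in> A"
    and "a \<in> A \<Longrightarrow> b \<in> A \<Longrightarrow> a * b \<in> A"
    using assms by (auto simp: subring_in_def)
  show "0 \<in> A" using p[OF * m[OF *]] by simp
  show "a \<in> A \<Longrightarrow> b \<in> A \<Longrightarrow> a - b \<in> A" using p[of a "- b"] m by simp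
qed

lemma ideal_inD:
  assumes "ideal_in A p"
  shows "a \<in> p \<Longrightarrow> a \<in> A" "0 \<in> p" "a \<in> p \<Longrightarrow> b \<in> p \<Longrightarrow> a + b \<in> p" "c \<in> A \<Longrightarrow> b \<in> p \<Longrightarrow> c * b \<in> p"
    "c \<in> A \<Longrightarrow> b \<in> p \<Longrightarrow> b * c \<in> p"
  using assms by (auto simp: ideal_in_def mult.commute)

lemma ideal_in_diff:
  assumes "subring_in A" "ideal_in A p" "a \<in> p" "b \<in> p"
  shows "a - b \<in> p" "- a \<in> p"
proof -
  have *: "- x \<in> p" if "x \<in> p" for x
    using ideal_inD(4)[OF assms(2) subring_inD(3)[OF assms(1) subring_inD(1)[OF assms(1)]] that] by simp
  show "- a \<in> p" using *[OF assms(3)] .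
  show "a - b \<in> p" using ideal_inD(3)[OF assms(2) assms(3) *[OF assms(4)]] by simp
qed

lemma ideal_in_sum: "ideal_in A p \<Longrightarrow> (\<And>i. i \<in> S \<Longrightarrow> f i \<in> p) \<Longrightarrow> sum f S \<in> p"
  by (induction S rule: infinite_finite_induct) (auto simp: ideal_inD)

lemma subring_in_sum: "subring_in A \<Longrightarrow> (\<And>i. i \<in> S \<Longrightarrow> f i \<in> A) \<Longrightarrow> sum f S \<in> A"
  by (induction S rule: infinite_finite_induct) (auto simp: subring_inD)

lemma subring_in_power: "subring_in A \<Longrightarrow> a \<in> A \<Longrightarrow> a ^ k \<in> A"
  by (induction k) (auto simp: subring_inD)

lemma prime_inD:
  assumes "prime_in A p"
  shows "ideal_in A p" "1 \<notin> p" "a \<in> A \<Longrightarrow> b \<in> A \<Longrightarrow> a * b \<in> p \<Longrightarrow> a \<in> p \<or> b \<in> p"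
  using assms by (auto simp: prime_in_def)

lemma prime_in_power: "subring_in A \<Longrightarrow> prime_in A p \<Longrightarrow> a \<in> A \<Longrightarrow> a ^ k \<in> p \<Longrightarrow> a \<in> p"
  by (induction k) (auto dest: prime_inD subring_in_power)

lemma prime_in_contract:
  assumes "subring_in A" "rhom f" "prime_in B p" "f ` A \<subseteq> B"
  shows "prime_in A {a \<in> A. f a \<in> p}"
proof -
  note id = prime_inD(1)[OF assms(3)]
  have B: "f a \<in> B" if "a \<in> A" for a using assms(4) that by blast
  show ?thesis
    unfolding prime_in_def ideal_in_def
  proof (intro conjI ballI impI)
    fix a b assume "a \<in> A" "b \<in> A" "a * b \<in> {a \<in> A. f a \<in> p}"
    then show "a \<in> {a \<in> A. f a \<in> p} \<or> b \<in> {a \<in> A. f a \<in> p}"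
      using prime_inD(3)[OF assms(3), of "f a" "f b"] B by (simp add: rhomD[OF assms(2)])
  next
    fix a b assume "a \<in> A" "b \<in> {a \<in> A. f a \<in> p}"
    then show "a * b \<in> {a \<in> A. f a \<in> p}"
      using ideal_inD(4)[OF id, of "f a" "f b"] B by (simp add: rhomD[OF assms(2)] subring_inD[OF assms(1)])
  next
    fix a b assume "a \<in> {a \<in> A. f a \<in> p}" "b \<in> {a \<in> A. f a \<in> p}"
    then show "a + b \<in> {a \<in> A. f a \<in> p}"
      using ideal_inD(3)[OF id, of "f a" "f b"] by (simp add: rhomD[OF assms(2)] subring_inD[OF assms(1)])
  qed (use prime_inD(2)[OF assms(3)] ideal_inD(2)[OF id] subring_inD[OF assms(1)] in
      \<open>auto simp: rhomD[OF assms(2)]\<close>)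
qed

lemma cring_subring_in: "subring_in A \<Longrightarrow> cring (ring_of_type_algebra\<lparr>carrier := A\<rparr>)"
  by (rule cring_of_type_algebra_carrier_update) (auto simp: subring_in_def)

lemma ideal_iff_ideal_in:
  assumes "subring_in A"
  shows "ideal p (ring_of_type_algebra\<lparr>carrier := A\<rparr>) \<longleftrightarrow> ideal_in A p"
proof -
  let ?R = "ring_of_type_algebra\<lparr>carrier := A\<rparr>"
  interpret cring ?R by (rule cring_subring_in[OF assms])
  have ops: "x \<otimes>\<^bsub>?R\<^esub> y = x * y" "x \<oplus>\<^bsub>?R\<^esub> y = x + y" "\<one>\<^bsub>?R\<^esub> = 1" "\<zero>\<^bsub>?R\<^esub> = 0" "carrier ?R = A" for x y
    by (simp_all add: ring_of_type_algebra_def)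
  have minus: "\<ominus>\<^bsub>?R\<^esub> a = - a" if "a \<in> A" for a
    by (rule minus_equality) (simp_all add: that subring_inD[OF assms], simp add: ring_of_type_algebra_def)
  show ?thesis
  proof
    assume "ideal p ?R"
    then interpret I: ideal p ?R .
    show "ideal_in A p"
      unfolding ideal_in_def
    proof (intro conjI ballI)
      show "p \<subseteq> A" "0 \<in> p" using I.a_subset I.zero_closed unfolding ops .
      show "a + b \<in> p" if "a \<in> p" "b \<in> p" for a b
        using I.a_closed[OF that] unfolding ops .
      show "a * b \<in> p" if "a \<in> A" "b \<in> p" for a b
        using I.I_l_closed[OF that(2), of a] that(1) unfolding ops by blast
    qed
  next
    assume p: "ideal_in A p"
    show "ideal p ?R"
    proof (rule idealI)
      show "subgroup p (add_monoid ?R)"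
      proof (rule group.subgroupI[OF a_group])
        show "inv\<^bsub>add_monoid ?R\<^esub> a \<in> p" if "a \<in> p" for a
          using minus[of a] ideal_inD(1)[OF p that] ideal_in_diff(2)[OF assms p that that]
          unfolding a_inv_def by simp
        show "a \<otimes>\<^bsub>add_monoid ?R\<^esub> b \<in> p" if "a \<in> p" "b \<in> p" for a b
          using ideal_inD(3)[OF p that] by (simp add: ring_of_type_algebra_def)
        show "p \<subseteq> carrier (add_monoid ?R)" using ideal_inD(1)[OF p] by auto
        show "p \<noteq> {}" using ideal_inD(2)[OF p] by blast
      qed
      show "x \<otimes>\<^bsub>?R\<^esub> a \<in> p" "a \<otimes>\<^bsub>?R\<^esub> x \<in> p" if "a \<in> p" "x \<in> carrier ?R" for a x
        using ideal_inD(4,5)[OF p _ that(1), of x] that(2) unfolding ops by blast+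
    qed (rule ring_axioms)
  qed
qed

lemma primeideal_iff_prime_in:
  assumes "subring_in A"
  shows "primeideal p (ring_of_type_algebra\<lparr>carrier := A\<rparr>) \<longleftrightarrow> prime_in A p"
proof -
  let ?R = "ring_of_type_algebra\<lparr>carrier := A\<rparr>"
  interpret cring ?R by (rule cring_subring_in[OF assms])
  have ops: "x \<otimes>\<^bsub>?R\<^esub> y = x * y" "\<one>\<^bsub>?R\<^esub> = 1" "carrier ?R = A" for x y
    by (simp_all add: ring_of_type_algebra_def)
  show ?thesis
  proof
    assume "primeideal p ?R"
    then interpret I: primeideal p ?R .
    have "ideal_in A p" using I.is_ideal by (simp add: ideal_iff_ideal_in[OF assms])
    moreover have "1 \<notin> p" using I.one_imp_carrier I.I_notcarr by (auto simp: ops)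
    moreover have "a \<in> p \<or> b \<in> p" if "a \<in> A" "b \<in> A" "a * b \<in> p" for a b
      using I.I_prime[of a b] that unfolding ops by blast
    ultimately show "prime_in A p" by (auto simp: prime_in_def)
  next
    assume p: "prime_in A p"
    show "primeideal p ?R"
    proof (rule primeidealI)
      show "ideal p ?R" using prime_inD(1)[OF p] by (simp add: ideal_iff_ideal_in[OF assms])
      show "carrier ?R \<noteq> p" using prime_inD(2)[OF p] subring_inD(1)[OF assms] by (auto simp: ops)
      show "a \<in> p \<or> b \<in> p" if "a \<in> carrier ?R" "b \<in> carrier ?R" "a \<otimes>\<^bsub>?R\<^esub> b \<in> p" for a b
        using prime_inD(3)[OF p, of a b] that unfolding ops by blast
    qed (rule is_cring)
  qed
qed

lemma Idl_eq_sums: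
  assumes A: "subring_in A" and B: "finite B" "B \<subseteq> A"
  shows "Idl\<^bsub>ring_of_type_algebra\<lparr>carrier := A\<rparr>\<^esub> B = {\<Sum>b\<in>B. c b * b | c. \<forall>b\<in>B. c b \<in> A}" (is "Idl\<^bsub>?R\<^esub> B = ?I")
proof
  interpret cring ?R by (rule cring_subring_in[OF A])
  have carr: "carrier ?R = A" by simp
  have id: "ideal_in A (Idl\<^bsub>?R\<^esub> B)" using genideal_ideal[of B] B ideal_iff_ideal_in[OF A] by simp
  show "?I \<subseteq> Idl\<^bsub>?R\<^esub> B"
    using genideal_self[of B] B by (auto intro!: ideal_in_sum[OF id] ideal_inD(4)[OF id])
  have "ideal_in A ?I"
    unfolding ideal_in_def
  proof (intro conjI ballI)
    show "?I \<subseteq> A" using B by (auto intro!: subring_in_sum[OF A] subring_inD[OF A])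
    show "0 \<in> ?I" using subring_inD(2)[OF A] by (intro CollectI exI[of _ "\<lambda>_. 0"]) simp
  next
    fix a b assume "a \<in> ?I" "b \<in> ?I"
    then obtain c d where "a = (\<Sum>b\<in>B. c b * b)" "b = (\<Sum>b\<in>B. d b * b)" "\<forall>b\<in>B. c b \<in> A" "\<forall>b\<in>B. d b \<in> A"
      by blast
    then have "a + b = (\<Sum>b\<in>B. (c b + d b) * b)" "\<forall>b\<in>B. c b + d b \<in> A"
      using subring_inD[OF A] by (auto simp: distrib_right sum.distrib)
    then show "a + b \<in> ?I" by (intro CollectI exI[of _ "\<lambda>b. c b + d b"]) simp
  next
    fix a b assume "a \<in> A" "b \<in> ?I"
    then obtain d where "b = (\<Sum>b\<in>B. d b * b)" "\<forall>b\<in>B. d b \<in> A"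
      by blast
    with \<open>a \<in> A\<close> have "a * b = (\<Sum>b\<in>B. (a * d b) * b)" "\<forall>b\<in>B. a * d b \<in> A"
      using subring_inD[OF A] by (auto simp: sum_distrib_left mult.assoc)
    then show "a * b \<in> ?I" by (intro CollectI exI[of _ "\<lambda>b. a * d b"]) simp
  qed
  moreover have "B \<subseteq> ?I"
  proof
    fix x assume x: "x \<in> B"
    have "x = (\<Sum>b\<in>B. (if b = x then 1 else 0) * b)"
      using x B(1) by (simp add: if_distrib[of "\<lambda>c. c * _"] sum.delta' cong: if_cong)
    moreover have "\<forall>b\<in>B. (if b = x then 1 else 0) \<in> A"
      using subring_inD[OF A] by simp
    ultimately show "x \<in> ?I" by (intro CollectI exI[of _ "\<lambda>b. if b = x then 1 else 0"]) simp
  qed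
  ultimately show "Idl\<^bsub>?R\<^esub> B \<subseteq> ?I"
    using genideal_minimal[of ?I B] by (simp add: ideal_iff_ideal_in[OF A])
qed

lemma Idl_subset_iff:
  assumes A: "subring_in A" and B: "B \<subseteq> A" and p: "ideal_in A p"
  shows "Idl\<^bsub>ring_of_type_algebra\<lparr>carrier := A\<rparr>\<^esub> B \<subseteq> p \<longleftrightarrow> B \<subseteq> p"
proof -
  interpret cring "ring_of_type_algebra\<lparr>carrier := A\<rparr>" by (rule cring_subring_in[OF A])
  have "ideal p (ring_of_type_algebra\<lparr>carrier := A\<rparr>)" using p ideal_iff_ideal_in[OF A] by blast
  then show ?thesis
    using genideal_self[of B] genideal_minimal[of p B] B by auto
qed

lemma ideal_in_Idl:
  assumes A: "subring_in A" and B: "B \<subseteq> A"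
  shows "ideal_in A (Idl\<^bsub>ring_of_type_algebra\<lparr>carrier := A\<rparr>\<^esub> B)"
    "B \<subseteq> Idl\<^bsub>ring_of_type_algebra\<lparr>carrier := A\<rparr>\<^esub> B"
proof -
  interpret cring "ring_of_type_algebra\<lparr>carrier := A\<rparr>" by (rule cring_subring_in[OF A])
  show "ideal_in A (Idl\<^bsub>ring_of_type_algebra\<lparr>carrier := A\<rparr>\<^esub> B)"
    "B \<subseteq> Idl\<^bsub>ring_of_type_algebra\<lparr>carrier := A\<rparr>\<^esub> B"
    using genideal_self[of B] genideal_ideal[of B] B ideal_iff_ideal_in[OF A] by auto
qed

lemma subring_in_polys: "subring_in (polys Vs)"
  by (simp add: subring_in_def one_in_polys uminus_in_polys add_in_polys mult_in_polys)

text \<open>\<open>pT p\<close> is the extension \<open>p[T]\<close>, and \<open>pull Vs \<beta> p\<close> is the preimage of \<open>p[T]\<close> under the substitution \<open>\<beta>\<close>.\<close>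

definition pT :: "'a::comm_ring_1 set \<Rightarrow> 'a poly set" where
  "pT p = {F. \<forall>i. poly.coeff F i \<in> p}"

lemma subring_in_pT:
  assumes "subring_in A"
  shows "subring_in (pT A)"
  unfolding subring_in_def
proof (intro conjI ballI)
  show "1 \<in> pT A" using subring_inD[OF assms] by (simp add: pT_def of_bool_def)
qed (auto simp: pT_def coeff_mult subring_inD[OF assms] intro!: subring_in_sum[OF assms])

text \<open>Gauss's argument: with \<open>i\<close> and \<open>j\<close> the lowest indices of
  coefficients outside \<open>p\<close>, the coefficient of \<open>F * G\<close> at
  \<open>i + j\<close> is the product of these two plus terms in \<open>p\<close>.\<close>

lemma prime_in_pT:
  assumes A: "subring_in A" and p: "prime_in A p"
  shows "prime_in (pT A) (pT p)"
proof -
  note id = prime_inD(1)[OF p]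
  have "F \<in> pT p \<or> G \<in> pT p" if FG: "F \<in> pT A" "G \<in> pT A" "F * G \<in> pT p" for F G
  proof (rule ccontr)
    assume "\<not> (F \<in> pT p \<or> G \<in> pT p)"
    then have ex: "\<exists>i. poly.coeff F i \<notin> p" "\<exists>i. poly.coeff G i \<notin> p" by (auto simp: pT_def)
    define i j where "i = (LEAST i. poly.coeff F i \<notin> p)" and "j = (LEAST j. poly.coeff G j \<notin> p)"
    have i: "poly.coeff F i \<notin> p" "\<And>k. k < i \<Longrightarrow> poly.coeff F k \<in> p"
      unfolding i_def using LeastI_ex[OF ex(1)] by (auto dest: not_less_Least)
    have j: "poly.coeff G j \<notin> p" "\<And>k. k < j \<Longrightarrow> poly.coeff G k \<in> p"
      unfolding j_def using LeastI_ex[OF ex(2)] by (auto dest: not_less_Least)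
    have cA: "poly.coeff F k \<in> A" "poly.coeff G k \<in> A" for k
      using FG by (auto simp: pT_def)
    have "(\<Sum>k\<in>{..i + j} - {i}. poly.coeff F k * poly.coeff G (i + j - k)) \<in> p"
    proof (rule ideal_in_sum[OF id])
      fix k assume "k \<in> {..i + j} - {i}"
      then have "k < i \<or> i + j - k < j" by auto
      then show "poly.coeff F k * poly.coeff G (i + j - k) \<in> p"
        using i(2) j(2) ideal_inD(4,5)[OF id] cA by blast
    qed
    moreover have "poly.coeff (F * G) (i + j) \<in> p" using FG(3) by (simp add: pT_def)
    moreover have "poly.coeff (F * G) (i + j) = poly.coeff F i * poly.coeff G j +
        (\<Sum>k\<in>{..i + j} - {i}. poly.coeff F k * poly.coeff G (i + j - k))"
      unfolding coeff_mult by (subst sum.remove[of _ i]) auto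
    ultimately have "poly.coeff F i * poly.coeff G j \<in> p"
      using ideal_in_diff(1)[OF A id, of "poly.coeff (F * G) (i + j)"
          "\<Sum>k\<in>{..i + j} - {i}. poly.coeff F k * poly.coeff G (i + j - k)"] by simp
    then show False using prime_inD(3)[OF p] i(1) j(1) cA by blast
  qed
  moreover have "ideal_in (pT A) (pT p)"
    by (auto simp: ideal_in_def pT_def coeff_mult ideal_inD(1,2,3)[OF id] intro!: ideal_in_sum[OF id] ideal_inD(4)[OF id])
  moreover have "1 \<notin> pT p"
    using prime_inD(2)[OF p] by (auto simp: pT_def intro!: exI[of _ 0])
  ultimately show ?thesis by (auto simp: prime_in_def)
qed

lemma pconst_in_pT: "0 \<in> p \<Longrightarrow> [:a:] \<in> pT p \<longleftrightarrow> a \<in> p"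
  by (auto simp: pT_def coeff_pCons split: nat.splits)

lemma pCons_in_pT: "pCons a F \<in> pT p \<longleftrightarrow> a \<in> p \<and> F \<in> pT p"
  by (auto simp: pT_def coeff_pCons split: nat.splits)

lemma zero_in_pT: "0 \<in> p \<Longrightarrow> 0 \<in> pT p"
  by (simp add: pT_def)

lemma poly_in_ideal:
  assumes "subring_in A" "ideal_in A p" "F \<in> pT p" "c \<in> A"
  shows "poly F c \<in> p"
  unfolding poly_altdef using assms
  by (auto intro!: ideal_in_sum[OF assms(2)] ideal_inD(5)[OF assms(2)] subring_in_power simp: pT_def)

definition pev :: "(lss_var \<Rightarrow> 'k::field mpoly poly) \<Rightarrow> 'k mpoly \<Rightarrow> 'k mpoly poly" where
  "pev \<beta> = ev (\<lambda>a. [:mconst a:]) \<beta>"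

lemma rhom_pmconst: "rhom (\<lambda>a::'k::field. [:mconst a:])"
  by (rule rhom_comp[OF rhom_pconst rhom_mconst])

lemma rhom_pev: "rhom (pev \<beta>)"
  unfolding pev_def by (rule rhom_ev[OF rhom_pmconst])

lemma pev_mvar: "pev \<beta> (mvar v) = \<beta> v"
  unfolding pev_def by (rule ev_mvar[OF rhom_pmconst])

lemma pev_mconst: "pev \<beta> (mconst a) = [:mconst a:]"
  unfolding pev_def by (rule ev_mconst[OF rhom_pmconst])

lemma pev_in_pT:
  assumes "g \<in> polys Vs" "\<And>v. v \<in> Vs \<Longrightarrow> \<beta> v \<in> pT (polys Ws)"
  shows "pev \<beta> g \<in> pT (polys Ws)"
  using assms(1)
  by (induction rule: polys_induct)
    (auto simp: assms rhomD[OF rhom_pev] pev_mvar pev_mconst pconst_in_pT zero_in_polys mconst_in_polys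
      subring_inD[OF subring_in_pT[OF subring_in_polys]])

lemma pev_fix:
  assumes "g \<in> polys Vs" "\<And>v. v \<in> Vs \<Longrightarrow> \<beta> v = [:mvar v:]"
  shows "pev \<beta> g = [:g:]"
  by (rule rhom_eqI[OF assms(1) rhom_pev rhom_pconst]) (auto simp: assms pev_mvar pev_mconst)

definition pull :: "lss_var set \<Rightarrow> (lss_var \<Rightarrow> 'k::field mpoly poly) \<Rightarrow> 'k mpoly set \<Rightarrow> 'k mpoly set" where
  "pull Vs \<beta> p = {g \<in> polys Vs. pev \<beta> g \<in> pT p}"

lemma prime_in_pull:
  assumes "prime_in (polys Vs) p" "\<And>v. v \<in> Vs \<Longrightarrow> \<beta> v \<in> pT (polys Vs)"
  shows "prime_in (polys Vs) (pull Vs \<beta> p)"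
  unfolding pull_def
  by (rule prime_in_contract[OF subring_in_polys rhom_pev prime_in_pT[OF subring_in_polys assms(1)]])
    (auto intro: pev_in_pT assms)

text \<open>Substituting \<open>\<beta>\<close> and then setting \<open>T = c\<close> is a ring
  homomorphism that agrees with the identity modulo \<open>p\<close> on variables, hence on all of
  \<open>polys Vs\<close>; and setting \<open>T = c\<close> sends \<open>p[T]\<close> into
  \<open>p\<close>.\<close>

lemma pull_subset:
  assumes p: "prime_in (polys Vs) p" and \<beta>: "\<And>v. v \<in> Vs \<Longrightarrow> \<beta> v \<in> pT (polys Vs)"
    and c: "c \<in> polys Vs" and spec: "\<And>v. v \<in> Vs \<Longrightarrow> poly (\<beta> v) c - mvar v \<in> p"
  shows "pull Vs \<beta> p \<subseteq> p"
proof
  note id = prime_inD(1)[OF p]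
  fix g assume "g \<in> pull Vs \<beta> p"
  then have g: "g \<in> polys Vs" "pev \<beta> g \<in> pT p" by (auto simp: pull_def)
  have cl: "poly (pev \<beta> h) c \<in> polys Vs" if "h \<in> polys Vs" for h
    using pev_in_pT[OF that \<beta>] c unfolding poly_altdef
    by (auto intro!: sum_in_polys mult_in_polys power_in_polys simp: pT_def)
  have "poly (pev \<beta> g) c - g \<in> p"
    using g(1)
  proof (induction rule: polys_induct)
    case (add a b)
    then have "(poly (pev \<beta> a) c - a) + (poly (pev \<beta> b) c - b) \<in> p" using ideal_inD(3)[OF id] by blast
    then show ?case by (simp add: rhomD[OF rhom_pev] algebra_simps)
  next
    case (mult a b)
    then have "poly (pev \<beta> b) c * (poly (pev \<beta> a) c - a) + a * (poly (pev \<beta> b) c - b) \<in> p"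
      using ideal_inD(3)[OF id ideal_inD(4)[OF id cl] ideal_inD(4)[OF id]] by blast
    then show ?case by (simp add: rhomD[OF rhom_pev] algebra_simps)
  qed (auto simp: pev_mconst pev_mvar spec ideal_inD(2)[OF id])
  moreover have "poly (pev \<beta> g) c \<in> p" by (rule poly_in_ideal[OF subring_in_polys id g(2) c])
  ultimately have "poly (pev \<beta> g) c - (poly (pev \<beta> g) c - g) \<in> p"
    using ideal_in_diff(1)[OF subring_in_polys id] by blast
  then show "g \<in> p" by simp
qed

text \<open>The partial derivative is the coefficient of \<open>T\<close> after substituting \<open>z + T\<close> for \<open>z\<close>.\<close>

definition shiftb :: "lss_var \<Rightarrow> lss_var \<Rightarrow> 'k::field mpoly poly" where
  "shiftb z v = (if v = z then [:mvar z, 1:] else [:mvar v:])"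

definition pder :: "lss_var \<Rightarrow> 'k::field mpoly \<Rightarrow> 'k mpoly" where
  "pder z g = poly.coeff (pev (shiftb z) g) 1"

lemma shiftb_in_pT: "v \<in> Vs \<Longrightarrow> shiftb z v \<in> pT (polys Vs)"
  by (auto simp: shiftb_def pCons_in_pT zero_in_pT zero_in_polys one_in_polys mvar_in_polys)

lemma coeff_0_shift: "poly.coeff (pev (shiftb z) g) 0 = g"
proof -
  have "g \<in> polys UNIV" by (simp add: polys_def)
  then show ?thesis
    using rhom_eqI[OF _ rhom_comp[OF rhom_coeff_0 rhom_pev[of "shiftb z"]] rhom_id, of g UNIV]
    by (auto simp: pev_mvar pev_mconst shiftb_def)
qed

lemma pder_add: "pder z (a + b) = pder z a + pder z b"
  by (simp add: pder_def rhomD[OF rhom_pev])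

lemma pder_mult: "pder z (a * b) = pder z a * b + a * pder z b"
  by (simp add: pder_def rhomD[OF rhom_pev] coeff_mult coeff_0_shift)

lemma pder_diff: "pder z (a - b) = pder z a - pder z b"
  by (simp add: pder_def rhom_diff[OF rhom_pev])

lemma pder_sum: "pder z (sum f S) = (\<Sum>i\<in>S. pder z (f i))"
  by (simp add: pder_def rhom_sum[OF rhom_pev] coeff_sum)

lemma pder_mvar: "pder z (mvar v) = (if v = z then 1 else 0)"
  by (simp add: pder_def pev_mvar shiftb_def)

lemma pder_mconst: "pder z (mconst a) = 0"
  by (simp add: pder_def pev_mconst)

lemma shift_free: "g \<in> polys Vs \<Longrightarrow> z \<notin> Vs \<Longrightarrow> pev (shiftb z) g = [:g:]"
  by (rule pev_fix) (auto simp: shiftb_def)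

lemma pder_free: "g \<in> polys Vs \<Longrightarrow> z \<notin> Vs \<Longrightarrow> pder z g = 0"
  by (simp add: pder_def shift_free)

lemma pder_in_polys: "g \<in> polys Vs \<Longrightarrow> pder z g \<in> polys Vs"
  using pev_in_pT[of g Vs "shiftb z" Vs] shiftb_in_pT by (auto simp: pder_def pT_def)

section \<open>Lengths of chains of primes\<close>

text \<open>Fraction-free Gaussian elimination over the domain \<open>A / p\<close>: more rows than
  columns force a nontrivial relation. It serves for plain linear algebra over the field, with
  \<open>p = {0}\<close>, and for the Jacobian argument modulo \<open>q\<close>.\<close>

lemma lin_dep_mod_prime:
  assumes A: "subring_in A" and p: "prime_in A p"
    and "finite M" "finite I" "card M < card I" "\<And>i m. i \<in> I \<Longrightarrow> m \<in> M \<Longrightarrow> c i m \<in> A"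
  shows "\<exists>w. (\<forall>i\<in>I. w i \<in> A) \<and> (\<exists>i\<in>I. w i \<notin> p) \<and> (\<forall>m\<in>M. (\<Sum>i\<in>I. w i * c i m) \<in> p)"
  using assms(3-6)
proof (induction M arbitrary: I c rule: finite_induct)
  case empty
  then have "I \<noteq> {}" by auto
  then show ?case
    using subring_inD(1)[OF A] prime_inD(2)[OF p] by (intro exI[of _ "\<lambda>_. 1"]) auto
next
  case (insert m0 M)
  note id = prime_inD(1)[OF p]
  show ?case
  proof (cases "\<forall>i\<in>I. c i m0 \<in> p")
    case True
    from insert.hyps insert.prems(1,2) have "card M < card I" by simp
    with insert.IH[OF insert.prems(1) this] insert.prems(3) obtain w
      where w: "\<forall>i\<in>I. w i \<in> A" "\<exists>i\<in>I. w i \<notin> p" "\<forall>m\<in>M. (\<Sum>i\<in>I. w i * c i m) \<in> p" by blast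
    moreover have "(\<Sum>i\<in>I. w i * c i m0) \<in> p"
      using True w(1) by (intro ideal_in_sum[OF id] ideal_inD(4)[OF id]) auto
    ultimately show ?thesis by blast
  next
    case False
    then obtain i0 where i0: "i0 \<in> I" "c i0 m0 \<notin> p" by blast
    define J where "J = I - {i0}"
    have J: "finite J" "i0 \<notin> J" "I = insert i0 J" "card M < card J"
      using insert.prems(1,2) insert.hyps i0 by (auto simp: J_def card_Diff_singleton)
    \<comment> \<open>Row \<open>i\<close> after clearing column \<open>m0\<close> with the pivot
      \<open>c i0 m0\<close>; its entry at \<open>m0\<close> vanishes.\<close>
    define d where "d i m = c i0 m0 * c i m - c i m0 * c i0 m" for i m
    have "d i m \<in> A" if "i \<in> J" "m \<in> M" for i m
      using that insert.prems(3) J(3) i0 by (auto simp: d_def intro!: subring_inD[OF A])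
    with insert.IH[OF J(1,4), of d] obtain w
      where w: "\<forall>i\<in>J. w i \<in> A" "\<exists>i\<in>J. w i \<notin> p" "\<forall>m\<in>M. (\<Sum>i\<in>J. w i * d i m) \<in> p" by blast
    \<comment> \<open>The pivot row collects the subtracted multiples, which turns the relation
      between the rows of \<open>d\<close> into one between those of \<open>c\<close>.\<close>
    define v where "v i = (if i = i0 then - (\<Sum>i\<in>J. w i * c i m0) else w i * c i0 m0)" for i
    have sum_v: "(\<Sum>i\<in>I. v i * c i m) = (\<Sum>i\<in>J. w i * d i m)" for m
    proof -
      have "(\<Sum>i\<in>J. v i * c i m) = (\<Sum>i\<in>J. w i * c i0 m0 * c i m)"
        using J(2) by (intro sum.cong) (auto simp: v_def)
      then have "(\<Sum>i\<in>I. v i * c i m) = (\<Sum>i\<in>J. w i * c i0 m0 * c i m) - (\<Sum>i\<in>J. w i * c i m0) * c i0 m"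
        using J(1,2) unfolding J(3) by (simp add: v_def)
      also have "\<dots> = (\<Sum>i\<in>J. w i * d i m)"
        by (simp add: d_def sum_distrib_right right_diff_distrib sum_subtractf mult.assoc)
      finally show ?thesis .
    qed
    have "v i \<in> A" if "i \<in> I" for i
      using that w(1) insert.prems(3) i0 J(3)
      by (auto simp: v_def intro!: subring_inD[OF A] subring_in_sum[OF A])
    moreover have "\<exists>i\<in>I. v i \<notin> p"
    proof -
      obtain i where i: "i \<in> J" "w i \<notin> p" using w(2) by blast
      then have "w i * c i0 m0 \<notin> p"
        using prime_inD(3)[OF p, of "w i" "c i0 m0"] i0 w(1) insert.prems(3) by auto
      moreover have "i \<in> I" "i \<noteq> i0" using i J by auto
      ultimately show ?thesis by (intro bexI[of _ i]) (auto simp: v_def)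
    qed
    moreover have "(\<Sum>i\<in>I. v i * c i m0) \<in> p"
      unfolding sum_v d_def using ideal_inD(2)[OF id] by (simp add: mult.commute)
    ultimately show ?thesis using w(3) unfolding sum_v[symmetric]
      by (intro exI[of _ v]) auto
  qed
qed

section \<open>Counting linearly independent products against monomials of bounded exponents\<close>

text \<open>Each exponent is bounded separately instead of the total degree: the count is then an
  exact power, and the bounds add up in products.\<close>

definition box_monomials :: "lss_var set \<Rightarrow> nat \<Rightarrow> (lss_var \<Rightarrow>\<^sub>0 nat) set" where
  "box_monomials W b = {m. Poly_Mapping.keys m \<subseteq> W \<and> (\<forall>v. Poly_Mapping.lookup m v \<le> b)}"

lemma card_box_monomials:
  assumes "finite W"
  shows "finite (box_monomials W b)" "card (box_monomials W b) = Suc b ^ card W"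
proof -
  have "bij_betw (\<lambda>m. restrict (Poly_Mapping.lookup m) W) (box_monomials W b) (W \<rightarrow>\<^sub>E {..b})"
  proof (rule bij_betw_byWitness[where f' = "\<lambda>f. Abs_poly_mapping (\<lambda>v. if v \<in> W then f v else 0)"])
    have fin: "finite {v. (if v \<in> W then f v else 0) \<noteq> (0::nat)}" for f
      using assms by (rule finite_subset[rotated]) auto
    have look: "Poly_Mapping.lookup (Abs_poly_mapping (\<lambda>v. if v \<in> W then f v else 0)) v = (if v \<in> W then f v else (0::nat))" for f v
      using fin[of f] by simp
    show "\<forall>m\<in>box_monomials W b. Abs_poly_mapping (\<lambda>v. if v \<in> W then restrict (Poly_Mapping.lookup m) W v else 0) = m"
    proof
      fix m assume m: "m \<in> box_monomials W b"
      show "Abs_poly_mapping (\<lambda>v. if v \<in> W then restrict (Poly_Mapping.lookup m) W v else 0) = m"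
        using m by (intro poly_mapping_eqI, subst look) (auto simp: box_monomials_def in_keys_iff)
    qed
    show "\<forall>f\<in>W \<rightarrow>\<^sub>E {..b}. restrict (Poly_Mapping.lookup (Abs_poly_mapping (\<lambda>v. if v \<in> W then f v else 0))) W = f"
      unfolding look by (auto simp: fun_eq_iff restrict_def PiE_def extensional_def)
    show "(\<lambda>m. restrict (Poly_Mapping.lookup m) W) ` box_monomials W b \<subseteq> W \<rightarrow>\<^sub>E {..b}"
      by (auto simp: box_monomials_def)
    show "(\<lambda>f. Abs_poly_mapping (\<lambda>v. if v \<in> W then f v else 0)) ` (W \<rightarrow>\<^sub>E {..b}) \<subseteq> box_monomials W b"
      by (auto simp: box_monomials_def in_keys_iff look split: if_splits)
  qed
  from bij_betw_finite[OF this] bij_betw_same_card[OF this]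
  show "finite (box_monomials W b)" "card (box_monomials W b) = Suc b ^ card W"
    by (simp_all add: finite_PiE[OF assms] card_PiE[OF assms])
qed

definition exp_le :: "nat \<Rightarrow> 'k::field mpoly \<Rightarrow> bool" where
  "exp_le b g \<longleftrightarrow> (\<forall>m\<in>Poly_Mapping.keys g. \<forall>v. Poly_Mapping.lookup m v \<le> b)"

lemma exp_le_mult: "exp_le a f \<Longrightarrow> exp_le b g \<Longrightarrow> exp_le (a + b) (f * g)"
  using keys_mult[of f g] by (fastforce simp: exp_le_def lookup_add intro: add_mono)

lemma exp_le_mono: "exp_le a f \<Longrightarrow> a \<le> b \<Longrightarrow> exp_le b f"
  by (auto simp: exp_le_def intro: order_trans)

lemma exp_le_power: "exp_le a f \<Longrightarrow> exp_le (k * a) (f ^ k)"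
  by (induction k) (auto simp: exp_le_mult, simp add: exp_le_def)

lemma ex_exp_le: "\<exists>b. exp_le b g"
proof -
  define b where "b = (\<Sum>m\<in>Poly_Mapping.keys g. \<Sum>v\<in>Poly_Mapping.keys m. Poly_Mapping.lookup m v)"
  have "Poly_Mapping.lookup m v \<le> b" if "m \<in> Poly_Mapping.keys g" for m v
  proof (cases "v \<in> Poly_Mapping.keys m")
    case True
    then have "Poly_Mapping.lookup m v \<le> (\<Sum>v\<in>Poly_Mapping.keys m. Poly_Mapping.lookup m v)"
      by (intro member_le_sum) auto
    also have "\<dots> \<le> b"
      unfolding b_def using that
      by (intro member_le_sum[of m _ "\<lambda>m. \<Sum>v\<in>Poly_Mapping.keys m. Poly_Mapping.lookup m v"]) auto
    finally show ?thesis .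
  qed (simp add: in_keys_iff)
  then show ?thesis by (auto simp: exp_le_def)
qed

text \<open>Linear independence over the field of the images in the quotient by \<open>p\<close>.
  The family is indexed by an initial segment of the naturals so that \<open>div\<close> and
  \<open>mod\<close> can enumerate its products with powers.\<close>

definition indep_mod :: "'k::field mpoly set \<Rightarrow> nat \<Rightarrow> (nat \<Rightarrow> 'k mpoly) \<Rightarrow> bool" where
  "indep_mod p M g \<longleftrightarrow> (\<forall>w. (\<Sum>t<M. mconst (w t) * g t) \<in> p \<longrightarrow> (\<forall>t<M. w t = 0))"

lemma sum_lessThan_add:
  fixes h :: "nat \<Rightarrow> 'a::comm_monoid_add"
  shows "(\<Sum>t<M + L. h t) = (\<Sum>t<M. h t) + (\<Sum>t<L. h (M + t))"
  by (induction L) (auto simp: add.assoc)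

text \<open>In a relation modulo \<open>p\<close> all terms with a positive power of
  \<open>f\<close> lie in \<open>q\<close>, so the block without \<open>f\<close> has zero
  coefficients. As \<open>p\<close> is prime and misses \<open>f\<close>, one factor
  \<open>f\<close> cancels from the rest, and induction on \<open>N\<close> applies.\<close>

lemma indep_mod_powers:
  fixes p q :: "'k::field mpoly set"
  assumes p: "prime_in A p" and q: "ideal_in A q" and "p \<subseteq> q" and A: "A = polys Vs"
    and f: "f \<in> q" "f \<notin> p" and g: "\<And>t. t < M \<Longrightarrow> g t \<in> A" "indep_mod q M g"
  shows "indep_mod p (N * M) (\<lambda>t. f ^ (t div M) * g (t mod M))"
proof (cases "M = 0")
  case False
  have fA: "f \<in> A" using ideal_inD(1)[OF q f(1)] .
  show ?thesis
  proof (induction N)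
    case (Suc N)
    let ?h = "\<lambda>t. f ^ (t div M) * g (t mod M)"
    show ?case
      unfolding indep_mod_def
    proof (intro allI impI)
      fix w t assume w: "(\<Sum>t<Suc N * M. mconst (w t) * ?h t) \<in> p" and t: "t < Suc N * M"
      define r where "r = (\<Sum>t<N * M. mconst (w (M + t)) * ?h t)"
      have hA: "?h t \<in> A" for t
        using g(1)[of "t mod M"] fA False by (auto simp: A mult_in_polys power_in_polys)
      have rA: "r \<in> A"
        unfolding r_def A by (intro sum_in_polys mult_in_polys[OF mconst_in_polys hA[unfolded A]])
      have "(\<Sum>t<Suc N * M. mconst (w t) * ?h t) =
          (\<Sum>t<M. mconst (w t) * ?h t) + (\<Sum>t<N * M. mconst (w (M + t)) * ?h (M + t))"
        using sum_lessThan_add[of "\<lambda>t. mconst (w t) * ?h t" M "N * M"] by simp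
      also have "(\<Sum>t<N * M. mconst (w (M + t)) * ?h (M + t)) = f * r"
        using False unfolding r_def sum_distrib_left by (intro sum.cong) (auto simp: mult.left_commute mult.assoc)
      also have "(\<Sum>t<M. mconst (w t) * ?h t) = (\<Sum>t<M. mconst (w t) * g t)"
        by (intro sum.cong) auto
      finally have split: "(\<Sum>t<Suc N * M. mconst (w t) * ?h t) = (\<Sum>t<M. mconst (w t) * g t) + f * r" .
      have "(\<Sum>t<M. mconst (w t) * g t) + f * r - f * r \<in> q"
        using w \<open>p \<subseteq> q\<close> ideal_inD(5)[OF q rA f(1)] subring_in_polys[of Vs] q
        unfolding split A by (intro ideal_in_diff(1)) auto
      then have w0: "w t = 0" if "t < M" for t
        using g(2) that by (auto simp: indep_mod_def)
      then have "f * r \<in> p" using w unfolding split by simp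
      then have "r \<in> p" using prime_inD(3)[OF p fA rA] f(2) by blast
      then have "w (M + t) = 0" if "t < N * M" for t
        using Suc.IH[unfolded indep_mod_def, rule_format, of "\<lambda>t. w (M + t)"] that unfolding r_def by simp
      from w0[of t] this[of "t - M"] t show "w t = 0"
        by (cases "t < M") (auto simp: not_less less_diff_conv2)
    qed
  qed (simp add: indep_mod_def)
qed (simp add: indep_mod_def)

lemma indep_mod_monomials:
  fixes p :: "'k::field mpoly set"
  assumes p: "p \<inter> polys W \<subseteq> {0}" and W: "finite W"
  shows "\<exists>g. (\<forall>t<Suc b ^ card W. g t \<in> polys W \<and> exp_le b (g t)) \<and> indep_mod p (Suc b ^ card W) (g :: nat \<Rightarrow> 'k mpoly)"
proof -
  let ?M = "Suc b ^ card W"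
  obtain e where e: "bij_betw e {..<?M} (box_monomials W b)"
    using ex_bij_betw_nat_finite[OF card_box_monomials(1)[OF W, of b]] card_box_monomials(2)[OF W, of b]
    by (auto simp: atLeast0LessThan)
  define g where "g t = Poly_Mapping.single (e t) (1::'k)" for t
  have em: "e t \<in> box_monomials W b" if "t < ?M" for t using e that by (auto simp: bij_betw_def)
  have gW: "g t \<in> polys W" "exp_le b (g t)" if "t < ?M" for t
    using em[OF that] by (auto simp: g_def box_monomials_def polys_def indets_def exp_le_def)
  moreover have "indep_mod p ?M g"
    unfolding indep_mod_def
  proof (intro allI impI)
    fix w t assume w: "(\<Sum>t<?M. mconst (w t) * g t) \<in> p" and t: "t < ?M"
    have "(\<Sum>t<?M. mconst (w t) * g t) \<in> polys W"
      using gW by (intro sum_in_polys mult_in_polys mconst_in_polys) auto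
    with w p have "(\<Sum>t<?M. mconst (w t) * g t) = 0" by blast
    then have "0 = (\<Sum>s<?M. Poly_Mapping.lookup (Poly_Mapping.single (e s) (w s)) (e t))"
      by (simp add: g_def mult_single flip: lookup_sum)
    also have "\<dots> = (\<Sum>s<?M. if s = t then w s else 0)"
      using e t by (intro sum.cong) (auto simp: lookup_single when_def bij_betw_def inj_on_def)
    finally show "w t = 0" using t by simp
  qed
  ultimately show ?thesis by blast
qed

lemma indep_mod_card:
  fixes p :: "'k::field mpoly set"
  assumes Vs: "finite Vs" and "0 \<in> p" and g: "\<And>t. t < M \<Longrightarrow> g t \<in> polys Vs \<and> exp_le b (g t)" "indep_mod p M g"
  shows "M \<le> Suc b ^ card Vs"
proof (rule ccontr)
  assume "\<not> M \<le> Suc b ^ card Vs"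
  then have "card (box_monomials Vs b) < card {..<M}" by (simp add: card_box_monomials[OF Vs])
  moreover have "subring_in (UNIV :: 'k set)" "prime_in (UNIV :: 'k set) {0}"
    by (auto simp: subring_in_def prime_in_def ideal_in_def)
  ultimately obtain w where w: "\<exists>t\<in>{..<M}. w t \<notin> {0}"
    "\<forall>m\<in>box_monomials Vs b. (\<Sum>t<M. w t * Poly_Mapping.lookup (g t) m) \<in> {0::'k}"
    using lin_dep_mod_prime[of "UNIV::'k set" "{0}" "box_monomials Vs b" "{..<M}" "\<lambda>t m. Poly_Mapping.lookup (g t) m"]
      card_box_monomials(1)[OF Vs, of b] by auto
  have "(\<Sum>t<M. mconst (w t) * g t) = 0"
  proof (rule poly_mapping_eqI)
    fix m
    have "Poly_Mapping.lookup (mconst (w t) * g t) m = w t * Poly_Mapping.lookup (g t) m" for t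
      by (simp add: mult_map_scale_conv_mult[symmetric] Poly_Mapping.map.rep_eq when_def)
    moreover have "(\<Sum>t<M. w t * Poly_Mapping.lookup (g t) m) = 0"
    proof (cases "m \<in> box_monomials Vs b")
      case False
      have "Poly_Mapping.lookup (g t) m = 0" if "t < M" for t
      proof (rule ccontr)
        assume "Poly_Mapping.lookup (g t) m \<noteq> 0"
        then have "m \<in> Poly_Mapping.keys (g t)" by (simp add: in_keys_iff)
        then have "m \<in> box_monomials Vs b"
          using g(1)[OF that] by (auto simp: box_monomials_def polys_def indets_def exp_le_def)
        with False show False by blast
      qed
      then show ?thesis by (intro sum.neutral) auto
    qed (use w(2) in auto)
    ultimately show "Poly_Mapping.lookup (\<Sum>t<M. mconst (w t) * g t) m = Poly_Mapping.lookup 0 m"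
      by (simp add: lookup_sum)
  qed
  then have "\<forall>t<M. w t = 0" using g(2) \<open>0 \<in> p\<close> by (auto simp: indep_mod_def)
  with w(1) show False by auto
qed

text \<open>
  Choosing \<open>f\<^sub>i\<close> in the \<open>i\<close>-th but not in the preceding prime of a chain ending in \<open>p\<close>, the products
  of powers of the \<open>f\<^sub>i\<close> and of the variables in \<open>W\<close> are linearly independent; comparing their number
  with the number of monomials gives the bound.
\<close>

lemma chain_length_le:
  fixes c :: "nat \<Rightarrow> 'k::field mpoly set"
  assumes Vs: "finite Vs" and W: "W \<subseteq> Vs"
    and c: "\<And>i. i \<le> k \<Longrightarrow> prime_in (polys Vs) (c i)" "\<And>i. i < k \<Longrightarrow> c i \<subset> c (Suc i)"
    and free: "c k \<inter> polys W \<subseteq> {0}"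
  shows "k + card W \<le> card Vs"
proof (rule ccontr)
  assume "\<not> k + card W \<le> card Vs"
  then have ge: "card Vs + 1 \<le> k + card W" by simp
  \<comment> \<open>\<open>D\<close> must not depend on \<open>b\<close>: the exponents grow only
    linearly in \<open>Suc b\<close>, while the number of products is the power of
    \<open>Suc b\<close> with exponent \<open>j + card W\<close>.\<close>
  have "\<exists>D. \<forall>b. \<exists>g. (\<forall>t<Suc b ^ (j + card W). g t \<in> polys Vs \<and> exp_le (D * Suc b) (g t)) \<and>
      indep_mod (c (k - j)) (Suc b ^ (j + card W)) (g :: nat \<Rightarrow> 'k mpoly)" if "j \<le> k" for j
    using that
  proof (induction j)
    case 0
    show ?case
    proof (intro exI[of _ 1] allI)
      fix b
      obtain g :: "nat \<Rightarrow> 'k mpoly" where "\<forall>t<Suc b ^ card W. g t \<in> polys W \<and> exp_le b (g t)" "indep_mod (c k) (Suc b ^ card W) g"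
        using indep_mod_monomials[OF free finite_subset[OF W Vs], of b] by blast
      then show "\<exists>g :: nat \<Rightarrow> 'k mpoly. (\<forall>t<Suc b ^ (0 + card W). g t \<in> polys Vs \<and> exp_le (1 * Suc b) (g t)) \<and>
          indep_mod (c (k - 0)) (Suc b ^ (0 + card W)) g"
        using polys_mono[OF W] exp_le_mono[of b _ "Suc b"] by (intro exI[of _ g]) auto
    qed
  next
    case (Suc j)
    then obtain D where D: "\<And>b. \<exists>g. (\<forall>t<Suc b ^ (j + card W). g t \<in> polys Vs \<and> exp_le (D * Suc b) (g t)) \<and>
      indep_mod (c (k - j)) (Suc b ^ (j + card W)) (g :: nat \<Rightarrow> 'k mpoly)" by auto
    define i where "i = k - Suc j"
    have i: "Suc i = k - j" "i < k" "k - Suc j = i" using Suc.prems by (auto simp: i_def)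
    obtain f where f: "f \<in> c (k - j)" "f \<notin> c i" using c(2)[OF i(2)] i by auto
    obtain d where d: "exp_le d f" using ex_exp_le by blast
    have pr: "prime_in (polys Vs) (c i)" "prime_in (polys Vs) (c (k - j))" using c(1) i by auto
    note fA = ideal_inD(1)[OF prime_inD(1)[OF pr(2)] f(1)]
    show ?case
    proof (intro exI[of _ "d + D"] allI)
      fix b
      let ?M = "Suc b ^ (j + card W)"
      obtain g :: "nat \<Rightarrow> 'k mpoly" where g: "\<And>t. t < ?M \<Longrightarrow> g t \<in> polys Vs \<and> exp_le (D * Suc b) (g t)" "indep_mod (c (k - j)) ?M g"
        using D[of b] by blast
      let ?h = "\<lambda>t. f ^ (t div ?M) * g (t mod ?M)"
      have "indep_mod (c i) (Suc b * ?M) ?h"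
        using indep_mod_powers[OF pr(1) prime_inD(1)[OF pr(2)] _ refl f _ g(2), of "Suc b"] c(2)[OF i(2)] g(1) i by auto
      moreover have "?h t \<in> polys Vs \<and> exp_le ((d + D) * Suc b) (?h t)" if t: "t < Suc b * ?M" for t
      proof
        have m: "t mod ?M < ?M" by simp
        show "?h t \<in> polys Vs" using g(1)[OF m] fA by (intro mult_in_polys power_in_polys) auto
        have "t div ?M \<le> Suc b" using t by (simp add: div_le_mono less_imp_le less_mult_imp_div_less)
        then have "t div ?M * d + D * Suc b \<le> (d + D) * Suc b"
          by (metis add_le_mono distrib_right le_refl mult.commute mult_le_mono1)
        then show "exp_le ((d + D) * Suc b) (?h t)"
          using exp_le_mono[OF exp_le_mult[OF exp_le_power[OF d, of "t div ?M"]]] g(1)[OF m] by blast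
      qed
      ultimately show "\<exists>g :: nat \<Rightarrow> 'k mpoly. (\<forall>t<Suc b ^ (Suc j + card W). g t \<in> polys Vs \<and> exp_le ((d + D) * Suc b) (g t)) \<and>
          indep_mod (c (k - Suc j)) (Suc b ^ (Suc j + card W)) g"
        unfolding i(3) by (intro exI[of _ ?h]) simp
    qed
  qed
  from this[of k] obtain D where D: "\<And>b. \<exists>g. (\<forall>t<Suc b ^ (k + card W). g t \<in> polys Vs \<and> exp_le (D * Suc b) (g t)) \<and>
      indep_mod (c 0) (Suc b ^ (k + card W)) (g :: nat \<Rightarrow> 'k mpoly)" by auto
  have 0: "0 \<in> c 0" using ideal_inD(2)[OF prime_inD(1)[OF c(1)]] by simp
  \<comment> \<open>With this choice \<open>Suc D ^ card Vs < Suc B\<close>, so the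
    \<open>Suc B ^ (card Vs + 1)\<close> independent products outnumber the available
    monomials.\<close>
  define B where "B = Suc D ^ card Vs"
  have "Suc B ^ (card Vs + 1) \<le> Suc B ^ (k + card W)" using ge by (intro power_increasing) auto
  also have "\<dots> \<le> Suc (D * Suc B) ^ card Vs"
    using D[of B] indep_mod_card[OF Vs 0] by blast
  also have "\<dots> \<le> (Suc D * Suc B) ^ card Vs" by (intro power_mono) auto
  also have "\<dots> = B * Suc B ^ card Vs" by (simp only: B_def power_mult_distrib)
  finally have "Suc B * Suc B ^ card Vs \<le> B * Suc B ^ card Vs" by simp
  then show False by (simp only: mult_le_cancel2) simp
qed

text \<open>
  Each step of the chain passes from \<open>p\<close> to the prime of all \<open>g\<close> with \<open>g(z + T) \<in> p[T]\<close>.  It contains the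
  elements of \<open>p\<close> free of \<open>z\<close>, but no element whose derivative with respect to \<open>z\<close> is outside \<open>p\<close>.
\<close>

lemma chain_of_triangular:
  fixes p :: "'k::field mpoly set" and rk :: "lss_var \<Rightarrow> nat"
  assumes "finite Z" and "prime_in (polys Vs) p" and "\<And>z. z \<in> Z \<Longrightarrow> f z \<in> p" "\<And>z. z \<in> Z \<Longrightarrow> pder z (f z) \<notin> p"
    and "\<And>z z'. z \<in> Z \<Longrightarrow> z' \<in> Z \<Longrightarrow> z' \<noteq> z \<Longrightarrow> z' \<in> indets (f z) \<Longrightarrow> rk z' < rk z"
  shows "\<exists>c. (\<forall>i\<le>card Z. prime_in (polys Vs) (c i)) \<and> (\<forall>i<card Z. c i \<subset> c (Suc i)) \<and> c (card Z) = p"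
  using assms
proof (induction Z arbitrary: p rule: finite_ranking_induct[where f = rk])
  case empty
  then show ?case by (intro exI[of _ "\<lambda>_. p"]) auto
next
  case (insert x S)
  show ?case
  proof (cases "x \<in> S")
    case True
    then have "insert x S = S" by auto
    then show ?thesis using insert.IH[OF insert.prems(1)] insert.prems by simp
  next
    case False
    let ?q = "pull Vs (shiftb x) p"
    note id = prime_inD(1)[OF insert.prems(1)]
    have q: "prime_in (polys Vs) ?q"
      by (rule prime_in_pull[OF insert.prems(1)]) (rule shiftb_in_pT)
    have sub: "?q \<subseteq> p"
    proof (rule pull_subset[OF insert.prems(1) _ zero_in_polys])
      fix v :: lss_var
      have "poly (shiftb x v) 0 - mvar v = (0::'k mpoly)" by (simp add: shiftb_def)
      then show "poly (shiftb x v) 0 - mvar v \<in> p" using ideal_inD(2)[OF id] by simp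
    qed (rule shiftb_in_pT)
    have fA: "f z \<in> polys Vs" if "z \<in> insert x S" for z
      using insert.prems(2)[OF that] ideal_inD(1)[OF id] by blast
    have fq: "f z \<in> ?q" if "z \<in> S" for z
    proof -
      \<comment> \<open>The induction inserts elements by increasing \<open>rk\<close>, so
        \<open>x\<close> has maximal rank, whereas a variable occurring in \<open>f z\<close> has
        smaller rank than \<open>z\<close>.\<close>
      have "x \<notin> indets (f z)"
        using insert.prems(4)[of z x] that False insert.hyps(2)[OF that] by fastforce
      then have "pev (shiftb x) (f z) = [:f z:]"
        by (intro shift_free[of _ "indets (f z)"]) (auto simp: polys_def)
      then show ?thesis
        using fA[of z] insert.prems(2)[of z] that ideal_inD(2)[OF id] by (simp add: pull_def pconst_in_pT)
    qed
    have "\<exists>c. (\<forall>i\<le>card S. prime_in (polys Vs) (c i)) \<and> (\<forall>i<card S. c i \<subset> c (Suc i)) \<and> c (card S) = ?q"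
    proof (rule insert.IH[OF q])
      fix z assume "z \<in> S"
      then show "pder z (f z) \<notin> ?q" using sub insert.prems(3) by blast
    qed (use insert.prems(4) fq in auto)
    then obtain c where c: "\<forall>i\<le>card S. prime_in (polys Vs) (c i)" "\<forall>i<card S. c i \<subset> c (Suc i)" "c (card S) = ?q"
      by blast
    have "f x \<notin> ?q" using insert.prems(3)[of x] by (auto simp: pull_def pT_def pder_def)
    then have less: "?q \<subset> p" using sub insert.prems(2)[of x] by blast
    define d where "d i = (if i \<le> card S then c i else p)" for i
    have "card (insert x S) = Suc (card S)" using False insert.hyps(1) by simp
    then show ?thesis
      using c less insert.prems(1) by (intro exI[of _ d]) (auto simp: d_def le_Suc_eq less_Suc_eq)
  qed
qed

section \<open>Primes containing the ideal of a graph\<close>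

text \<open>The Boolean is the parity of the length, \<open>True\<close> for odd. Only the existence
  of a walk of given parity inside \<open>U\<close> matters, not the walk itself.\<close>

inductive pwalk :: "nat set set \<Rightarrow> nat set \<Rightarrow> nat \<Rightarrow> bool \<Rightarrow> nat \<Rightarrow> bool" for E U where
  start: "i \<in> U \<Longrightarrow> pwalk E U i False i"
| step: "pwalk E U i b j \<Longrightarrow> {j, k} \<in> E \<Longrightarrow> k \<in> U \<Longrightarrow> pwalk E U i (\<not> b) k"

lemma pwalk_in: "pwalk E U i b j \<Longrightarrow> i \<in> U \<and> j \<in> U"
  by (induction rule: pwalk.induct) auto

lemma pwalk_trans: "pwalk E U j b' k \<Longrightarrow> pwalk E U i b j \<Longrightarrow> pwalk E U i (b \<noteq> b') k"
proof (induction rule: pwalk.induct)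
  case (step j b' k l)
  then have "pwalk E U i (\<not> (b \<noteq> b')) l"
    by (intro pwalk.step[of E U i "b \<noteq> b'" k l]) auto
  moreover have "(\<not> (b \<noteq> b')) = (b \<noteq> (\<not> b'))" by auto
  ultimately show ?case by simp
qed simp

lemma pwalk_edge: "{i, j} \<in> E \<Longrightarrow> i \<in> U \<Longrightarrow> j \<in> U \<Longrightarrow> pwalk E U i True j"
  using pwalk.step[OF pwalk.start] by fastforce

lemma pwalk_sym: "pwalk E U i b j \<Longrightarrow> pwalk E U j b i"
proof (induction rule: pwalk.induct)
  case (step i b j k)
  have "pwalk E U k True j"
    using step pwalk_in by (intro pwalk_edge) (auto simp: insert_commute)
  from pwalk_trans[OF step.IH this] show ?case by simp
qed (rule pwalk.start)

text \<open>These are the vertices of the non-bipartite components of the graph on \<open>U\<close>,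
  since a closed odd walk at one vertex can be moved to any vertex connected with it.\<close>

definition odd_verts :: "nat set set \<Rightarrow> nat set \<Rightarrow> nat set" where
  "odd_verts E U = {i \<in> U. pwalk E U i True i}"

definition comp_root :: "nat set set \<Rightarrow> nat set \<Rightarrow> nat \<Rightarrow> nat" where
  "comp_root E U i = (LEAST j. \<exists>b. pwalk E U i b j)"

text \<open>One root per bipartite component, isolated vertices included; with \<open>U\<close> the
  complement of \<open>S\<close> its cardinality is \<open>b(S)\<close>.\<close>

definition bip_roots :: "nat set set \<Rightarrow> nat set \<Rightarrow> nat set" where
  "bip_roots E U = comp_root E U ` (U - odd_verts E U)"

lemma comp_root_walk: "i \<in> U \<Longrightarrow> \<exists>b. pwalk E U i b (comp_root E U i)"
  unfolding comp_root_def by (rule LeastI_ex) (blast intro: pwalk.start)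

lemma comp_root_in: "i \<in> U \<Longrightarrow> comp_root E U i \<in> U"
  using comp_root_walk pwalk_in by blast

lemma comp_root_eq:
  assumes "pwalk E U i b j"
  shows "comp_root E U i = comp_root E U j"
proof -
  have "(\<exists>b. pwalk E U i b k) \<longleftrightarrow> (\<exists>b. pwalk E U j b k)" for k
    using pwalk_trans[OF _ assms] pwalk_trans[OF _ pwalk_sym[OF assms]] by blast
  then show ?thesis by (simp add: comp_root_def)
qed

lemma comp_root_idem: "i \<in> U \<Longrightarrow> comp_root E U (comp_root E U i) = comp_root E U i"
  using comp_root_walk comp_root_eq by metis

lemma odd_verts_walk:
  assumes "i \<in> odd_verts E U" "pwalk E U i b j"
  shows "j \<in> odd_verts E U"
proof -
  have "pwalk E U i True i" using assms(1) by (simp add: odd_verts_def)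
  from pwalk_trans[OF assms(2) pwalk_trans[OF this pwalk_sym[OF assms(2)]]]
  have "pwalk E U j True j" by auto
  then show ?thesis using pwalk_in[OF assms(2)] by (simp add: odd_verts_def)
qed

lemma comp_root_notin_odd: "i \<in> U - odd_verts E U \<Longrightarrow> comp_root E U i \<in> U - odd_verts E U"
  using comp_root_walk[of i U E] comp_root_in[of i U E] odd_verts_walk pwalk_sym by blast

lemma bip_roots_sub: "bip_roots E U \<subseteq> U - odd_verts E U"
  using comp_root_notin_odd unfolding bip_roots_def by blast

lemma bip_roots_fix: "i \<in> bip_roots E U \<Longrightarrow> comp_root E U i = i"
  unfolding bip_roots_def using comp_root_idem by blast

lemma pwalk_unique:
  assumes "i \<in> U - odd_verts E U" "pwalk E U i b j" "pwalk E U i b' j"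
  shows "b = b'"
proof (rule ccontr)
  assume "b \<noteq> b'"
  then have "pwalk E U i True i" using pwalk_trans[OF pwalk_sym[OF assms(2)] assms(3)] by auto
  with assms(1) show False by (auto simp: odd_verts_def)
qed

text \<open>On a bipartite component this is the 2-colouring in which the root has colour
  \<open>False\<close>.\<close>

definition odd_pos :: "nat set set \<Rightarrow> nat set \<Rightarrow> nat \<Rightarrow> bool" where
  "odd_pos E U i \<longleftrightarrow> pwalk E U (comp_root E U i) True i"

lemma odd_pos_iff:
  assumes "i \<in> U - odd_verts E U"
  shows "pwalk E U (comp_root E U i) b i \<longleftrightarrow> b = odd_pos E U i"
proof -
  obtain b' where b': "pwalk E U (comp_root E U i) b' i"
    using comp_root_walk[of i U E] assms pwalk_sym by blast
  note u = pwalk_unique[OF comp_root_notin_odd[OF assms]]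
  show ?thesis
  proof
    assume "pwalk E U (comp_root E U i) b i"
    then show "b = odd_pos E U i" using u[of b i True] unfolding odd_pos_def by (cases b) auto
  next
    assume "b = odd_pos E U i"
    then show "pwalk E U (comp_root E U i) b i"
      using b' unfolding odd_pos_def by (cases b; cases b') auto
  qed
qed

lemma odd_pos_edge:
  assumes "{i, j} \<in> E" "i \<in> U - odd_verts E U" "j \<in> U"
  shows "j \<in> U - odd_verts E U" "comp_root E U j = comp_root E U i" "odd_pos E U j \<longleftrightarrow> \<not> odd_pos E U i"
proof -
  have w: "pwalk E U i True j" using assms by (intro pwalk_edge) auto
  show j: "j \<in> U - odd_verts E U"
    using odd_verts_walk[OF _ pwalk_sym[OF w]] assms by auto
  show r: "comp_root E U j = comp_root E U i" using comp_root_eq[OF w] by simp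
  have "pwalk E U (comp_root E U i) (\<not> odd_pos E U i) j"
    using odd_pos_iff[OF assms(2), of "odd_pos E U i"] assms by (intro pwalk.step[of _ _ _ _ i]) auto
  then show "odd_pos E U j \<longleftrightarrow> \<not> odd_pos E U i" using odd_pos_iff[OF j] r by metis
qed

section \<open>The variables and the quadratic forms\<close>

definition xy_vars :: "nat \<Rightarrow> lss_var set" where
  "xy_vars n = XV ` {1..n} \<union> YV ` {1..n}"

lemma card_xy_vars: "card (xy_vars n) = 2 * n" "finite (xy_vars n)"
proof -
  have "card (XV ` {1..n} \<union> YV ` {1..n}) = card (XV ` {1..n}) + card (YV ` {1..n})"
    by (rule card_Un_disjoint) auto
  then show "card (xy_vars n) = 2 * n" by (simp add: xy_vars_def card_image inj_on_def)
qed (simp add: xy_vars_def)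

definition bform :: "'k::field mpoly \<Rightarrow> nat \<Rightarrow> nat \<Rightarrow> 'k mpoly" where
  "bform e i j = xvar i * xvar j + e * (yvar i * yvar j)"

text \<open>The 2 by 2 minor of two vertices. It arises from even walks: two neighbours of the same
  vertex have vectors orthogonal to one vector, hence proportional ones.\<close>

definition dform :: "nat \<Rightarrow> nat \<Rightarrow> 'k::field mpoly" where
  "dform i j = xvar i * yvar j - yvar i * xvar j"

definition edge_gens :: "nat set set \<Rightarrow> 'k::field mpoly \<Rightarrow> 'k mpoly set" where
  "edge_gens E e = {bform e i j | i j. {i, j} \<in> E}"

lemma bform_commute: "bform e i j = bform e j i"
  by (simp add: bform_def mult.commute)

locale edge_ring =
  fixes n :: nat and E :: "nat set set" and e :: "'k::field mpoly"
  assumes edge_verts: "\<And>i j. {i, j} \<in> E \<Longrightarrow> i \<in> {1..n} \<and> j \<in> {1..n} \<and> i \<noteq> j"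
    and e_cases: "e = 1 \<or> e = - 1"
    and two_nonzero: "(2 :: 'k) \<noteq> 0"
begin

abbreviation A :: "'k mpoly set" where "A \<equiv> polys (xy_vars n)"
abbreviation bf :: "nat \<Rightarrow> nat \<Rightarrow> 'k mpoly" where "bf \<equiv> bform e"
abbreviation df :: "nat \<Rightarrow> nat \<Rightarrow> 'k mpoly" where "df \<equiv> dform"

lemma ee: "e * e = 1"
  using e_cases by auto

lemma eea: "e * (e * a) = a"
  using ee by (simp add: mult.assoc[symmetric])

lemma eA: "e \<in> polys Vs"
  using e_cases by (auto intro: one_in_polys uminus_in_polys)

lemma varA: "i \<in> {1..n} \<Longrightarrow> xvar i \<in> A" "i \<in> {1..n} \<Longrightarrow> yvar i \<in> A"
  by (auto simp: mvar_in_polys xy_vars_def)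

lemma bfA: "i \<in> {1..n} \<Longrightarrow> j \<in> {1..n} \<Longrightarrow> bf i j \<in> A"
  unfolding bform_def by (intro add_in_polys mult_in_polys varA eA)

lemma dfA: "i \<in> {1..n} \<Longrightarrow> j \<in> {1..n} \<Longrightarrow> df i j \<in> A"
  unfolding dform_def by (intro diff_in_polys mult_in_polys varA)

lemma gensA: "edge_gens E e \<subseteq> A"
  using edge_verts bfA by (auto simp: edge_gens_def)

lemma two_A: "(2 :: 'k mpoly) \<in> A"
  using add_in_polys[OF one_in_polys one_in_polys] by simp

lemma pev_e: "pev \<beta> e = [:e:]"
proof -
  have "pev \<beta> 1 = [:1:]" by (simp add: rhomD[OF rhom_pev] one_pCons)
  then show ?thesis using e_cases rhom_uminus[OF rhom_pev, of \<beta> 1] by auto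
qed

lemma pev_bf: "pev \<beta> (bf i j) = \<beta> (XV i) * \<beta> (XV j) + [:e:] * (\<beta> (YV i) * \<beta> (YV j))"
  by (simp add: bform_def rhomD[OF rhom_pev] pev_e pev_mvar)

lemma pder_e: "pder z e = 0"
  using pev_e by (simp add: pder_def)

end

locale edge_prime = edge_ring n E e for n :: nat and E and e :: "'k::field mpoly" +
  fixes q :: "'k mpoly set"
  assumes q: "prime_in (polys (xy_vars n)) q" and gens_q: "edge_gens E e \<subseteq> q"
begin

lemma q_ideal: "ideal_in A q"
  by (rule prime_inD(1)[OF q])

lemma two_q: "2 \<notin> q"
proof
  assume "2 \<in> q"
  then have "mconst (inverse 2) * 2 \<in> q"
    by (intro ideal_inD(4)[OF q_ideal] mconst_in_polys)
  also have "mconst (inverse 2) * 2 = (1 :: 'k mpoly)"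
    using two_nonzero by (simp add: mult_single flip: single_numeral single_one)
  finally show False using prime_inD(2)[OF q] by simp
qed

text \<open>The ideals contracted from the localization at \<open>q\<close>, described without
  fractions: elements outside \<open>q\<close> may be cancelled. Three instances occur:
  \<open>q\<close>, the saturation of the ideal of the graph, and the contraction of the ideal that
  the \<open>fz z\<close> generate locally.\<close>

definition saturated :: "'k mpoly set \<Rightarrow> bool" where
  "saturated Q \<longleftrightarrow> ideal_in A Q \<and> Q \<subseteq> q \<and> (\<forall>u\<in>A. \<forall>g\<in>A. u \<notin> q \<longrightarrow> u * g \<in> Q \<longrightarrow> g \<in> Q)"

definition saturation :: "'k mpoly set \<Rightarrow> 'k mpoly set" where
  "saturation Q = {g \<in> A. \<exists>u\<in>A. u \<notin> q \<and> u * g \<in> Q}"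

lemma prodnotin: "a \<in> A \<Longrightarrow> b \<in> A \<Longrightarrow> a \<notin> q \<Longrightarrow> b \<notin> q \<Longrightarrow> a * b \<notin> q"
  using prime_inD(3)[OF q] by blast

lemma saturated_saturation:
  assumes Q: "ideal_in A Q" "Q \<subseteq> q"
  shows "saturated (saturation Q)" "Q \<subseteq> saturation Q"
proof -
  show "Q \<subseteq> saturation Q"
    using ideal_inD(1)[OF Q(1)] prime_inD(2)[OF q] one_in_polys
    by (auto simp: saturation_def intro!: bexI[of _ 1])
  have "ideal_in A (saturation Q)"
    unfolding ideal_in_def
  proof (intro conjI ballI)
    show "saturation Q \<subseteq> A" by (auto simp: saturation_def)
    show "0 \<in> saturation Q" using \<open>Q \<subseteq> saturation Q\<close> ideal_inD(2)[OF Q(1)] by blast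
  next
    fix a b assume "a \<in> saturation Q" "b \<in> saturation Q"
    then obtain u v where *: "a \<in> A" "b \<in> A" "u \<in> A" "v \<in> A" "u \<notin> q" "v \<notin> q" "u * a \<in> Q" "v * b \<in> Q"
      by (auto simp: saturation_def)
    have "v * (u * a) + u * (v * b) \<in> Q"
      by (rule ideal_inD(3)[OF Q(1) ideal_inD(4)[OF Q(1) *(4,7)] ideal_inD(4)[OF Q(1) *(3,8)]])
    then have "(u * v) * (a + b) \<in> Q" by (simp add: algebra_simps)
    then show "a + b \<in> saturation Q"
      using * prodnotin[of u v] by (auto simp: saturation_def add_in_polys intro!: bexI[of _ "u * v"] mult_in_polys)
  next
    fix a b assume a: "a \<in> A" and "b \<in> saturation Q"
    then obtain v where *: "b \<in> A" "v \<in> A" "v \<notin> q" "v * b \<in> Q"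
      by (auto simp: saturation_def)
    have "a * (v * b) \<in> Q" by (rule ideal_inD(4)[OF Q(1) a *(4)])
    then show "a * b \<in> saturation Q"
      using a * by (auto simp: saturation_def mult_in_polys mult.left_commute intro!: bexI[of _ v])
  qed
  moreover have "saturation Q \<subseteq> q"
    using prime_inD(3)[OF q] Q(2) by (auto simp: saturation_def)
  moreover have "g \<in> saturation Q" if ug: "u \<in> A" "g \<in> A" "u \<notin> q" "u * g \<in> saturation Q" for u g
  proof -
    obtain v where "v \<in> A" "v \<notin> q" "v * (u * g) \<in> Q" using ug(4) unfolding saturation_def by blast
    then show ?thesis using ug prodnotin[of v u]
      by (auto simp: saturation_def mult.assoc intro!: bexI[of _ "v * u"] mult_in_polys)
  qed
  ultimately show "saturated (saturation Q)" by (auto simp: saturated_def)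
qed

definition S :: "nat set" where "S = {i \<in> {1..n}. xvar i \<in> q \<and> yvar i \<in> q}"
definition U :: "nat set" where "U = {1..n} - S"

abbreviation "walk \<equiv> pwalk E U"
abbreviation "Od \<equiv> odd_verts E U"
abbreviation "rt \<equiv> comp_root E U"
abbreviation "Rs \<equiv> bip_roots E U"
abbreviation "od \<equiv> odd_pos E U"

lemma U_verts: "i \<in> U \<Longrightarrow> i \<in> {1..n}" "i \<in> S \<Longrightarrow> i \<in> {1..n}"
  by (auto simp: U_def S_def)

lemma U_iff: "i \<in> {1..n} \<Longrightarrow> i \<in> U \<longleftrightarrow> xvar i \<notin> q \<or> yvar i \<notin> q"
  by (auto simp: U_def S_def)

lemma Od_U: "i \<in> Od \<Longrightarrow> i \<in> U"
  by (simp add: odd_verts_def)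

lemma U_notin_S: "i \<in> U \<Longrightarrow> i \<notin> S"
  by (simp add: U_def)

lemma satD:
  assumes "saturated Q"
  shows "ideal_in A Q" "Q \<subseteq> q" "u * g \<in> Q \<Longrightarrow> u \<in> A \<Longrightarrow> g \<in> A \<Longrightarrow> u \<notin> q \<Longrightarrow> g \<in> Q"
  using assms by (auto simp: saturated_def)

text \<open>A vertex of \<open>U\<close> has a coordinate outside \<open>q\<close>, which can be
  cancelled; multiplying by both avoids asking which one it is.\<close>

lemma sat_coord:
  assumes "saturated Q" "i \<in> U" "g \<in> A" "xvar i * g \<in> Q" "yvar i * g \<in> Q"
  shows "g \<in> Q"
  using assms U_iff[of i] U_verts(1)[of i] varA[of i] satD(3)[OF assms(1)] by blast

lemma saturated_q: "saturated q"
  using q_ideal prime_inD(3)[OF q] by (auto simp: saturated_def)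

lemma gens_edge: "edge_gens E e \<subseteq> Q \<Longrightarrow> {i, j} \<in> E \<Longrightarrow> bf i j \<in> Q"
  by (auto simp: edge_gens_def)

text \<open>Each step eliminates the middle vertex \<open>j\<close> from two relations that share
  it. The result is the new relation times either coordinate of \<open>j\<close>, so
  \<open>sat_coord\<close> applies; the parity decides between form and minor.\<close>

lemma walk_form:
  assumes Q: "saturated Q" "edge_gens E e \<subseteq> Q" and w: "walk i b j"
  shows "(if b then bf i j else df i j) \<in> Q"
  using w
proof (induction rule: pwalk.induct)
  case (start i)
  then show ?case using ideal_inD(2)[OF satD(1)[OF Q(1)]] by (simp add: dform_def mult.commute)
next
  case (step i b j k)
  note id = satD(1)[OF Q(1)]
  have ijk: "i \<in> {1..n}" "j \<in> {1..n}" "k \<in> {1..n}" "j \<in> U"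
    using pwalk_in[OF step.hyps(1)] step.hyps U_verts by auto
  have jk: "bf j k \<in> Q" by (rule gens_edge[OF Q(2) step.hyps(2)])
  note in_A = varA(1,2)[OF ijk(1)] varA(1,2)[OF ijk(2)] varA(1,2)[OF ijk(3)] eA
  show ?case
  proof (cases b)
    case True
    then have ij: "bf i j \<in> Q" using step.IH by simp
    have "df i k \<in> Q"
    proof (rule sat_coord[OF Q(1) ijk(4)])
      have "yvar k * bf i j - yvar i * bf j k \<in> Q"
        using ij jk in_A by (intro ideal_in_diff(1)[OF subring_in_polys id] ideal_inD(4)[OF id])
      also have "yvar k * bf i j - yvar i * bf j k = xvar j * df i k"
        by (simp add: bform_def dform_def algebra_simps)
      finally show "xvar j * df i k \<in> Q" .
      have "e * (xvar i * bf j k - xvar k * bf i j) \<in> Q"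
        using ij jk in_A by (intro ideal_in_diff(1)[OF subring_in_polys id] ideal_inD(4)[OF id])
      also have "e * (xvar i * bf j k - xvar k * bf i j) = yvar j * df i k"
        by (simp add: bform_def dform_def algebra_simps eea)
      finally show "yvar j * df i k \<in> Q" .
    qed (rule dfA[OF ijk(1,3)])
    with True show ?thesis by simp
  next
    case False
    then have ij: "df i j \<in> Q" using step.IH by simp
    have "bf i k \<in> Q"
    proof (rule sat_coord[OF Q(1) ijk(4)])
      have "xvar i * bf j k - (e * yvar k) * df i j \<in> Q"
        using ij jk in_A by (intro ideal_in_diff(1)[OF subring_in_polys id] ideal_inD(4)[OF id] mult_in_polys)
      also have "xvar i * bf j k - (e * yvar k) * df i j = xvar j * bf i k"
        by (simp add: bform_def dform_def algebra_simps)
      finally show "xvar j * bf i k \<in> Q" .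
      have "yvar i * bf j k + xvar k * df i j \<in> Q"
        using ij jk in_A by (intro ideal_inD(3)[OF id] ideal_inD(4)[OF id] mult_in_polys)
      also have "yvar i * bf j k + xvar k * df i j = yvar j * bf i k"
        by (simp add: bform_def dform_def algebra_simps)
      finally show "yvar j * bf i k \<in> Q" .
    qed (rule bfA[OF ijk(1,3)])
    with False show ?thesis by simp
  qed
qed

lemma Od_form: "saturated Q \<Longrightarrow> edge_gens E e \<subseteq> Q \<Longrightarrow> i \<in> Od \<Longrightarrow> bf i i \<in> Q"
  using walk_form[of Q i True i] by (simp add: odd_verts_def)

text \<open>As \<open>x^2 + e y^2\<close> lies in \<open>q\<close>, either coordinate in
  \<open>q\<close> would bring the other one along, but \<open>i\<close> is not in
  \<open>S\<close>.\<close>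

lemma Od_coord:
  assumes "i \<in> Od"
  shows "xvar i \<notin> q" "yvar i \<notin> q"
proof -
  have i: "i \<in> {1..n}" using Od_U[OF assms] U_verts by blast
  have b: "xvar i * xvar i + e * (yvar i * yvar i) \<in> q"
    using Od_form[OF saturated_q gens_q assms] by (simp add: bform_def)
  have "yvar i \<in> q" if "xvar i \<in> q"
  proof -
    have "e * (xvar i * xvar i + e * (yvar i * yvar i)) - (e * xvar i) * xvar i \<in> q"
      using b that varA[OF i] by (intro ideal_in_diff(1)[OF subring_in_polys q_ideal] ideal_inD(4)[OF q_ideal] mult_in_polys eA)
    then have "yvar i * yvar i \<in> q" by (simp add: algebra_simps eea)
    then show ?thesis using prime_inD(3)[OF q] varA[OF i] by blast
  qed
  moreover have "xvar i \<in> q" if "yvar i \<in> q"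
  proof -
    have "(xvar i * xvar i + e * (yvar i * yvar i)) - (e * yvar i) * yvar i \<in> q"
      using b that varA[OF i] by (intro ideal_in_diff(1)[OF subring_in_polys q_ideal] ideal_inD(4)[OF q_ideal] mult_in_polys eA)
    then have "xvar i * xvar i \<in> q" by (simp add: algebra_simps)
    then show ?thesis using prime_inD(3)[OF q] varA[OF i] by blast
  qed
  ultimately show "xvar i \<notin> q" "yvar i \<notin> q"
    using U_iff[OF i] Od_U[OF assms] by auto
qed

text \<open>
  \<open>Z\<close> is the set of variables that are algebraic over the others modulo \<open>q\<close>, and \<open>fz z\<close> is the relation
  for \<open>z \<in> Z\<close>.  All non-bipartite components of \<open>G - S\<close> are handled together, relative to one of their
  vertices \<open>o1\<close>: since \<open>x\<^sup>2 + e y\<^sup>2 \<in> q\<close> at each of their vertices, \<open>q\<close> contains \<open>y\<^sub>o x\<^sub>i - x\<^sub>o y\<^sub>i\<close> or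
  \<open>y\<^sub>o x\<^sub>i + x\<^sub>o y\<^sub>i\<close>.  (\<open>o1\<close> is arbitrary if there is no such component.)  In a bipartite component, \<open>zv i\<close> is
  the variable of \<open>i\<close> whose coefficient in \<open>rel i\<close> is not in \<open>q\<close>.
\<close>

definition o1 :: nat where "o1 = (SOME i. i \<in> Od)"

definition lin :: "nat \<Rightarrow> 'k mpoly \<Rightarrow> 'k mpoly" where
  "lin i s = yvar o1 * xvar i - s * (xvar o1 * yvar i)"

definition sg :: "nat \<Rightarrow> 'k mpoly" where
  "sg i = (if lin i 1 \<in> q then 1 else - 1)"

definition rel :: "nat \<Rightarrow> 'k mpoly" where
  "rel i = (if od i then bf (rt i) i else df (rt i) i)"

definition top_x :: "nat \<Rightarrow> bool" where
  "top_x i \<longleftrightarrow> (xvar (rt i) \<notin> q \<longleftrightarrow> od i)"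

definition zv :: "nat \<Rightarrow> lss_var" where "zv i = (if top_x i then XV i else YV i)"
definition wv :: "nat \<Rightarrow> lss_var" where "wv i = (if top_x i then YV i else XV i)"

definition Z :: "lss_var set" where
  "Z = XV ` S \<union> YV ` S \<union> XV ` Od \<union> zv ` (U - Od - Rs)"

fun fz :: "lss_var \<Rightarrow> 'k mpoly" where
  "fz (XV i) = (if i \<in> S then xvar i else if i \<in> Od then if i = o1 then bf i i else lin i (sg i) else rel i)"
| "fz (YV i) = (if i \<in> S then yvar i else rel i)"

lemma o1: "i \<in> Od \<Longrightarrow> o1 \<in> Od"
  unfolding o1_def by (rule someI)

lemma sg_cases: "sg i = 1 \<or> sg i = - 1"
  by (simp add: sg_def)

lemma sgA: "sg i \<in> A"
  using sg_cases[of i] one_in_polys uminus_in_polys[OF one_in_polys] by auto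

lemma linA: "i \<in> {1..n} \<Longrightarrow> o1 \<in> {1..n} \<Longrightarrow> s \<in> A \<Longrightarrow> lin i s \<in> A"
  unfolding lin_def by (intro diff_in_polys mult_in_polys varA)

text \<open>The quadrics at \<open>i\<close> and \<open>o1\<close> combine to the product of the
  linear forms with signs \<open>1\<close> and \<open>- 1\<close>. The sum of these forms is
  \<open>2 * (yvar o1 * xvar i)\<close>, which is outside \<open>q\<close>, so one factor is outside
  \<open>q\<close> and cancels.\<close>

lemma lin_in:
  assumes Q: "saturated Q" "edge_gens E e \<subseteq> Q" and i: "i \<in> Od"
  shows "lin i (sg i) \<in> Q"
proof -
  note id = satD(1)[OF Q(1)]
  note o = o1[OF i]
  have v: "i \<in> {1..n}" "o1 \<in> {1..n}" using i o Od_U U_verts by blast+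
  have A: "lin i 1 \<in> A" "lin i (- 1) \<in> A"
    using linA[OF v] one_in_polys uminus_in_polys[OF one_in_polys] by auto
  have "(yvar o1 * yvar o1) * bf i i - (yvar i * yvar i) * bf o1 o1 \<in> Q"
    using varA[OF v(1)] varA[OF v(2)] Od_form[OF Q i] Od_form[OF Q o]
    by (intro ideal_in_diff(1)[OF subring_in_polys id] ideal_inD(4)[OF id] mult_in_polys)
  also have "(yvar o1 * yvar o1) * bf i i - (yvar i * yvar i) * bf o1 o1 = lin i 1 * lin i (- 1)"
    by (simp add: bform_def lin_def algebra_simps)
  finally have prod: "lin i 1 * lin i (- 1) \<in> Q" .
  show ?thesis
  proof (cases "lin i 1 \<in> q")
    case True
    have "lin i (- 1) \<notin> q"
    proof
      assume "lin i (- 1) \<in> q"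
      with True have "lin i 1 + lin i (- 1) \<in> q" by (rule ideal_inD(3)[OF q_ideal])
      also have "lin i 1 + lin i (- 1) = 2 * (yvar o1 * xvar i)" by (simp add: lin_def)
      finally have "2 * (yvar o1 * xvar i) \<in> q" .
      moreover have "2 * (yvar o1 * xvar i) \<notin> q"
        using Od_coord[OF i] Od_coord[OF o] varA[OF v(1)] varA[OF v(2)] two_q two_A
        by (intro prodnotin mult_in_polys)
      ultimately show False by blast
    qed
    with satD(3)[OF Q(1), of "lin i (- 1)" "lin i 1"] prod A True show ?thesis
      by (simp add: sg_def mult.commute)
  next
    case False
    with satD(3)[OF Q(1), of "lin i 1" "lin i (- 1)"] prod A show ?thesis
      by (simp add: sg_def)
  qed
qed

lemma rel_in:
  assumes Q: "saturated Q" "edge_gens E e \<subseteq> Q" and i: "i \<in> U - Od"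
  shows "rel i \<in> Q"
  using walk_form[OF Q, of "rt i" "od i" i] odd_pos_iff[OF i, of "od i"] by (simp add: rel_def)

lemma Z_cases:
  assumes "z \<in> Z"
  obtains (sx) i where "i \<in> S" "z = XV i" "fz z = xvar i"
  | (sy) i where "i \<in> S" "z = YV i" "fz z = yvar i"
  | (top) i where "i \<in> Od" "i = o1" "z = XV i" "fz z = bf i i"
  | (odd) i where "i \<in> Od" "i \<noteq> o1" "z = XV i" "fz z = lin i (sg i)"
  | (bip) i where "i \<in> U - Od - Rs" "z = zv i" "fz z = rel i"
proof -
  consider i where "i \<in> S" "z = XV i" | i where "i \<in> S" "z = YV i"
    | i where "i \<in> Od" "z = XV i" | i where "i \<in> U - Od - Rs" "z = zv i"
    using assms unfolding Z_def by blast
  then show ?thesis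
  proof cases
    case (1 i)
    show ?thesis by (rule sx[of i]) (use 1 in simp_all)
  next
    case (2 i)
    show ?thesis by (rule sy[of i]) (use 2 in simp_all)
  next
    case (3 i)
    then have "i \<notin> S" using Od_U U_notin_S by blast
    show ?thesis
    proof (cases "i = o1")
      case True
      show ?thesis by (rule top[of i]) (use 3 True \<open>i \<notin> S\<close> in simp_all)
    next
      case False
      show ?thesis by (rule odd[of i]) (use 3 False \<open>i \<notin> S\<close> in simp_all)
    qed
  next
    case (4 i)
    then have "i \<notin> S" "i \<notin> Od" using U_notin_S by blast+
    then show ?thesis using 4 by (intro bip[of i]) (simp_all add: zv_def)
  qed
qed

lemma fz_in:
  assumes Q: "saturated Q" "edge_gens E e \<subseteq> Q" "\<And>s. s \<in> S \<Longrightarrow> xvar s \<in> Q \<and> yvar s \<in> Q" and z: "z \<in> Z"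
  shows "fz z \<in> Q"
  using z
proof (cases rule: Z_cases)
  case (top i)
  show ?thesis unfolding top(4) by (rule Od_form[OF Q(1,2) top(1)])
next
  case (odd i)
  show ?thesis unfolding odd(4) by (rule lin_in[OF Q(1,2) odd(1)])
next
  case (bip i)
  then show ?thesis using rel_in[OF Q(1,2), of i] by simp
qed (use Q(3) in simp_all)

lemma root_coord: "i \<in> U - Od \<Longrightarrow> xvar (rt i) \<notin> q \<or> yvar (rt i) \<notin> q"
  using comp_root_in[of i U E] U_iff U_verts by blast

lemma root_neq: "i \<in> U - Od - Rs \<Longrightarrow> rt i \<noteq> i"
  by (force simp: bip_roots_def)

text \<open>The derivative is \<open>1\<close> for a vertex of \<open>S\<close>,
  \<open>2 * xvar o1\<close> at \<open>o1\<close>, \<open>yvar o1\<close> at the other odd vertices,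
  and up to a unit a coordinate of the root in a bipartite component; \<open>top_x\<close> selects a
  coordinate that is outside \<open>q\<close>.\<close>

lemma pder_fz:
  assumes "z \<in> Z"
  shows "pder z (fz z) \<notin> q"
proof -
  have e_notin: "e \<notin> q"
    using ideal_inD(4)[OF q_ideal eA, of e] prime_inD(2)[OF q] by (auto simp: ee)
  show ?thesis
    using assms
  proof (cases rule: Z_cases)
    case (top i)
    then have "2 * xvar i \<notin> q"
      using Od_coord[OF top(1)] two_q two_A varA[of i] Od_U U_verts by (intro prodnotin) auto
    moreover have "pder z (fz z) = 2 * xvar i"
      unfolding top(4) unfolding top(3) by (simp add: bform_def pder_add pder_mult pder_mvar pder_e)
    ultimately show ?thesis by simp
  next
    case (odd i)
    have "pder z (sg i) = 0"
      using sg_cases[of i] pder_mconst[of z 1] pder_mconst[of z "- 1"] by (auto simp: single_uminus)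
    then have "pder z (fz z) = yvar o1"
      unfolding odd(4) unfolding odd(3) using odd(2) by (simp add: lin_def pder_diff pder_mult pder_mvar)
    with Od_coord[OF o1[OF odd(1)]] show ?thesis by simp
  next
    case (bip i)
    then have i: "i \<notin> Od" "rt i \<noteq> i" using root_neq by auto
    have "rt i \<in> {1..n}" using bip comp_root_in[of i U E] U_verts by blast
    then have 1: "e * yvar (rt i) \<notin> q" if "yvar (rt i) \<notin> q"
      using e_notin that varA by (intro prodnotin eA) auto
    have 2: "- yvar (rt i) \<notin> q" if "yvar (rt i) \<notin> q"
      using ideal_in_diff(2)[OF subring_in_polys q_ideal, of "- yvar (rt i)"] that by auto
    have 3: "pder z (fz z) = (if od i then if top_x i then xvar (rt i) else e * yvar (rt i)
        else if top_x i then - yvar (rt i) else xvar (rt i))"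
      unfolding bip(3) unfolding bip(2) zv_def rel_def using i(2)
      by (simp add: bform_def dform_def pder_add pder_diff pder_mult pder_mvar pder_e)
    have "xvar (rt i) \<notin> q \<or> yvar (rt i) \<notin> q" using root_coord[of i] bip by blast
    with 1 2 3 show ?thesis by (auto simp: top_x_def)
  qed (use prime_inD(2)[OF q] in \<open>simp_all add: pder_mvar\<close>)
qed

text \<open>Two ranks suffice: the only variable of \<open>Z\<close> that enters the relation of
  another one is \<open>XV o1\<close>, through \<open>lin\<close>.\<close>

definition rk :: "lss_var \<Rightarrow> nat" where
  "rk v = (if v = XV o1 then 0 else 1)"

lemma indets_subset: "g \<in> polys Vs \<Longrightarrow> v \<in> indets g \<Longrightarrow> v \<in> Vs"
  by (auto simp: polys_def)

lemma rel_polys: "rel i \<in> polys {XV (rt i), YV (rt i), XV i, YV i}"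
  unfolding rel_def bform_def dform_def
  by (auto intro!: add_in_polys diff_in_polys mult_in_polys eA simp: mvar_in_polys)

lemma Z_iff:
  "XV i \<in> Z \<longleftrightarrow> i \<in> S \<or> i \<in> Od \<or> i \<in> U - Od - Rs \<and> top_x i"
  "YV i \<in> Z \<longleftrightarrow> i \<in> S \<or> i \<in> U - Od - Rs \<and> \<not> top_x i"
  by (auto simp: Z_def zv_def)

lemma rootvar_notin_Z: "r \<in> Rs \<Longrightarrow> XV r \<notin> Z \<and> YV r \<notin> Z"
  using bip_roots_sub[of E U] U_notin_S[of r] unfolding Z_iff by blast

lemma wv_notin_Z: "i \<in> U - Od \<Longrightarrow> wv i \<notin> Z"
  using U_notin_S[of i] by (simp add: wv_def Z_iff)

lemma yOd_notin_Z: "i \<in> Od \<Longrightarrow> YV i \<notin> Z"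
  using U_notin_S[of i] Od_U[of i] by (simp add: Z_iff)

lemma fz_triangular:
  assumes "z \<in> Z" "z' \<in> Z" "z' \<noteq> z" "z' \<in> indets (fz z)"
  shows "rk z' < rk z"
proof -
  show ?thesis
    using assms(1)
  proof (cases rule: Z_cases)
    case (top i)
    have "fz z \<in> polys {XV i, YV i}"
      unfolding top(4) bform_def by (intro add_in_polys mult_in_polys eA) (simp_all add: mvar_in_polys)
    then have "z' = YV i" using assms(3,4) indets_subset top by blast
    with assms(2) yOd_notin_Z top show ?thesis by blast
  next
    case (odd i)
    have "sg i \<in> polys Vs" for Vs
      using sg_cases[of i] one_in_polys uminus_in_polys[OF one_in_polys] by auto
    then have "fz z \<in> polys {XV o1, YV o1, XV i, YV i}"
      unfolding odd(4) lin_def by (intro diff_in_polys mult_in_polys) (simp_all add: mvar_in_polys)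
    then have "z' \<in> {XV o1, YV o1, YV i}" using assms(3,4) indets_subset odd by blast
    with assms(2) yOd_notin_Z odd(1) o1[OF odd(1)] have "z' = XV o1" by blast
    with odd show ?thesis by (simp add: rk_def)
  next
    case (bip i)
    then have i: "i \<in> U - Od" "rt i \<in> Rs" by (auto simp: bip_roots_def)
    have "z' \<in> {XV (rt i), YV (rt i), XV i, YV i}"
      using assms(4) rel_polys[of i] indets_subset unfolding bip(3) by blast
    moreover have "z' \<noteq> XV (rt i)" "z' \<noteq> YV (rt i)" using assms(2) rootvar_notin_Z[OF i(2)] by auto
    moreover have "z' \<noteq> zv i" "z' \<noteq> wv i" using assms(2,3) bip wv_notin_Z[OF i(1)] by auto
    ultimately show ?thesis by (auto simp: zv_def wv_def split: if_splits)
  qed (use assms(3,4) in \<open>simp_all add: indets_def mvar_def\<close>)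
qed

lemma finite_sets: "finite S" "finite U" "finite Od" "finite Rs"
  by (auto simp: S_def U_def odd_verts_def bip_roots_def)

text \<open>Both variables count for a vertex of \<open>S\<close>, none for a bipartite root, and
  one for every other vertex. The equation is additive because subtraction on naturals
  truncates.\<close>

lemma card_Z: "card Z + card Rs = n + card S"
proof -
  have fin: "finite (zv ` (U - Od - Rs))" using finite_sets by auto
  have dis: "XV ` S \<inter> YV ` S = {}" "(XV ` S \<union> YV ` S) \<inter> XV ` Od = {}"
    "(XV ` S \<union> YV ` S \<union> XV ` Od) \<inter> zv ` (U - Od - Rs) = {}"
    using U_notin_S Od_U by (force simp: zv_def split: if_splits)+
  have "card Z = card (XV ` S) + card (YV ` S) + card (XV ` Od) + card (zv ` (U - Od - Rs))"
    unfolding Z_def using finite_sets fin dis by (simp add: card_Un_disjoint)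
  moreover have "card (XV ` S) = card S" "card (YV ` S) = card S" "card (XV ` Od) = card Od"
    by (auto intro!: card_image inj_onI)
  moreover have "card (zv ` (U - Od - Rs)) = card (U - Od - Rs)"
    by (rule card_image, rule inj_onI) (simp add: zv_def split: if_splits)
  ultimately have 1: "card Z = 2 * card S + card Od + card (U - Od - Rs)" by simp
  have "card (U - Od - Rs) + card Rs = card (U - Od)"
    using bip_roots_sub[of E U] finite_sets by (metis card_Diff_subset card_mono finite_Diff le_add_diff_inverse2)
  moreover have "card (U - Od) + card Od = card U"
    using finite_sets Od_U by (metis card_Diff_subset card_mono le_add_diff_inverse2 subsetI)
  moreover have "card U + card S = n"
    using finite_sets U_verts(2) by (metis U_def card_Diff_subset card_atLeastAtMost card_mono diff_Suc_1 finite_atLeastAtMost le_add_diff_inverse2 subsetI)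
  ultimately show ?thesis using 1 by linarith
qed

lemma Z_sub: "Z \<subseteq> xy_vars n"
  using U_verts Od_U by (auto simp: Z_def xy_vars_def zv_def)

lemma finite_Z: "finite Z"
  using Z_sub finite_subset by (auto simp: xy_vars_def)

lemma fz_q: "z \<in> Z \<Longrightarrow> fz z \<in> q"
  by (rule fz_in[OF saturated_q gens_q]) (simp_all add: S_def)

lemma ex_chain:
  "\<exists>c. (\<forall>i\<le>card Z. prime_in A (c i)) \<and> (\<forall>i<card Z. c i \<subset> c (Suc i)) \<and> c (card Z) = q"
  using fz_q pder_fz fz_triangular
  by (intro chain_of_triangular[OF finite_Z q, where f = fz and rk = rk])

end

section \<open>Minimal primes of the ideal of a graph\<close>

context edge_prime
begin

lemma edge_U: "{i, j} \<in> E \<Longrightarrow> i \<in> S \<or> i \<in> U"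
  using edge_verts[of i j] by (auto simp: U_def)

lemma root_rel: "i \<in> Rs \<Longrightarrow> rt i = i \<and> \<not> od i"
  using bip_roots_fix[of i E U] bip_roots_sub[of E U] odd_pos_iff[of i U E False] pwalk.start[of i U E] by auto

lemma rel_of_fz:
  assumes id: "ideal_in A Q" and fz: "\<And>z. z \<in> Z \<Longrightarrow> fz z \<in> Q" and i: "i \<in> U - Od"
  shows "rel i \<in> Q"
proof (cases "i \<in> Rs")
  case True
  then have "rel i = 0" using root_rel[OF True] by (simp add: rel_def dform_def mult.commute)
  then show ?thesis using ideal_inD(2)[OF id] by simp
next
  case False
  then have "zv i \<in> Z" "fz (zv i) = rel i" using i U_notin_S[of i] by (auto simp: Z_def zv_def)
  then show ?thesis using fz by metis
qed

section \<open>The triangular relations recover the edge forms\<close>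

text \<open>The vector of \<open>i\<close> is proportional to that of the root \<open>r\<close> and
  the vector of \<open>j\<close> is orthogonal to it, so \<open>i\<close> and \<open>j\<close> are
  orthogonal once a coordinate of \<open>r\<close> is cancelled.\<close>

lemma bf_of_rel:
  assumes Q: "saturated Q" and r: "df r i \<in> Q" "bf r j \<in> Q" and rij: "r \<in> U" "i \<in> {1..n}" "j \<in> {1..n}"
  shows "bf i j \<in> Q"
proof (rule sat_coord[OF Q rij(1) bfA[OF rij(2,3)]])
  note id = satD(1)[OF Q]
  note in_A = varA[OF rij(2)] varA[OF rij(3)] eA
  have "xvar i * bf r j + (e * yvar j) * df r i \<in> Q"
    using r in_A by (intro ideal_inD(3)[OF id] ideal_inD(4)[OF id] mult_in_polys)
  also have "xvar i * bf r j + (e * yvar j) * df r i = xvar r * bf i j"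
    by (simp add: bform_def dform_def algebra_simps)
  finally show "xvar r * bf i j \<in> Q" .
  have "yvar i * bf r j - xvar j * df r i \<in> Q"
    using r in_A by (intro ideal_in_diff(1)[OF subring_in_polys id] ideal_inD(4)[OF id])
  also have "yvar i * bf r j - xvar j * df r i = yvar r * bf i j"
    by (simp add: bform_def dform_def algebra_simps)
  finally show "yvar r * bf i j \<in> Q" .
qed

text \<open>Inserting the two linear relations and the quadric at \<open>o1\<close> into the edge
  form leaves \<open>1 - sg i * sg j\<close> times a product of elements outside \<open>q\<close>.
  For different signs the first factor would be \<open>2\<close>.\<close>

lemma sg_edge:
  assumes ij: "{i, j} \<in> E" "i \<in> Od" "j \<in> Od"
  shows "sg i = sg j"
proof (rule ccontr)
  assume "sg i \<noteq> sg j"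
  then have sg: "sg i = 1 \<and> sg j = - 1 \<or> sg i = - 1 \<and> sg j = 1" using sg_cases[of i] sg_cases[of j] by auto
  note o = o1[OF ij(2)]
  have v: "i \<in> {1..n}" "j \<in> {1..n}" "o1 \<in> {1..n}" using ij o Od_U U_verts by blast+
  note in_A = varA[OF v(1)] varA[OF v(2)] varA[OF v(3)] eA sgA
  have mem: "bf i j \<in> q" "lin i (sg i) \<in> q" "lin j (sg j) \<in> q" "bf o1 o1 \<in> q"
    using gens_edge[OF gens_q ij(1)] lin_in[OF saturated_q gens_q] Od_form[OF saturated_q gens_q] ij o by blast+
  have "(yvar o1 * yvar o1) * bf i j - (yvar o1 * xvar j) * lin i (sg i)
      - (sg i * (xvar o1 * yvar i)) * lin j (sg j) + (yvar i * yvar j) * bf o1 o1 \<in> q"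
    using mem in_A by (intro ideal_inD(3)[OF q_ideal] ideal_in_diff(1)[OF subring_in_polys q_ideal] ideal_inD(4)[OF q_ideal] mult_in_polys)
  also have "(yvar o1 * yvar o1) * bf i j - (yvar o1 * xvar j) * lin i (sg i)
      - (sg i * (xvar o1 * yvar i)) * lin j (sg j) + (yvar i * yvar j) * bf o1 o1
      = e * (2 * ((yvar o1 * yvar o1) * (yvar i * yvar j)))"
    using sg by (auto simp: bform_def lin_def algebra_simps)
  finally have "e * (e * (2 * ((yvar o1 * yvar o1) * (yvar i * yvar j)))) \<in> q"
    by (rule ideal_inD(4)[OF q_ideal eA])
  then have "2 * ((yvar o1 * yvar o1) * (yvar i * yvar j)) \<in> q" by (simp only: eea)
  moreover have "2 * ((yvar o1 * yvar o1) * (yvar i * yvar j)) \<notin> q"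
    using Od_coord(2)[OF ij(2)] Od_coord(2)[OF ij(3)] Od_coord(2)[OF o] in_A two_q two_A
    by (intro prodnotin mult_in_polys)
  ultimately show False by blast
qed

text \<open>Converse to \<open>fz_in\<close>: locally the \<open>card Z\<close> relations produce
  every edge form, which bounds the number of local generators from above. In a non-bipartite
  component this rests on the sign being constant along edges.\<close>

lemma gens_of_fz:
  assumes Q: "saturated Q" and fz: "\<And>z. z \<in> Z \<Longrightarrow> fz z \<in> Q"
  shows "edge_gens E e \<subseteq> Q"
proof
  note id = satD(1)[OF Q]
  have S_in: "xvar s \<in> Q" "yvar s \<in> Q" if "s \<in> S" for s
    using fz[of "XV s"] fz[of "YV s"] that by (auto simp: Z_iff)
  fix g assume "g \<in> edge_gens E e"
  then obtain i j where g: "g = bf i j" and ij: "{i, j} \<in> E" by (auto simp: edge_gens_def)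
  have v: "i \<in> {1..n}" "j \<in> {1..n}" using edge_verts[OF ij] by auto
  note in_A = varA[OF v(1)] varA[OF v(2)] eA
  have ji: "{j, i} \<in> E" using ij by (simp add: insert_commute)
  consider "i \<in> S" | "j \<in> S" | "i \<in> U" "j \<in> U" using edge_U ij ji by blast
  then have "bf i j \<in> Q"
  proof cases
    case 1
    have "xvar j * xvar i + (e * yvar j) * yvar i \<in> Q"
      using S_in[OF 1] in_A by (intro ideal_inD(3)[OF id] ideal_inD(4)[OF id] mult_in_polys)
    then show ?thesis by (simp add: bform_def algebra_simps)
  next
    case 2
    have "xvar i * xvar j + (e * yvar i) * yvar j \<in> Q"
      using S_in[OF 2] in_A by (intro ideal_inD(3)[OF id] ideal_inD(4)[OF id] mult_in_polys)
    then show ?thesis by (simp add: bform_def algebra_simps)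
  next
    case U: 3
    show ?thesis
    proof (cases "i \<in> Od")
      case True
      have jO: "j \<in> Od" by (rule odd_verts_walk[OF True pwalk_edge[OF ij U]])
      note o = o1[OF True]
      have vo: "o1 \<in> {1..n}" using o Od_U U_verts by blast
      note in_A = in_A varA[OF vo] sgA
      have oo: "bf o1 o1 \<in> Q"
        using fz[of "XV o1"] o U_notin_S[OF Od_U[OF o]] by (simp add: Z_iff)
      have lin: "lin k (sg k) \<in> Q" if "k \<in> Od" for k
      proof (cases "k = o1")
        case True
        then have "lin k 1 = 0" by (simp add: lin_def mult.commute)
        then show ?thesis using ideal_inD(2)[OF id] ideal_inD(2)[OF q_ideal] by (simp add: sg_def)
      next
        case False
        then show ?thesis using fz[of "XV k"] that U_notin_S[OF Od_U[OF that]] by (simp add: Z_iff)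
      qed
      have "(yvar o1 * xvar j) * lin i (sg i) + (sg i * (xvar o1 * yvar i)) * lin j (sg j) + (yvar i * yvar j) * bf o1 o1 \<in> Q"
        using lin[OF True] lin[OF jO] oo in_A by (intro ideal_inD(3)[OF id] ideal_inD(4)[OF id] mult_in_polys)
      also have "(yvar o1 * xvar j) * lin i (sg i) + (sg i * (xvar o1 * yvar i)) * lin j (sg j) + (yvar i * yvar j) * bf o1 o1
          = (yvar o1 * yvar o1) * bf i j"
        using sg_edge[OF ij True jO] sg_cases[of i] by (auto simp: bform_def lin_def algebra_simps)
      finally show ?thesis
        using satD(3)[OF Q, of "yvar o1 * yvar o1" "bf i j"] prodnotin[of "yvar o1" "yvar o1"] Od_coord(2)[OF o] in_A
          mult_in_polys bfA[OF v] by blast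
    next
      case False
      then have iO: "i \<in> U - Od" using U by blast
      note j = odd_pos_edge[OF ij iO U(2)]
      have r: "rel i \<in> Q" "rel j \<in> Q" using rel_of_fz[OF id fz] iO j(1) by blast+
      have rU: "rt i \<in> U" using comp_root_in[of i U E] U by blast
      show ?thesis
      proof (cases "od i")
        case True
        then have "bf j i \<in> Q"
          using r j by (intro bf_of_rel[OF Q _ _ rU v(2,1)]) (simp_all add: rel_def)
        then show ?thesis by (simp add: bform_commute)
      next
        case False
        then show ?thesis
          using r j by (intro bf_of_rel[OF Q _ _ rU v]) (simp_all add: rel_def)
      qed
    qed
  qed
  then show "g \<in> Q" using g by simp
qed

section \<open>Algebraic independence from one-parameter families\<close>

text \<open>Let \<open>F\<close> be a relation \<open>r\<close> read as a polynomial in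
  \<open>w\<close>. The substitution turns \<open>r\<close> into \<open>F(a + c T)\<close>, whose
  top coefficient is the leading coefficient \<open>l\<close> of \<open>F\<close> times a power of
  \<open>c\<close>. By stability this lies in \<open>q\<close>, and \<open>c\<close> does not; so
  \<open>l\<close> would be a nonzero element of \<open>q\<close> in
  \<open>polys Xs\<close>.\<close>

lemma extend_free:
  assumes stable: "\<And>g. g \<in> q \<Longrightarrow> pev \<beta> g \<in> pT q"
    and fixd: "\<And>v. v \<in> Xs \<Longrightarrow> \<beta> v = [:mvar v:]"
    and w: "\<beta> w = [:a, c:]" "c \<in> A" "c \<notin> q" and Xs: "Xs \<subseteq> xy_vars n"
    and free: "q \<inter> polys Xs \<subseteq> {0}"
  shows "q \<inter> polys (insert w Xs) \<subseteq> {0}"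
proof (rule ccontr)
  assume "\<not> ?thesis"
  then obtain r where r: "r \<in> q" "r \<in> polys (insert w Xs)" "r \<noteq> 0" by blast
  have c0: "c \<noteq> 0" using w(3) ideal_inD(2)[OF q_ideal] by auto
  then have wX: "w \<notin> Xs" using fixd[of w] w(1) by auto
  define \<theta> :: "lss_var \<Rightarrow> 'k mpoly poly" where "\<theta> v = (if v = w then [:0, 1:] else [:mvar v:])" for v
  define F where "F = pev \<theta> r"
  have F_in: "F \<in> pT (polys Xs)"
    unfolding F_def by (rule pev_in_pT[OF r(2)])
      (auto simp: \<theta>_def pCons_in_pT zero_in_pT zero_in_polys one_in_polys mvar_in_polys)
  have comp: "rhom (\<lambda>g. pcompose (pev \<theta> g) [:a, c:])"
    by (simp add: rhom_def rhomD[OF rhom_pev] pcompose_add pcompose_mult pcompose_1)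
  have pev_r: "pev \<beta> r = pcompose F [:a, c:]"
    unfolding F_def
  proof (rule rhom_eqI[OF r(2) rhom_pev comp])
    fix v assume "v \<in> insert w Xs"
    then show "pev \<beta> (mvar v) = pcompose (pev \<theta> (mvar v)) [:a, c:]"
      using w(1) fixd wX by (auto simp: pev_mvar \<theta>_def pcompose_pCons)
  qed (simp add: pev_mconst pcompose_const)
  have "r = poly F (mvar w)"
    unfolding F_def
    by (rule rhom_eqI[OF r(2) rhom_id rhom_comp[OF rhom_poly rhom_pev]]) (auto simp: pev_mconst pev_mvar \<theta>_def)
  then have "F \<noteq> 0" using r(3) by auto
  define l where "l = poly.coeff F (Polynomial.degree F)"
  have l: "l \<noteq> 0" "l \<in> polys Xs"
    using \<open>F \<noteq> 0\<close> F_in by (auto simp: l_def pT_def)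
  have "poly.coeff (pcompose F [:a, c:]) (Polynomial.degree (pcompose F [:a, c:])) = l * c ^ Polynomial.degree F"
    using Polynomial.lead_coeff_comp[of "[:a, c:]" F] c0 by (simp add: l_def)
  moreover have "poly.coeff (pcompose F [:a, c:]) k \<in> q" for k
    using stable[OF r(1)] by (simp add: pev_r pT_def)
  ultimately have "l * c ^ Polynomial.degree F \<in> q" by metis
  moreover have "c ^ Polynomial.degree F \<notin> q"
    using prime_in_power[OF subring_in_polys q w(2)] w(3) by blast
  ultimately have "l \<in> q"
    using prime_inD(3)[OF q polys_mono[OF Xs l(2)] power_in_polys[OF w(2)]] by blast
  with l free show False by blast
qed

end

locale edge_min_prime = edge_prime +
  assumes minimal: "\<And>p. prime_in (polys (xy_vars n)) p \<Longrightarrow> edge_gens E e \<subseteq> p \<Longrightarrow> p \<subseteq> q \<Longrightarrow> p = q"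
begin

text \<open>
  A one-parameter family of substitutions that specializes to the identity modulo \<open>q\<close> and maps the
  generators into \<open>q[T]\<close> maps all of \<open>q\<close> into \<open>q[T]\<close>: the preimage of \<open>q[T]\<close> is a prime contained in \<open>q\<close>.
\<close>

lemma deform:
  assumes \<beta>: "\<And>v. v \<in> xy_vars n \<Longrightarrow> \<beta> v \<in> pT A" and "c \<in> A"
    and "\<And>v. v \<in> xy_vars n \<Longrightarrow> poly (\<beta> v) c - mvar v \<in> q"
    and edges: "\<And>i j. {i, j} \<in> E \<Longrightarrow> pev \<beta> (bf i j) \<in> pT q"
    and g: "g \<in> q"
  shows "pev \<beta> g \<in> pT q"
proof -
  have "edge_gens E e \<subseteq> pull (xy_vars n) \<beta> q"
    using gensA edges by (auto simp: pull_def edge_gens_def)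
  then have "pull (xy_vars n) \<beta> q = q"
    by (intro minimal prime_in_pull[OF q \<beta>] pull_subset[OF q \<beta> assms(2,3)])
  with g show ?thesis by (auto simp: pull_def)
qed

lemma const_in_pT: "a \<in> A \<Longrightarrow> [:a:] \<in> pT A" "a \<in> q \<Longrightarrow> [:a:] \<in> pT q"
  by (simp_all add: pconst_in_pT zero_in_polys ideal_inD(2)[OF q_ideal])

lemma lin_in_pT: "a \<in> A \<Longrightarrow> b \<in> A \<Longrightarrow> [:a, b:] \<in> pT A" "a \<in> q \<Longrightarrow> b \<in> q \<Longrightarrow> [:a, b:] \<in> pT q"
  by (simp_all add: pCons_in_pT zero_in_pT zero_in_polys ideal_inD(2)[OF q_ideal])

lemma mvarA: "v \<in> xy_vars n \<Longrightarrow> mvar v \<in> A"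
  by (simp add: mvar_in_polys)

lemma xy_vars_iff: "XV i \<in> xy_vars n \<longleftrightarrow> i \<in> {1..n}" "YV i \<in> xy_vars n \<longleftrightarrow> i \<in> {1..n}"
  by (auto simp: xy_vars_def)

text \<open>The vector of \<open>s\<close> vanishes modulo \<open>q\<close>, so replacing it by
  \<open>T (a, b)\<close> is the identity modulo \<open>q\<close> at \<open>T = 0\<close>, and
  orthogonality to the neighbours keeps the edge forms in \<open>q[T]\<close>. By
  \<open>deform\<close> the image \<open>a T\<close> of \<open>xvar s\<close> is in
  \<open>q[T]\<close>, hence \<open>a\<close> in \<open>q\<close>; likewise for
  \<open>b\<close>.\<close>

lemma orth_direction:
  assumes s: "s \<in> S" and ab: "a \<in> A" "b \<in> A"
    and orth: "\<And>j. j \<in> U \<Longrightarrow> {s, j} \<in> E \<Longrightarrow> a * xvar j + e * (b * yvar j) \<in> q"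
  shows "a \<in> q \<and> b \<in> q"
proof -
  define \<beta> :: "lss_var \<Rightarrow> 'a mpoly poly" where
    "\<beta> v = (if v = XV s then [:0, a:] else if v = YV s then [:0, b:] else [:mvar v:])" for v
  have nb: "a * xvar j + e * (b * yvar j) \<in> q" if "{s, j} \<in> E" for j
  proof (cases "j \<in> U")
    case False
    then have "j \<in> S" using that edge_U[of j s] by (auto simp: insert_commute)
    then have "a * xvar j + (e * b) * yvar j \<in> q"
      using ab by (intro ideal_inD(3)[OF q_ideal] ideal_inD(4)[OF q_ideal] mult_in_polys eA) (auto simp: S_def)
    then show ?thesis by (simp add: mult.assoc)
  qed (use orth that in blast)
  have stable: "pev \<beta> g \<in> pT q" if "g \<in> q" for g
  proof (rule deform[OF _ zero_in_polys _ _ that])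
    fix v assume "v \<in> xy_vars n"
    then show "\<beta> v \<in> pT A"
      using ab by (auto simp: \<beta>_def intro!: const_in_pT lin_in_pT mvarA zero_in_polys)
    have "xvar s \<in> q" "yvar s \<in> q" using s by (auto simp: S_def)
    then show "poly (\<beta> v) 0 - mvar v \<in> q"
      using ideal_in_diff(2)[OF subring_in_polys q_ideal] ideal_inD(2)[OF q_ideal] by (auto simp: \<beta>_def)
  next
    fix i j assume ij: "{i, j} \<in> E"
    have step: "pev \<beta> (bf s k) \<in> pT q" if "{s, k} \<in> E" for k
    proof -
      have "k \<noteq> s" using edge_verts[OF that] by auto
      then have "pev \<beta> (bf s k) = [:0, a * xvar k + e * (b * yvar k):]"
        by (simp add: pev_bf \<beta>_def)
      then show ?thesis using nb[OF that] by (simp add: lin_in_pT ideal_inD(2)[OF q_ideal])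
    qed
    show "pev \<beta> (bf i j) \<in> pT q"
    proof (cases "i = s \<or> j = s")
      case True
      then show ?thesis using step[of j] step[of i] ij bform_commute[of e i j] by (auto simp: insert_commute)
    next
      case False
      then have "pev \<beta> (bf i j) = [:bf i j:]" unfolding pev_bf by (auto simp: \<beta>_def bform_def)
      then show ?thesis using gens_edge[OF gens_q ij] by (simp add: const_in_pT)
    qed
  qed
  have "xvar s \<in> q" "yvar s \<in> q" using s by (auto simp: S_def)
  from this[THEN stable] show ?thesis
    by (simp add: pev_mvar \<beta>_def pCons_in_pT)
qed

text \<open>By \<open>orth_direction\<close> the vectors of the neighbours of \<open>s\<close> span
  the plane modulo \<open>q\<close>. So two of them have a minor outside \<open>q\<close>, and
  Cramer's rule solves their edge forms for the coordinates of \<open>s\<close>.\<close>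

lemma S_in_saturation:
  assumes Q: "saturated Q" "edge_gens E e \<subseteq> Q" and s: "s \<in> S"
  shows "xvar s \<in> Q \<and> yvar s \<in> Q"
proof -
  note id = satD(1)[OF Q(1)]
  have "\<exists>i\<in>U. {s, i} \<in> E"
  proof (rule ccontr)
    assume "\<not> ?thesis"
    then have "1 \<in> q \<and> 0 \<in> q"
      using orth_direction[OF s one_in_polys zero_in_polys] by blast
    with prime_inD(2)[OF q] show False by blast
  qed
  then obtain i where i: "i \<in> U" "{s, i} \<in> E" by blast
  have v: "i \<in> {1..n}" "s \<in> {1..n}" using edge_verts[OF i(2)] by auto
  have "\<exists>j\<in>U. {s, j} \<in> E \<and> df i j \<notin> q"
  proof (rule ccontr)
    assume *: "\<not> ?thesis"
    \<comment> \<open>This direction is orthogonal to \<open>i\<close>; if all minors with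
      \<open>i\<close> were in \<open>q\<close>, it would be orthogonal to the other neighbours
      too.\<close>
    have "e * - yvar i \<in> q \<and> xvar i \<in> q"
    proof (rule orth_direction[OF s])
      fix j assume "j \<in> U" "{s, j} \<in> E"
      then have "e * df i j \<in> q" using * ideal_inD(4)[OF q_ideal eA] by blast
      then show "e * - yvar i * xvar j + e * (xvar i * yvar j) \<in> q"
        by (simp add: dform_def algebra_simps)
    qed (use varA[OF v(1)] in \<open>auto intro: mult_in_polys eA uminus_in_polys\<close>)
    then have *: "e * - yvar i \<in> q" "xvar i \<in> q" by auto
    have "(- e) * (e * - yvar i) \<in> q" by (intro ideal_inD(4)[OF q_ideal uminus_in_polys[OF eA] *(1)])
    then have "yvar i \<in> q" by (simp add: eea)
    with * i U_iff[OF v(1)] show False by blast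
  qed
  then obtain j where j: "j \<in> U" "{s, j} \<in> E" "df i j \<notin> q" by blast
  have vj: "j \<in> {1..n}" using edge_verts[OF j(2)] by auto
  note in_A = varA[OF v(1)] varA[OF v(2)] varA[OF vj] eA
  have si: "bf s i \<in> Q" "bf s j \<in> Q" using gens_edge[OF Q(2)] i j by blast+
  have "yvar j * bf s i - yvar i * bf s j \<in> Q"
    using si in_A by (intro ideal_in_diff(1)[OF subring_in_polys id] ideal_inD(4)[OF id])
  also have "yvar j * bf s i - yvar i * bf s j = df i j * xvar s"
    by (simp add: bform_def dform_def algebra_simps)
  finally have x: "df i j * xvar s \<in> Q" .
  have "e * (xvar i * bf s j - xvar j * bf s i) \<in> Q"
    using si in_A by (intro ideal_in_diff(1)[OF subring_in_polys id] ideal_inD(4)[OF id])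
  also have "e * (xvar i * bf s j - xvar j * bf s i) = df i j * yvar s"
    by (simp add: bform_def dform_def algebra_simps eea)
  finally have "df i j * yvar s \<in> Q" .
  with x show ?thesis
    using satD(3)[OF Q(1)] dfA[OF v(1) vj] in_A j(3) by blast
qed

text \<open>Scaling both coordinates of one vertex multiplies the forms of its edges by
  \<open>T\<close>; the identity is at \<open>T = 1\<close>, not at \<open>T = 0\<close>.\<close>

definition scale :: "nat \<Rightarrow> lss_var \<Rightarrow> 'a mpoly poly" where
  "scale i v = (if v = XV i \<or> v = YV i then [:0, mvar v:] else [:mvar v:])"

lemma scale_stable:
  assumes "g \<in> q"
  shows "pev (scale i) g \<in> pT q"
proof (rule deform[OF _ one_in_polys _ _ assms])
  fix v assume "v \<in> xy_vars n"
  then show "scale i v \<in> pT A" by (auto simp: scale_def intro!: const_in_pT lin_in_pT mvarA zero_in_polys)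
  show "poly (scale i v) 1 - mvar v \<in> q" using ideal_inD(2)[OF q_ideal] by (simp add: scale_def)
next
  fix j k assume jk: "{j, k} \<in> E"
  then have "j \<noteq> k" using edge_verts by blast
  then have "pev (scale i) (bf j k) = (if i = j \<or> i = k then [:0, bf j k:] else [:bf j k:])"
    unfolding pev_bf by (auto simp: scale_def bform_def)
  then show "pev (scale i) (bf j k) \<in> pT q"
    using gens_edge[OF gens_q jk] by (simp add: const_in_pT lin_in_pT ideal_inD(2)[OF q_ideal])
qed

text \<open>
  The shear acts on the bipartite component of \<open>r\<close>, by a transvection on the side of \<open>r\<close> and by the
  contragredient one on the other side, so that \<open>bf\<close> is preserved.
\<close>

definition shear :: "nat \<Rightarrow> lss_var \<Rightarrow> 'a mpoly poly" where
  "shear r v = (case v of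
     XV i \<Rightarrow> if i \<in> U - Od \<and> rt i = r \<and> (xvar r \<notin> q \<longleftrightarrow> od i)
       then [:xvar i, if od i then - (e * yvar i) else yvar i:] else [:xvar i:]
   | YV i \<Rightarrow> if i \<in> U - Od \<and> rt i = r \<and> \<not> (xvar r \<notin> q \<longleftrightarrow> od i)
       then [:yvar i, if od i then - (e * xvar i) else xvar i:] else [:yvar i:])"

lemma shear_stable:
  assumes "g \<in> q"
  shows "pev (shear r) g \<in> pT q"
proof (rule deform[OF _ zero_in_polys _ _ assms])
  fix v assume "v \<in> xy_vars n"
  then show "shear r v \<in> pT A"
    using mvarA eA
    by (auto simp: shear_def xy_vars_iff split: lss_var.splits intro!: const_in_pT lin_in_pT mult_in_polys uminus_in_polys)
  show "poly (shear r v) 0 - mvar v \<in> q" using ideal_inD(2)[OF q_ideal] by (auto simp: shear_def split: lss_var.splits)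
next
  fix i j assume ij: "{i, j} \<in> E"
  have step: "pev (shear r) (bf i j) \<in> pT q" if ij: "{i, j} \<in> E" and i: "i \<in> U - Od" "rt i = r" for i j
  proof (cases "j \<in> U")
    case True
    note j = odd_pos_edge[OF ij i(1) True]
    have "pev (shear r) (bf i j) = [:bf i j:]"
      unfolding pev_bf using i j
      by (cases "od i"; cases "xvar r \<in> q") (simp_all add: shear_def bform_def algebra_simps eea)
    then show ?thesis using gens_edge[OF gens_q ij] by (simp add: const_in_pT)
  next
    case False
    then have "j \<in> S" using ij edge_U[of j i] by (auto simp: insert_commute)
    then have jq: "xvar j \<in> q" "yvar j \<in> q" by (auto simp: S_def)
    have idT: "ideal_in (pT A) (pT q)"
      by (rule prime_inD(1)[OF prime_in_pT[OF subring_in_polys q]])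
    have "i \<in> {1..n}" using i U_verts by blast
    then have "shear r (XV i) \<in> pT A" "shear r (YV i) \<in> pT A"
      using varA eA by (auto simp: shear_def intro!: const_in_pT lin_in_pT mult_in_polys uminus_in_polys)
    moreover have "shear r (XV j) = [:xvar j:]" "shear r (YV j) = [:yvar j:]"
      using False by (simp_all add: shear_def)
    ultimately show ?thesis
      unfolding pev_bf using ideal_inD(3)[OF idT ideal_inD(4)[OF idT _ const_in_pT(2)[OF jq(1)]]
          ideal_inD(4)[OF idT const_in_pT(1)[OF eA] ideal_inD(4)[OF idT _ const_in_pT(2)[OF jq(2)]]]]
      by simp
  qed
  show "pev (shear r) (bf i j) \<in> pT q"
  proof (cases "i \<in> U - Od \<and> rt i = r \<or> j \<in> U - Od \<and> rt j = r")
    case True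
    then show ?thesis using step[of i j] step[of j i] ij bform_commute[of e i j] by (auto simp: insert_commute)
  next
    case False
    then have "pev (shear r) (bf i j) = [:bf i j:]" unfolding pev_bf by (auto simp: shear_def bform_def)
    then show ?thesis using gens_edge[OF gens_q ij] by (simp add: const_in_pT)
  qed
qed

lemma polys_empty: "g \<in> polys {} \<Longrightarrow> \<exists>a. g = mconst a"
  by (induction rule: polys_induct) (auto simp flip: single_add simp: mult_single)

lemma free_empty: "q \<inter> polys {} \<subseteq> {0}"
proof
  fix g assume g: "g \<in> q \<inter> polys {}"
  then obtain a where a: "g = mconst a" using polys_empty by blast
  have "a = 0"
  proof (rule ccontr)
    assume "a \<noteq> 0"
    have "mconst (inverse a) * g \<in> q" using g by (intro ideal_inD(4)[OF q_ideal] mconst_in_polys) auto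
    then have "1 \<in> q" using \<open>a \<noteq> 0\<close> by (simp add: a mult_single)
    with prime_inD(2)[OF q] show False by blast
  qed
  with a show "g \<in> {0}" by simp
qed

text \<open>Scaling at a bipartite root frees a coordinate \<open>v1\<close> outside
  \<open>q\<close>. The shear then fixes \<open>v1\<close> and adds \<open>T\<close> times
  \<open>v1\<close> to the other coordinate, which frees that one as well.\<close>

lemma free_roots: "finite R \<Longrightarrow> R \<subseteq> Rs \<Longrightarrow> q \<inter> polys (XV ` R \<union> YV ` R) \<subseteq> {0}"
proof (induction R rule: finite_induct)
  case (insert r R)
  have r: "r \<in> U - Od" "rt r = r" "\<not> od r" "r \<in> {1..n}"
    using insert.prems bip_roots_sub[of E U] root_rel U_verts by auto
  have R: "i \<in> {1..n}" "rt i = i" "i \<noteq> r" if "i \<in> R" for i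
    using that insert bip_roots_sub[of E U] root_rel U_verts by auto
  have sub: "XV ` R \<union> YV ` R \<subseteq> xy_vars n" using R by (auto simp: xy_vars_iff)
  define v1 v2 where "v1 = (if xvar r \<notin> q then XV r else YV r)" and "v2 = (if xvar r \<notin> q then YV r else XV r)"
  have v1: "mvar v1 \<notin> q" "mvar v1 \<in> A" "v1 \<in> xy_vars n"
    using root_coord[OF r(1)] r varA by (auto simp: v1_def xy_vars_iff)
  have "q \<inter> polys (insert v1 (XV ` R \<union> YV ` R)) \<subseteq> {0}"
  proof (rule extend_free[where \<beta> = "scale r" and a = 0 and c = "mvar v1"])
    show "scale r v1 = [:0, mvar v1:]" by (simp add: scale_def v1_def)
  qed (use scale_stable insert.IH insert.prems insert.hyps(2) v1 sub R in \<open>auto simp: scale_def\<close>)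
  then have "q \<inter> polys (insert v2 (insert v1 (XV ` R \<union> YV ` R))) \<subseteq> {0}"
  proof (rule extend_free[where \<beta> = "shear r" and a = "mvar v2" and c = "mvar v1", rotated -1])
    show "shear r v2 = [:mvar v2, mvar v1:]" using r by (simp add: shear_def v1_def v2_def)
    show "shear r v = [:mvar v:]" if "v \<in> insert v1 (XV ` R \<union> YV ` R)" for v
      using that R r by (auto simp: shear_def v1_def)
  qed (use shear_stable v1 sub in auto)
  also have "insert v2 (insert v1 (XV ` R \<union> YV ` R)) = XV ` insert r R \<union> YV ` insert r R"
    by (auto simp: v1_def v2_def)
  finally show ?case .
qed (use free_empty in simp)

text \<open>In \<open>rel i\<close> the variable \<open>zv i\<close> has a coefficient outside
  \<open>q\<close>; so \<open>wv i\<close> in \<open>q\<close> would force \<open>zv i\<close> into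
  \<open>q\<close>, but \<open>i\<close> is not in \<open>S\<close>.\<close>

lemma wv_notin:
  assumes i: "i \<in> U - Od"
  shows "mvar (wv i) \<notin> q"
proof
  assume w: "mvar (wv i) \<in> q"
  have rU: "rt i \<in> U" using comp_root_in[of i U E] i by blast
  have v: "i \<in> {1..n}" "rt i \<in> {1..n}" using i rU U_verts by blast+
  note in_A = varA[OF v(1)] varA[OF v(2)] eA
  have rel: "rel i \<in> q" by (rule rel_in[OF saturated_q gens_q i])
  have rc: "xvar (rt i) \<notin> q \<or> yvar (rt i) \<notin> q" by (rule root_coord[OF i])
  have iU: "xvar i \<notin> q \<or> yvar i \<notin> q" using i U_iff[OF v(1)] by blast
  have *: "c * w \<in> q \<Longrightarrow> c \<in> A \<Longrightarrow> w \<in> A \<Longrightarrow> c \<notin> q \<Longrightarrow> w \<in> q" for c w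
    using prime_inD(3)[OF q] by blast
  show False
  proof (cases "od i"; cases "xvar (rt i) \<in> q")
    assume c: "od i" "xvar (rt i) \<notin> q"
    then have "yvar i \<in> q" using w by (simp add: wv_def top_x_def)
    then have "rel i - (e * yvar (rt i)) * yvar i \<in> q"
      using rel in_A by (intro ideal_in_diff(1)[OF subring_in_polys q_ideal] ideal_inD(4)[OF q_ideal] mult_in_polys)
    also have "rel i - (e * yvar (rt i)) * yvar i = xvar (rt i) * xvar i" using c by (simp add: rel_def bform_def)
    finally show False using *[of "xvar (rt i)" "xvar i"] c in_A iU \<open>yvar i \<in> q\<close> by blast
  next
    assume c: "od i" "xvar (rt i) \<in> q"
    then have "xvar i \<in> q" using w by (simp add: wv_def top_x_def)
    then have "e * (rel i - xvar (rt i) * xvar i) \<in> q"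
      using rel in_A by (intro ideal_in_diff(1)[OF subring_in_polys q_ideal] ideal_inD(4)[OF q_ideal])
    also have "e * (rel i - xvar (rt i) * xvar i) = yvar (rt i) * yvar i" using c by (simp add: rel_def bform_def eea)
    finally show False using *[of "yvar (rt i)" "yvar i"] c in_A iU rc \<open>xvar i \<in> q\<close> by blast
  next
    assume c: "\<not> od i" "xvar (rt i) \<notin> q"
    then have "xvar i \<in> q" using w by (simp add: wv_def top_x_def)
    then have "rel i + yvar (rt i) * xvar i \<in> q"
      using rel in_A by (intro ideal_inD(3)[OF q_ideal] ideal_inD(4)[OF q_ideal])
    also have "rel i + yvar (rt i) * xvar i = xvar (rt i) * yvar i" using c by (simp add: rel_def dform_def)
    finally show False using *[of "xvar (rt i)" "yvar i"] c in_A iU \<open>xvar i \<in> q\<close> by blast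
  next
    assume c: "\<not> od i" "xvar (rt i) \<in> q"
    then have "yvar i \<in> q" using w by (simp add: wv_def top_x_def)
    then have "xvar (rt i) * yvar i - rel i \<in> q"
      using rel in_A by (intro ideal_in_diff(1)[OF subring_in_polys q_ideal] ideal_inD(4)[OF q_ideal])
    also have "xvar (rt i) * yvar i - rel i = yvar (rt i) * xvar i" using c by (simp add: rel_def dform_def)
    finally show False using *[of "yvar (rt i)" "xvar i"] c in_A iU rc \<open>yvar i \<in> q\<close> by blast
  qed
qed

text \<open>The other variable of the same vertex is in \<open>Z\<close>, so scaling at that vertex
  moves no further variable outside \<open>Z\<close>.\<close>

lemma nonroot_free_cases:
  assumes "w \<in> xy_vars n - Z - (XV ` Rs \<union> YV ` Rs)"
  obtains i where "i \<in> {1..n}" "w = XV i" "YV i \<in> Z" "mvar w \<notin> q" | i where "i \<in> {1..n}" "w = YV i" "XV i \<in> Z" "mvar w \<notin> q"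
proof (cases w)
  case (XV i)
  then have i: "i \<in> {1..n}" "i \<notin> S" "i \<notin> Od" "i \<notin> Rs" "i \<in> U" "\<not> top_x i"
    using assms by (auto simp: xy_vars_iff Z_iff U_def)
  then show ?thesis using that(1)[of i] XV wv_notin[of i] by (auto simp: Z_iff wv_def)
next
  case (YV i)
  then have i: "i \<in> {1..n}" "i \<notin> S" "i \<notin> Rs" "i \<in> U" "i \<notin> Od \<Longrightarrow> top_x i"
    using assms by (auto simp: xy_vars_iff Z_iff U_def)
  then show ?thesis using that(2)[of i] YV wv_notin[of i] Od_coord[of i] by (cases "i \<in> Od") (auto simp: Z_iff wv_def)
qed

lemma free_variables: "q \<inter> polys (xy_vars n - Z) \<subseteq> {0}"
proof -
  let ?R = "XV ` Rs \<union> YV ` Rs"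
  have Rsub: "?R \<subseteq> xy_vars n - Z"
    using bip_roots_sub[of E U] U_verts(1) rootvar_notin_Z by (auto simp: xy_vars_iff)
  have "q \<inter> polys (?R \<union> Y) \<subseteq> {0}" if "finite Y" "Y \<subseteq> xy_vars n - Z - ?R" for Y
    using that
  proof (induction Y rule: finite_induct)
    case empty
    show ?case using free_roots[OF finite_sets(4)] by simp
  next
    case (insert w Y)
    have w: "w \<in> xy_vars n - Z - ?R" using insert.prems by blast
    have "\<exists>i. scale i w = [:0, mvar w:] \<and> (\<forall>v\<in>?R \<union> Y. scale i v = [:mvar v:]) \<and> mvar w \<notin> q"
      using w
    proof (cases rule: nonroot_free_cases)
      case (1 i)
      then show ?thesis using insert by (intro exI[of _ i]) (auto simp: scale_def)
    next
      case (2 i)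
      then show ?thesis using insert by (intro exI[of _ i]) (auto simp: scale_def)
    qed
    then obtain i where i: "scale i w = [:0, mvar w:]" "\<And>v. v \<in> ?R \<union> Y \<Longrightarrow> scale i v = [:mvar v:]" "mvar w \<notin> q"
      by blast
    have "q \<inter> polys (insert w (?R \<union> Y)) \<subseteq> {0}"
      by (rule extend_free[where \<beta> = "scale i", OF scale_stable i(2) i(1) _ i(3)])
        (use insert Rsub mvarA in auto)
    then show ?case by simp
  qed
  from this[of "xy_vars n - Z - ?R"] Rsub show ?thesis
    by (simp add: xy_vars_def Un_absorb1)
qed

lemma chain_to_min_le:
  assumes "\<And>i. i \<le> k \<Longrightarrow> prime_in A (c i)" "\<And>i. i < k \<Longrightarrow> c i \<subset> c (Suc i)" "c k = q"
  shows "k \<le> card Z"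
proof -
  have "k + card (xy_vars n - Z) \<le> card (xy_vars n)"
    using free_variables assms by (intro chain_length_le[of _ _ k c] card_xy_vars) auto
  moreover have "card (xy_vars n - Z) + card Z = card (xy_vars n)"
    using Z_sub card_xy_vars by (metis card_Diff_subset card_mono finite_subset le_add_diff_inverse2)
  ultimately show ?thesis by linarith
qed

end

section \<open>Localization at a minimal prime and numbers of generators\<close>

abbreviation (input) sub_ring :: "'a::comm_ring_1 set \<Rightarrow> 'a ring" where
  "sub_ring A \<equiv> ring_of_type_algebra\<lparr>carrier := A\<rparr>"

lemma xy_poly_ring_eq: "xy_poly_ring n = sub_ring (polys (xy_vars n))"
  by (simp add: xy_poly_ring_def polys_def xy_vars_def)

definition prime_chain :: "'a::comm_ring_1 set \<Rightarrow> nat \<Rightarrow> (nat \<Rightarrow> 'a set) \<Rightarrow> 'a set \<Rightarrow> bool" where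
  "prime_chain A k c p \<longleftrightarrow> (\<forall>i\<le>k. prime_in A (c i)) \<and> (\<forall>i<k. c i \<subset> c (Suc i)) \<and> c k = p"

lemma prime_height_sub_ring:
  assumes "subring_in A"
  shows "prime_height (sub_ring A) p = Sup {enat k | k. \<exists>c. prime_chain A k c p}"
  unfolding prime_height_def prime_chain_def primeideal_iff_prime_in[OF assms] ..

lemma prime_height_ge:
  assumes "subring_in A" "prime_chain A k c p"
  shows "enat k \<le> prime_height (sub_ring A) p"
  unfolding prime_height_sub_ring[OF assms(1)] using assms(2) by (intro Sup_upper) blast

lemma prime_height_le:
  assumes "subring_in A" "\<And>k c. prime_chain A k c p \<Longrightarrow> k \<le> h"
  shows "prime_height (sub_ring A) p \<le> enat h"
  unfolding prime_height_sub_ring[OF assms(1)] using assms(2) by (intro Sup_least) auto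

text \<open>Only primes inside the top one are considered, since extension to the local ring at
  \<open>q\<close> is prime only for primes inside \<open>q\<close>.\<close>

lemma prime_chain_map:
  assumes c: "prime_chain A k c p" and top: "\<And>p'. prime_in A p' \<Longrightarrow> p' \<subseteq> p \<Longrightarrow> prime_in B (f p')"
    and mono: "\<And>a b. prime_in A a \<Longrightarrow> prime_in A b \<Longrightarrow> b \<subseteq> p \<Longrightarrow> a \<subset> b \<Longrightarrow> f a \<subset> f b"
  shows "prime_chain B k (\<lambda>i. f (c i)) (f p)"
proof -
  have sub: "c i \<subseteq> p" if "i \<le> k" for i
    using that
  proof (induction rule: inc_induct)
    case base
    then show ?case using c by (simp add: prime_chain_def)
  next
    case (step m)
    then show ?case using c by (auto simp: prime_chain_def)
  qed
  show ?thesis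
    using c sub unfolding prime_chain_def
  proof (intro conjI allI impI)
    fix i assume *: "(\<forall>i\<le>k. prime_in A (c i)) \<and> (\<forall>i<k. c i \<subset> c (Suc i)) \<and> c k = p" "i < k"
    then have "c i \<subset> c (Suc i)" "prime_in A (c i)" "prime_in A (c (Suc i))" by auto
    then show "f (c i) \<subset> f (c (Suc i))" using sub[of "Suc i"] * by (intro mono) auto
  next
    fix i assume *: "(\<forall>i\<le>k. prime_in A (c i)) \<and> (\<forall>i<k. c i \<subset> c (Suc i)) \<and> c k = p" "i \<le> k"
    then show "prime_in B (f (c i))" using sub[of i] by (intro top) auto
  qed auto
qed

context edge_ring
begin

definition I :: "'k mpoly set" where
  "I = Idl\<^bsub>xy_poly_ring n\<^esub> (edge_gens E e)"

lemma I_ideal: "ideal_in A I" and gens_I: "edge_gens E e \<subseteq> I"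
  unfolding I_def xy_poly_ring_eq by (rule ideal_in_Idl[OF subring_in_polys gensA])+

lemma I_subset_iff: "ideal_in A p \<Longrightarrow> I \<subseteq> p \<longleftrightarrow> edge_gens E e \<subseteq> p"
  unfolding I_def xy_poly_ring_eq by (rule Idl_subset_iff[OF subring_in_polys gensA])

lemma primeideal_iff: "primeideal p (xy_poly_ring n) \<longleftrightarrow> prime_in A p"
  unfolding xy_poly_ring_eq by (rule primeideal_iff_prime_in[OF subring_in_polys])

lemma edge_prime_iff: "primeideal p (xy_poly_ring n) \<and> I \<subseteq> p \<longleftrightarrow> edge_prime n E e p"
  using I_subset_iff prime_inD(1) edge_ring_axioms unfolding primeideal_iff edge_prime_def edge_prime_axioms_def
  by blast

lemma edge_min_primeI:
  assumes "minimal_prime (xy_poly_ring n) I p"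
  shows "edge_min_prime n E e p"
proof -
  have "edge_prime n E e p" using assms edge_prime_iff by (auto simp: minimal_prime_def)
  moreover have "p' = p" if "prime_in A p'" "edge_gens E e \<subseteq> p'" "p' \<subseteq> p" for p'
    using assms that I_subset_iff[OF prime_inD(1)[OF that(1)]]
    by (auto simp: minimal_prime_def primeideal_iff)
  ultimately show ?thesis by (simp add: edge_min_prime_def edge_min_prime_axioms_def)
qed

end

context edge_min_prime
begin

section \<open>Primes of the local ring\<close>

definition Lc :: "'a mpoly fract set" where
  "Lc = {Fract a b | a b. a \<in> A \<and> b \<in> A - q}"

definition extend :: "'a mpoly set \<Rightarrow> 'a mpoly fract set" where
  "extend K = {Fract a b | a b. a \<in> K \<and> b \<in> A - q}"

definition contract :: "'a mpoly fract set \<Rightarrow> 'a mpoly set" where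
  "contract P = {a \<in> A. Fract a 1 \<in> P}"

lemma nz: "b \<in> A - q \<Longrightarrow> b \<noteq> 0"
  using ideal_inD(2)[OF q_ideal] by auto

lemma den_mult: "a \<in> A - q \<Longrightarrow> b \<in> A - q \<Longrightarrow> a * b \<in> A - q"
  using prodnotin[of a b] mult_in_polys[of a _ b] by auto

lemma one_den: "1 \<in> A - q"
  using prime_inD(2)[OF q] one_in_polys by blast

lemma FractI: "a \<in> K \<Longrightarrow> b \<in> A - q \<Longrightarrow> Fract a b \<in> extend K"
  by (auto simp: extend_def)

lemma LcI: "a \<in> A \<Longrightarrow> b \<in> A - q \<Longrightarrow> Fract a b \<in> Lc"
  by (auto simp: Lc_def)

lemma subring_Lc: "subring_in Lc"
  unfolding subring_in_def
proof (intro conjI ballI)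
  show "1 \<in> Lc" using LcI[OF one_in_polys one_den] by (simp add: One_fract_def)
next
  fix x assume "x \<in> Lc"
  then obtain a b where "x = Fract a b" "a \<in> A" "b \<in> A - q" by (auto simp: Lc_def)
  then show "- x \<in> Lc" using LcI[OF uminus_in_polys, of a b] by simp
next
  fix x y assume "x \<in> Lc" "y \<in> Lc"
  then obtain a b c d where *: "x = Fract a b" "a \<in> A" "b \<in> A - q" "y = Fract c d" "c \<in> A" "d \<in> A - q"
    by (auto simp: Lc_def)
  then have "a * d + c * b \<in> A" "a * c \<in> A" by (auto intro!: add_in_polys mult_in_polys)
  then show "x + y \<in> Lc" "x * y \<in> Lc"
    using LcI[of "a * d + c * b" "b * d"] LcI[of "a * c" "b * d"] den_mult[of b d] * nz[of b] nz[of d]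
    by simp_all
qed

lemma ideal_extend:
  assumes K: "ideal_in A K"
  shows "ideal_in Lc (extend K)"
  unfolding ideal_in_def
proof (intro conjI ballI)
  show "extend K \<subseteq> Lc" using ideal_inD(1)[OF K] by (auto simp: extend_def Lc_def)
  show "0 \<in> extend K" using FractI[OF ideal_inD(2)[OF K] one_den] by (simp add: Zero_fract_def)
next
  fix x y assume "x \<in> extend K" "y \<in> extend K"
  then obtain a b c d where *: "x = Fract a b" "a \<in> K" "b \<in> A - q" "y = Fract c d" "c \<in> K" "d \<in> A - q"
    by (auto simp: extend_def)
  have "a * d + c * b \<in> K"
    using * by (intro ideal_inD(3)[OF K ideal_inD(5)[OF K] ideal_inD(5)[OF K]]) auto
  then show "x + y \<in> extend K" using FractI[OF _ den_mult[of b d]] * nz[of b] nz[of d] by simp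
next
  fix x y assume "x \<in> Lc" "y \<in> extend K"
  then obtain a b c d where *: "x = Fract a b" "a \<in> A" "b \<in> A - q" "y = Fract c d" "c \<in> K" "d \<in> A - q"
    by (auto simp: extend_def Lc_def)
  have "a * c \<in> K" using * by (intro ideal_inD(4)[OF K]) auto
  then show "x * y \<in> extend K" using FractI[OF _ den_mult[of b d]] * by simp
qed

lemma rhom_Fract: "rhom (\<lambda>a :: 'a mpoly. Fract a 1)"
  by (simp add: rhom_def Zero_fract_def One_fract_def)

lemma Fract_in_Lc: "a \<in> A \<Longrightarrow> Fract a 1 \<in> Lc"
  by (rule LcI[OF _ one_den])

lemma contract_extend: "prime_in A p \<Longrightarrow> p \<subseteq> q \<Longrightarrow> contract (extend p) = p"
proof -
  assume p: "prime_in A p" "p \<subseteq> q"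
  note id = prime_inD(1)[OF p(1)]
  have "a \<in> p" if a: "a \<in> A" "Fract a 1 \<in> extend p" for a
  proof -
    obtain c d where cd: "Fract a 1 = Fract c d" "c \<in> p" "d \<in> A - q" using a(2) by (auto simp: extend_def)
    then have "a * d = c" using nz[of d] by (simp add: eq_fract)
    then show ?thesis using prime_inD(3)[OF p(1) a(1), of d] cd p(2) by blast
  qed
  then show ?thesis using ideal_inD(1)[OF id] FractI[OF _ one_den] by (auto simp: contract_def)
qed

lemma prime_extend:
  assumes p: "prime_in A p" "p \<subseteq> q"
  shows "prime_in Lc (extend p)"
  unfolding prime_in_def
proof (intro conjI ballI impI)
  show "ideal_in Lc (extend p)" by (rule ideal_extend[OF prime_inD(1)[OF p(1)]])
  show "1 \<notin> extend p"
    using contract_extend[OF p] prime_inD(2)[OF p(1)] one_in_polys by (auto simp: contract_def One_fract_def)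
next
  fix x y assume "x \<in> Lc" "y \<in> Lc" and xy: "x * y \<in> extend p"
  then obtain a b c d where *: "x = Fract a b" "a \<in> A" "b \<in> A - q" "y = Fract c d" "c \<in> A" "d \<in> A - q"
    by (auto simp: Lc_def)
  obtain r s where rs: "x * y = Fract r s" "r \<in> p" "s \<in> A - q" using xy by (auto simp: extend_def)
  have "a * c * s = r * (b * d)" using rs(1) * nz[of b] nz[of d] nz[OF rs(3)] by (simp add: eq_fract)
  moreover have "r * (b * d) \<in> p"
    using rs(2) * by (intro ideal_inD(5)[OF prime_inD(1)[OF p(1)]] mult_in_polys) auto
  ultimately have "a * c \<in> p \<or> s \<in> p"
    using prime_inD(3)[OF p(1), of "a * c" s] * rs(3) mult_in_polys by auto
  then have "a \<in> p \<or> c \<in> p" using prime_inD(3)[OF p(1), of a c] * rs(3) p(2) by blast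
  then show "x \<in> extend p \<or> y \<in> extend p" using * FractI by blast
qed

lemma prime_contract: "prime_in Lc P \<Longrightarrow> prime_in A (contract P)"
  unfolding contract_def by (rule prime_in_contract[OF subring_in_polys rhom_Fract]) (auto intro: Fract_in_Lc)

lemma contract_subset:
  assumes P: "prime_in Lc P"
  shows "contract P \<subseteq> q"
proof
  fix a assume a: "a \<in> contract P"
  show "a \<in> q"
  proof (rule ccontr)
    assume "a \<notin> q"
    then have aq: "a \<in> A - q" using a by (auto simp: contract_def)
    then have "Fract 1 a * Fract a 1 \<in> P"
      using a by (intro ideal_inD(4)[OF prime_inD(1)[OF P] LcI[OF one_in_polys aq]]) (simp add: contract_def)
    moreover have "Fract a a = 1" using nz[OF aq] by (simp add: One_fract_def eq_fract)
    ultimately have "1 \<in> P" by simp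
    with prime_inD(2)[OF P] show False by blast
  qed
qed

lemma extend_contract:
  assumes P: "ideal_in Lc P"
  shows "extend (contract P) = P"
proof
  show "extend (contract P) \<subseteq> P"
  proof
    fix x assume "x \<in> extend (contract P)"
    then obtain a b where *: "x = Fract a b" "a \<in> A" "Fract a 1 \<in> P" "b \<in> A - q" by (auto simp: extend_def contract_def)
    then have "Fract 1 b * Fract a 1 \<in> P"
      by (intro ideal_inD(4)[OF P LcI[OF one_in_polys *(4)]])
    then show "x \<in> P" using * by simp
  qed
  show "P \<subseteq> extend (contract P)"
  proof
    fix x assume x: "x \<in> P"
    then obtain a b where *: "x = Fract a b" "a \<in> A" "b \<in> A - q"
      using ideal_inD(1)[OF P] unfolding Lc_def by blast
    then have "Fract b 1 * x \<in> P"
      using ideal_inD(4)[OF P _ x] Fract_in_Lc by blast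
    also have "Fract b 1 * x = Fract a 1" using * nz[of b] by (simp add: eq_fract)
    finally have "a \<in> contract P" using *(2) by (simp add: contract_def)
    then show "x \<in> extend (contract P)" using FractI *(1,3) by blast
  qed
qed

lemma I_sub: "I \<subseteq> q"
  using I_subset_iff[OF q_ideal] gens_q by blast

text \<open>A prime of the local ring contracts to a prime inside \<open>q\<close>, and by
  minimality only \<open>q\<close> contains the ideal there. So the height of the extended ideal is
  the height of a single prime.\<close>

lemma prime_above_J:
  assumes P: "prime_in Lc P" "extend I \<subseteq> P"
  shows "P = extend q"
proof -
  have "I \<subseteq> contract P"
    using P(2) FractI[OF _ one_den, of _ I] ideal_inD(1)[OF I_ideal] by (auto simp: contract_def)
  then have "edge_gens E e \<subseteq> contract P" using gens_I by blast
  then have "contract P = q" by (rule minimal[OF prime_contract[OF P(1)] _ contract_subset[OF P(1)]])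
  then show ?thesis using extend_contract[OF prime_inD(1)[OF P(1)]] by simp
qed

lemma localization_eq: "localization (xy_poly_ring n) q = sub_ring Lc"
  by (simp add: localization_def xy_poly_ring_eq Lc_def)

lemma localized_ideal_eq: "localized_ideal (xy_poly_ring n) q K = extend K"
  by (simp add: localized_ideal_def xy_poly_ring_eq extend_def)

lemma height_extend_q: "prime_height (sub_ring Lc) (extend q) = enat (card Z)"
proof (rule antisym)
  show "prime_height (sub_ring Lc) (extend q) \<le> enat (card Z)"
  proof (rule prime_height_le[OF subring_Lc])
    fix k c assume c: "prime_chain Lc k c (extend q)"
    have "prime_chain A k (\<lambda>i. contract (c i)) (contract (extend q))"
    proof (rule prime_chain_map[OF c])
      fix a b assume ab: "prime_in Lc a" "prime_in Lc b" "a \<subset> b"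
      then have "contract a \<subseteq> contract b" by (auto simp: contract_def)
      moreover have "contract a \<noteq> contract b"
        using extend_contract[OF prime_inD(1)[OF ab(1)]] extend_contract[OF prime_inD(1)[OF ab(2)]] ab(3) by (metis psubsetE)
      ultimately show "contract a \<subset> contract b" by blast
    qed (rule prime_contract)
    then show "k \<le> card Z"
      using contract_extend[OF q] by (intro chain_to_min_le[of k "\<lambda>i. contract (c i)"]) (auto simp: prime_chain_def)
  qed
  obtain c where "prime_chain A (card Z) c q" using ex_chain unfolding prime_chain_def by blast
  then have "prime_chain Lc (card Z) (\<lambda>i. extend (c i)) (extend q)"
  proof (rule prime_chain_map[OF _ prime_extend])
    fix a b assume ab: "prime_in A a" "prime_in A b" "b \<subseteq> q" "a \<subset> b"
    then have "extend a \<subseteq> extend b" by (auto simp: extend_def)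
    moreover have "extend a \<noteq> extend b"
      using contract_extend[OF ab(1)] contract_extend[OF ab(2)] ab(3,4) by (metis psubset_eq subset_trans)
    ultimately show "extend a \<subset> extend b" by blast
  qed auto
  then show "enat (card Z) \<le> prime_height (sub_ring Lc) (extend q)"
    by (rule prime_height_ge[OF subring_Lc])
qed

lemma ht_extend_I: "ht (sub_ring Lc) (extend I) = enat (card Z)"
proof -
  have "extend I \<subseteq> extend q" using I_sub by (auto simp: extend_def)
  then have "P = extend q \<longleftrightarrow> primeideal P (sub_ring Lc) \<and> extend I \<subseteq> P" for P
    using prime_above_J prime_extend[OF q subset_refl] unfolding primeideal_iff_prime_in[OF subring_Lc] by blast
  then have "ht (sub_ring Lc) (extend I) = Inf {prime_height (sub_ring Lc) P | P. P = extend q}"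
    unfolding ht_def by presburger
  then show ?thesis by (simp add: height_extend_q)
qed

section \<open>Number of generators of the local ideal\<close>

text \<open>Minimality enters through \<open>S_in_saturation\<close>, which puts the variables of
  \<open>S\<close> into the saturation; the remaining relations follow from the edge forms.\<close>

lemma fz_denominator:
  assumes "z \<in> Z"
  shows "\<exists>u\<in>A - q. u * fz z \<in> I"
proof -
  note sat = saturated_saturation[OF I_ideal I_sub]
  have "fz z \<in> saturation I"
    using fz_in[OF sat(1) _ _ assms] S_in_saturation[OF sat(1)] sat(2) gens_I by blast
  then show ?thesis by (auto simp: saturation_def)
qed

text \<open>
  Expressing the elements \<open>fz z\<close> through fewer generators would make the rows of their Jacobian matrix
  linearly dependent modulo \<open>q\<close>, but this matrix is triangular with nonzero diagonal.
\<close>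

lemma gens_count_ge:
  assumes B: "finite B" "B \<subseteq> Lc" "Idl\<^bsub>sub_ring Lc\<^esub> B = extend I"
  shows "card Z \<le> card B"
proof (rule ccontr)
  assume less: "\<not> card Z \<le> card B"
  have "B \<subseteq> extend I" using ideal_in_Idl(2)[OF subring_Lc B(2)] B(3) by simp
  then have "\<forall>b\<in>B. \<exists>g s. b = Fract g s \<and> g \<in> I \<and> s \<in> A - q" by (auto simp: extend_def)
  then obtain g s where gs: "\<And>b. b \<in> B \<Longrightarrow> b = Fract (g b) (s b) \<and> g b \<in> I \<and> s b \<in> A - q" by metis
  \<comment> \<open>Denominators are units of the local ring, so the numerators generate
    locally.\<close>
  define M where "M = g ` B"
  have M: "finite M" "M \<subseteq> I" "card M \<le> card B"
    using B(1) gs by (auto simp: M_def card_image_le)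
  have MA: "M \<subseteq> A" using M(2) ideal_inD(1)[OF I_ideal] by blast
  define K where "K = Idl\<^bsub>sub_ring A\<^esub> M"
  have K: "ideal_in A K" "M \<subseteq> K" unfolding K_def by (rule ideal_in_Idl[OF subring_in_polys MA])+
  have "B \<subseteq> extend K"
  proof
    fix b assume b: "b \<in> B"
    then have "g b \<in> K" using K(2) by (auto simp: M_def)
    then show "b \<in> extend K" using FractI gs[OF b] by metis
  qed
  then have IK: "extend I \<subseteq> extend K"
    using Idl_subset_iff[OF subring_Lc B(2) ideal_extend[OF K(1)]] B(3) by simp
  have "\<exists>t c. t \<in> A - q \<and> (\<forall>y\<in>M. c y \<in> A) \<and> t * fz z = (\<Sum>y\<in>M. c y * y)" if z: "z \<in> Z" for z
  proof -
    obtain u where u: "u \<in> A - q" "u * fz z \<in> I" using fz_denominator[OF z] by blast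
    then have "Fract (u * fz z) u \<in> extend K" using IK FractI[of "u * fz z" I u] by blast
    then obtain a b where ab: "Fract (u * fz z) u = Fract a b" "a \<in> K" "b \<in> A - q" by (auto simp: extend_def)
    have "b * fz z = a"
      using ab(1) nz[OF u(1)] nz[OF ab(3)] by (simp add: eq_fract mult.commute mult.left_commute)
    moreover obtain c where "a = (\<Sum>y\<in>M. c y * y)" "\<forall>y\<in>M. c y \<in> A"
      using ab(2) unfolding K_def Idl_eq_sums[OF subring_in_polys M(1) MA] by blast
    ultimately show ?thesis using ab(3) by blast
  qed
  then have "\<forall>z\<in>Z. \<exists>tc. fst tc \<in> A - q \<and> (\<forall>y\<in>M. snd tc y \<in> A) \<and> fst tc * fz z = (\<Sum>y\<in>M. snd tc y * y)"
    by simp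
  from bchoice[OF this] obtain tc where
    "\<forall>z\<in>Z. fst (tc z) \<in> A - q \<and> (\<forall>y\<in>M. snd (tc z) y \<in> A) \<and> fst (tc z) * fz z = (\<Sum>y\<in>M. snd (tc z) y * y)" ..
  then obtain t c where tc: "\<And>z. z \<in> Z \<Longrightarrow> t z \<in> A - q" "\<And>z y. z \<in> Z \<Longrightarrow> y \<in> M \<Longrightarrow> c z y \<in> A"
    "\<And>z. z \<in> Z \<Longrightarrow> t z * fz z = (\<Sum>y\<in>M. c z y * y)"
    using that[of "\<lambda>z. fst (tc z)" "\<lambda>z. snd (tc z)"] by blast
  obtain w where w: "\<forall>z\<in>Z. w z \<in> A" "\<exists>z\<in>Z. w z \<notin> q" "\<forall>y\<in>M. (\<Sum>z\<in>Z. w z * c z y) \<in> q"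
    using lin_dep_mod_prime[OF subring_in_polys q M(1) finite_Z, of c] M(3) less tc(2) by auto
  \<comment> \<open>Differentiate a combination of the \<open>fz z\<close> written in the
    generators. All \<open>fz z\<close>, all generators and the coefficients \<open>r y\<close> lie
    in \<open>q\<close>, so modulo \<open>q\<close> the product rule leaves only this sum.\<close>
  have der: "(\<Sum>z\<in>Z. w z * t z * pder v (fz z)) \<in> q" for v
  proof -
    have "(\<Sum>z\<in>Z. w z * (t z * fz z)) = (\<Sum>z\<in>Z. \<Sum>y\<in>M. w z * c z y * y)"
      using tc(3) by (simp add: sum_distrib_left mult.assoc)
    also have "\<dots> = (\<Sum>y\<in>M. (\<Sum>z\<in>Z. w z * c z y) * y)"
      by (subst sum.swap) (simp add: sum_distrib_right)
    finally have eq: "(\<Sum>z\<in>Z. (w z * t z) * fz z) = (\<Sum>y\<in>M. (\<Sum>z\<in>Z. w z * c z y) * y)"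
      by (simp add: mult.assoc)
    define r where "r y = (\<Sum>z\<in>Z. w z * c z y)" for y
    have "pder v (\<Sum>y\<in>M. r y * y) \<in> q"
      unfolding pder_sum pder_mult
    proof (rule ideal_in_sum[OF q_ideal], rule ideal_inD(3)[OF q_ideal])
      fix y assume y: "y \<in> M"
      have rA: "r y \<in> A"
        unfolding r_def using w(1) tc(2) y by (intro sum_in_polys mult_in_polys) auto
      have "y \<in> q" using y M(2) I_sub by blast
      then show "pder v (r y) * y \<in> q"
        by (intro ideal_inD(4)[OF q_ideal] pder_in_polys[OF rA])
      show "r y * pder v y \<in> q"
        using w(3) y MA by (intro ideal_inD(5)[OF q_ideal] pder_in_polys) (auto simp: r_def)
    qed
    moreover have "pder v (\<Sum>z\<in>Z. (w z * t z) * fz z) =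
        (\<Sum>z\<in>Z. pder v (w z * t z) * fz z) + (\<Sum>z\<in>Z. w z * t z * pder v (fz z))"
      by (simp add: pder_sum pder_mult[of v "_ * _" "fz _"] sum.distrib)
    moreover have "(\<Sum>z\<in>Z. pder v (w z * t z) * fz z) \<in> q"
      using w(1) tc(1) fz_q
      by (intro ideal_in_sum[OF q_ideal] ideal_inD(4)[OF q_ideal] pder_in_polys mult_in_polys) auto
    ultimately show ?thesis
      using ideal_in_diff(1)[OF subring_in_polys q_ideal, of "pder v (\<Sum>z\<in>Z. (w z * t z) * fz z)"
          "\<Sum>z\<in>Z. pder v (w z * t z) * fz z"] eq by (simp add: r_def)
  qed
  define W where "W = {z \<in> Z. w z \<notin> q}"
  have W: "finite W" "W \<noteq> {}" using w(2) finite_Z by (auto simp: W_def)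
  \<comment> \<open>Among the rows with coefficient outside \<open>q\<close> take one of highest
    rank: \<open>z\<close> does not occur in the other such relations, and the column of
    \<open>z\<close> reduces to its diagonal entry.\<close>
  obtain z where z: "z \<in> W" "\<And>z'. z' \<in> W \<Longrightarrow> rk z' \<le> rk z"
    using Max_in[of "rk ` W"] Max_ge[of "rk ` W"] W by fastforce
  then have zZ: "z \<in> Z" "w z \<notin> q" by (auto simp: W_def)
  have "(\<Sum>z'\<in>Z - {z}. w z' * t z' * pder z (fz z')) \<in> q"
  proof (rule ideal_in_sum[OF q_ideal])
    fix z' assume z': "z' \<in> Z - {z}"
    then have fA: "fz z' \<in> A" "t z' \<in> A" using fz_q[of z'] ideal_inD(1)[OF q_ideal] tc(1) by auto
    show "w z' * t z' * pder z (fz z') \<in> q"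
    proof (cases "z' \<in> W")
      case True
      then have "z \<notin> indets (fz z')" using fz_triangular[of z' z] z(2)[OF True] zZ z' by force
      then have "pder z (fz z') = 0" by (intro pder_free[of _ "indets (fz z')"]) (auto simp: polys_def)
      then show ?thesis using ideal_inD(2)[OF q_ideal] by simp
    next
      case False
      then have "w z' \<in> q" using z' by (simp add: W_def)
      then show ?thesis using fA by (intro ideal_inD(5)[OF q_ideal] pder_in_polys)
    qed
  qed
  from ideal_in_diff(1)[OF subring_in_polys q_ideal der[of z] this]
  have "w z * t z * pder z (fz z) \<in> q"
    unfolding sum.remove[OF finite_Z zZ(1)] by simp
  moreover have "w z * t z * pder z (fz z) \<notin> q"
    using zZ w(1) tc(1) pder_fz[OF zZ(1)] fz_q[OF zZ(1)] ideal_inD(1)[OF q_ideal]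
    by (intro prodnotin mult_in_polys pder_in_polys) auto
  ultimately show False by blast
qed

text \<open>For the upper bound, the ideal generated locally by the \<open>fz z\<close> contracts to
  a saturated ideal, and by \<open>gens_of_fz\<close> this contains the edge forms.\<close>

lemma num_gens_extend_I: "num_gens (sub_ring Lc) (extend I) = enat (card Z)"
proof (rule antisym)
  define F where "F = (\<lambda>z. Fract (fz z) 1) ` Z"
  have fzA: "fz z \<in> A" if "z \<in> Z" for z using ideal_inD(1)[OF q_ideal fz_q[OF that]] .
  have F: "finite F" "F \<subseteq> Lc" "card F \<le> card Z"
    using finite_Z fzA Fract_in_Lc by (auto simp: F_def card_image_le)
  have FI: "F \<subseteq> extend I"
  proof
    fix x assume "x \<in> F"
    then obtain z where z: "z \<in> Z" "x = Fract (fz z) 1" by (auto simp: F_def)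
    obtain u where u: "u \<in> A - q" "u * fz z \<in> I" using fz_denominator[OF z(1)] by blast
    then have "Fract (u * fz z) u \<in> extend I" using FractI by blast
    moreover have "Fract (u * fz z) u = x" using z(2) nz[OF u(1)] by (simp add: eq_fract)
    ultimately show "x \<in> extend I" by simp
  qed
  define K where "K = Idl\<^bsub>sub_ring Lc\<^esub> F"
  have K: "ideal_in Lc K" "F \<subseteq> K" unfolding K_def by (rule ideal_in_Idl[OF subring_Lc F(2)])+
  have "K \<subseteq> extend I" unfolding K_def using Idl_subset_iff[OF subring_Lc F(2) ideal_extend[OF I_ideal]] FI by blast
  moreover have "extend I \<subseteq> K"
  proof -
    have conK: "ideal_in A (contract K)"
      unfolding ideal_in_def contract_def
    proof (intro conjI ballI)
      fix a b assume "a \<in> {a \<in> A. Fract a 1 \<in> K}" "b \<in> {a \<in> A. Fract a 1 \<in> K}"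
      then show "a + b \<in> {a \<in> A. Fract a 1 \<in> K}"
        using ideal_inD(3)[OF K(1), of "Fract a 1" "Fract b 1"] by (simp add: add_in_polys)
    next
      fix a b assume "a \<in> A" "b \<in> {a \<in> A. Fract a 1 \<in> K}"
      then show "a * b \<in> {a \<in> A. Fract a 1 \<in> K}"
        using ideal_inD(4)[OF K(1) Fract_in_Lc, of a "Fract b 1"] by (simp add: mult_in_polys)
    qed (use ideal_inD(2)[OF K(1)] in \<open>auto simp: zero_in_polys Zero_fract_def\<close>)
    have "extend I \<subseteq> extend q" using I_sub by (auto simp: extend_def)
    then have "contract K \<subseteq> contract (extend q)" using \<open>K \<subseteq> extend I\<close> by (auto simp: contract_def)
    then have "contract K \<subseteq> q" using contract_extend[OF q] by simp
    moreover have "g \<in> contract K" if ug: "u \<in> A" "g \<in> A" "u \<notin> q" "u * g \<in> contract K" for u g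
    proof -
      have u: "u \<in> A - q" using ug by blast
      have "Fract 1 u * Fract (u * g) 1 \<in> K"
        using ug(4) by (intro ideal_inD(4)[OF K(1) LcI[OF one_in_polys u]]) (simp add: contract_def)
      also have "Fract 1 u * Fract (u * g) 1 = Fract g 1" using nz[OF u] by (simp add: eq_fract)
      finally show ?thesis using ug by (simp add: contract_def)
    qed
    ultimately have "saturated (contract K)" using conK unfolding saturated_def by blast
    moreover have "fz z \<in> contract K" if "z \<in> Z" for z
      using that fzA K(2) by (auto simp: contract_def F_def)
    ultimately have "edge_gens E e \<subseteq> contract K" by (rule gens_of_fz)
    then have "I \<subseteq> contract K" using I_subset_iff[OF conK] by blast
    then have "extend I \<subseteq> extend (contract K)" by (auto simp: extend_def)
    then show ?thesis using extend_contract[OF K(1)] by simp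
  qed
  ultimately have "Idl\<^bsub>sub_ring Lc\<^esub> F = extend I" by (simp add: K_def)
  then have "num_gens (sub_ring Lc) (extend I) \<le> enat (card F)"
    unfolding num_gens_def using F by (intro Inf_lower) auto
  also have "\<dots> \<le> enat (card Z)" using F(3) by simp
  finally show "num_gens (sub_ring Lc) (extend I) \<le> enat (card Z)" .
  show "enat (card Z) \<le> num_gens (sub_ring Lc) (extend I)"
    unfolding num_gens_def using gens_count_ge by (intro Inf_greatest) auto
qed

lemma local_complete_intersection:
  "num_gens (localization (xy_poly_ring n) q) (localized_ideal (xy_poly_ring n) q I) =
   ht (localization (xy_poly_ring n) q) (localized_ideal (xy_poly_ring n) q I)"
  unfolding localization_eq localized_ideal_eq using num_gens_extend_I ht_extend_I by simp

end

context edge_ring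
begin

section \<open>Minimal generating sets of the ideal of a graph\<close>

text \<open>\<open>Min\<close> and \<open>Max\<close> order the ends, so that generators are indexed
  by edges and not by ordered pairs.\<close>

definition edge_form :: "nat set \<Rightarrow> 'k mpoly" where
  "edge_form d = bf (Min d) (Max d)"

context
  assumes E2: "\<And>d. d \<in> E \<Longrightarrow> card d = 2"
begin

lemma edge_pair:
  assumes "d \<in> E"
  obtains i j where "d = {i, j}" "i < j" "i \<in> {1..n}" "j \<in> {1..n}" "edge_form d = bf i j"
proof -
  obtain a b where ab: "d = {a, b}" "a \<noteq> b" using E2[OF assms] by (auto simp: card_2_iff)
  then have v: "a \<in> {1..n}" "b \<in> {1..n}" using edge_verts[of a b] assms by auto
  consider "a < b" | "b < a" using ab(2) by linarith
  then show thesis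
  proof cases
    case 1
    then show ?thesis using ab v by (intro that[of a b]) (auto simp: edge_form_def)
  next
    case 2
    then show ?thesis using ab v by (intro that[of b a]) (auto simp: edge_form_def)
  qed
qed

lemma finite_E: "finite E"
proof (rule finite_subset)
  show "E \<subseteq> Pow {1..n}" by (auto elim: edge_pair)
qed simp

lemma edge_gens_eq: "edge_gens E e = edge_form ` E"
proof
  show "edge_gens E e \<subseteq> edge_form ` E"
  proof
    fix g assume "g \<in> edge_gens E e"
    then obtain i j where ij: "g = bf i j" "{i, j} \<in> E" by (auto simp: edge_gens_def)
    obtain a b where "{i, j} = {a, b}" "edge_form {i, j} = bf a b" using edge_pair[OF ij(2)] by metis
    then have "edge_form {i, j} = bf i j" using bform_commute by (metis doubleton_eq_iff)
    then show "g \<in> edge_form ` E" using ij by (metis imageI)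
  qed
  show "edge_form ` E \<subseteq> edge_gens E e"
  proof
    fix g assume "g \<in> edge_form ` E"
    then obtain d where d: "d \<in> E" "g = edge_form d" by blast
    obtain i j where "d = {i, j}" "edge_form d = bf i j" using edge_pair[OF d(1)] by metis
    then show "g \<in> edge_gens E e" using d unfolding edge_gens_def by blast
  qed
qed

text \<open>
  Substituting \<open>T v\<close> for every variable \<open>v\<close> and comparing coefficients of \<open>T\<^sup>2\<close>, a generating set of \<open>I\<close>
  spans the quadrics \<open>edge_form d\<close> over the field; these are linearly independent.
\<close>

lemma hom_gens_ge:
  assumes B: "finite B" "B \<subseteq> A" "Idl\<^bsub>sub_ring A\<^esub> B = I"
  shows "card E \<le> card B"
proof (rule ccontr)
  assume less: "\<not> card E \<le> card B"
  define \<theta> :: "lss_var \<Rightarrow> 'k mpoly poly" where "\<theta> v = [:0, mvar v:]" for v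
  define c0 where "c0 = ev (\<lambda>x::'k. x) (\<lambda>_. 0)"
  have coeff0: "poly.coeff (pev \<theta> g) 0 = mconst (c0 g)" for g
  proof -
    have "g \<in> polys UNIV" by (simp add: polys_def)
    then show ?thesis
      unfolding c0_def
      by (rule rhom_eqI[OF _ rhom_comp[OF rhom_coeff_0 rhom_pev] rhom_comp[OF rhom_mconst rhom_ev[OF rhom_id]]])
        (simp_all add: pev_mconst pev_mvar \<theta>_def ev_mconst[OF rhom_id] ev_mvar[OF rhom_id])
  qed
  have pev_form: "pev \<theta> (bf i j) = [:0, 0, bf i j:]" for i j
    unfolding pev_bf by (simp add: \<theta>_def bform_def)
  \<comment> \<open>The elements without terms of degree 0 and 1. For generators of this kind only
    the constant terms of their coefficients affect degree 2.\<close>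
  define K where "K = {g \<in> A. poly.coeff (pev \<theta> g) 0 = 0 \<and> poly.coeff (pev \<theta> g) 1 = 0}"
  have c1: "poly.coeff (P * Q) (Suc 0) = poly.coeff P 0 * poly.coeff Q 1 + poly.coeff P 1 * poly.coeff Q 0"
    for P Q :: "'k mpoly poly"
    by (simp add: coeff_mult)
  have c2: "poly.coeff (P * Q) 2 = poly.coeff P 0 * poly.coeff Q 2 + poly.coeff P 1 * poly.coeff Q 1 + poly.coeff P 2 * poly.coeff Q 0"
    for P Q :: "'k mpoly poly"
    by (simp add: coeff_mult numeral_2_eq_2)
  have "ideal_in A K"
    by (auto simp: ideal_in_def K_def zero_in_polys add_in_polys mult_in_polys rhomD[OF rhom_pev] coeff_mult)
  moreover have "edge_gens E e \<subseteq> K"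
    using gensA by (auto simp: K_def edge_gens_def pev_form)
  ultimately have IK: "I \<subseteq> K" using I_subset_iff by blast
  have BI: "B \<subseteq> I" using ideal_in_Idl(2)[OF subring_in_polys B(2)] B(3) by simp
  have "\<exists>c. edge_form d = (\<Sum>b\<in>B. c b * b)" if "d \<in> E" for d
  proof -
    have "edge_form d \<in> I" using that gens_I by (auto simp: edge_gens_eq)
    then show ?thesis using Idl_eq_sums[OF subring_in_polys B(1,2)] B(3) by blast
  qed
  then obtain c where c: "\<And>d. d \<in> E \<Longrightarrow> edge_form d = (\<Sum>b\<in>B. c d b * b)" by metis
  have form: "edge_form d = (\<Sum>b\<in>B. mconst (c0 (c d b)) * poly.coeff (pev \<theta> b) 2)" if d: "d \<in> E" for d
  proof -
    obtain i j where "edge_form d = bf i j" using edge_pair[OF d] by metis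
    then have "edge_form d = poly.coeff (pev \<theta> (edge_form d)) 2" by (simp add: pev_form numeral_2_eq_2)
    also have "\<dots> = (\<Sum>b\<in>B. poly.coeff (pev \<theta> (c d b) * pev \<theta> b) 2)"
      by (simp add: c[OF d] rhom_sum[OF rhom_pev] rhomD[OF rhom_pev] coeff_sum)
    also have "\<dots> = (\<Sum>b\<in>B. mconst (c0 (c d b)) * poly.coeff (pev \<theta> b) 2)"
      using BI IK by (intro sum.cong refl) (auto simp: c2 coeff0 K_def)
    finally show ?thesis .
  qed
  have "subring_in (UNIV :: 'k set)" "prime_in (UNIV :: 'k set) {0}"
    by (auto simp: subring_in_def prime_in_def ideal_in_def)
  then obtain w where w: "\<exists>d\<in>E. w d \<notin> {0}" "\<forall>b\<in>B. (\<Sum>d\<in>E. w d * c0 (c d b)) \<in> {0}"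
    using lin_dep_mod_prime[of UNIV "{0}" B E "\<lambda>d b. c0 (c d b)"] B(1) finite_E less by auto
  have "(\<Sum>d\<in>E. mconst (w d) * edge_form d) =
      (\<Sum>d\<in>E. \<Sum>b\<in>B. mconst (w d * c0 (c d b)) * poly.coeff (pev \<theta> b) 2)"
  proof (rule sum.cong[OF refl])
    fix d assume "d \<in> E"
    show "mconst (w d) * edge_form d = (\<Sum>b\<in>B. mconst (w d * c0 (c d b)) * poly.coeff (pev \<theta> b) 2)"
      unfolding form[OF \<open>d \<in> E\<close>] sum_distrib_left by (simp add: mult.assoc rhomD(4)[OF rhom_mconst])
  qed
  also have "\<dots> = (\<Sum>b\<in>B. mconst (\<Sum>d\<in>E. w d * c0 (c d b)) * poly.coeff (pev \<theta> b) 2)"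
    by (subst sum.swap) (simp add: sum_distrib_right rhom_sum[OF rhom_mconst])
  also have "\<dots> = 0" using w(2) by (intro sum.neutral) auto
  finally have zero: "(\<Sum>d\<in>E. mconst (w d) * edge_form d) = 0" .
  obtain d where d: "d \<in> E" "w d \<noteq> 0" using w(1) by blast
  \<comment> \<open>The indicator of the ends of \<open>d\<close> in the x-coordinates, zero in the
    y-coordinates: the form of \<open>d\<close> takes the value 1 there and every other edge form
    vanishes.\<close>
  define \<alpha> :: "lss_var \<Rightarrow> 'k" where "\<alpha> v = (case v of XV i \<Rightarrow> of_bool (i \<in> d) | YV i \<Rightarrow> 0)" for v
  note h = rhom_ev[OF rhom_id, of \<alpha>]
  have val: "ev (\<lambda>x. x) \<alpha> (edge_form d') = of_bool (d' = d)" if d': "d' \<in> E" for d'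
  proof -
    obtain a b where ab: "d' = {a, b}" "a < b" "edge_form d' = bf a b" using edge_pair[OF d'] by metis
    obtain i j where ij: "d = {i, j}" "i < j" using edge_pair[OF d(1)] by metis
    have "ev (\<lambda>x. x) \<alpha> (bf a b) = \<alpha> (XV a) * \<alpha> (XV b)"
      by (simp add: bform_def rhomD[OF h] ev_mvar[OF rhom_id] \<alpha>_def)
    also have "\<dots> = of_bool (d' = d)" using ab ij by (auto simp: \<alpha>_def doubleton_eq_iff)
    finally show ?thesis using ab(3) by simp
  qed
  have "0 = ev (\<lambda>x. x) \<alpha> (\<Sum>d\<in>E. mconst (w d) * edge_form d)" unfolding zero by (simp add: rhomD[OF h])
  also have "\<dots> = (\<Sum>d'\<in>E. w d' * of_bool (d' = d))"
    by (simp add: rhom_sum[OF h] rhomD[OF h] ev_mconst[OF rhom_id] val)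
  also have "\<dots> = w d" using d(1) finite_E by (simp add: of_bool_def if_distrib cong: if_cong)
  finally show False using d(2) by simp
qed

lemma homogeneous_bform: "homogeneous (bf i j)"
  unfolding homogeneous_def
proof (intro exI[of _ 2] ballI)
  fix m assume m: "m \<in> Poly_Mapping.keys (bf i j)"
  define s where "s v w = (Poly_Mapping.single v 1 + Poly_Mapping.single w 1 :: lss_var \<Rightarrow>\<^sub>0 nat)" for v w
  have "Poly_Mapping.keys (e * (yvar i * yvar j)) \<subseteq> {s (YV i) (YV j)}"
    using e_cases keys_mult[of "yvar i :: 'k mpoly" "yvar j"]
    by (auto simp: mvar_def s_def mult_single simp flip: single_uminus)
  moreover have "Poly_Mapping.keys (xvar i * xvar j :: 'k mpoly) \<subseteq> {s (XV i) (XV j)}"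
    by (simp add: mvar_def s_def mult_single)
  ultimately have "m = s (XV i) (XV j) \<or> m = s (YV i) (YV j)"
    using m Poly_Mapping.keys_add[of "xvar i * xvar j" "e * (yvar i * yvar j)"] unfolding bform_def by blast
  moreover have "total_deg (s v w) = 2" for v w
  proof -
    have "Poly_Mapping.keys (s v w) = {v, w}"
      by (auto simp: s_def in_keys_iff lookup_add lookup_single when_def split: if_splits)
    then show ?thesis
      by (cases "v = w") (auto simp: total_deg_def s_def lookup_add lookup_single when_def)
  qed
  ultimately show "total_deg m = 2" by auto
qed

lemma num_hom_gens_I: "num_hom_gens n I = enat (card E)"
proof (rule antisym)
  have "finite (edge_gens E e)" using finite_E by (simp add: edge_gens_eq)
  moreover have "\<forall>g\<in>edge_gens E e. homogeneous g" using homogeneous_bform by (auto simp: edge_gens_def)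
  ultimately have "num_hom_gens n I \<le> enat (card (edge_gens E e))"
    unfolding num_hom_gens_def using gensA
    by (intro Inf_lower CollectI exI[of _ "edge_gens E e"]) (simp add: I_def xy_poly_ring_eq)
  also have "\<dots> \<le> enat (card E)" using finite_E by (simp add: edge_gens_eq card_image_le)
  finally show "num_hom_gens n I \<le> enat (card E)" .
  show "enat (card E) \<le> num_hom_gens n I"
    unfolding num_hom_gens_def xy_poly_ring_eq using hom_gens_ge by (intro Inf_greatest) auto
qed

lemma almost_complete_intersection_iff:
  "almost_complete_intersection n I \<longleftrightarrow> enat (card E) = ht (xy_poly_ring n) I + 1"
  using edge_min_prime.local_complete_intersection[OF edge_min_primeI]
  by (auto simp: almost_complete_intersection_def num_hom_gens_I)

end

end

section \<open>Bounds for the height\<close>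

context edge_ring
begin

lemma ht_xy_poly_ring:
  "ht (xy_poly_ring n) I = Inf {prime_height (xy_poly_ring n) p | p. edge_prime n E e p}"
  unfolding ht_def edge_prime_iff ..

text \<open>The kernel of a rational parametrization is a prime over the ideal. Vertices in
  \<open>S\<close> get the zero vector; elsewhere all x-coordinates and the y-coordinates of the
  roots are free, that is, \<open>n - card S + card R\<close> of the \<open>2 * n\<close> variables,
  and \<open>chain_length_le\<close> bounds the height.\<close>

lemma ht_le:
  fixes rho :: "nat \<Rightarrow> nat" and col :: "nat \<Rightarrow> bool"
  assumes S: "S \<subseteq> {1..n}" and R: "R \<subseteq> {1..n} - S"
    and rho: "\<And>i. i \<in> {1..n} - S \<Longrightarrow> rho i \<in> R" "\<And>r. r \<in> R \<Longrightarrow> rho r = r"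
    and edge: "\<And>i j. {i, j} \<in> E \<Longrightarrow> i \<notin> S \<Longrightarrow> j \<notin> S \<Longrightarrow> rho i = rho j \<and> col i \<noteq> col j"
  shows "ht (xy_poly_ring n) I \<le> enat (n + card S - card R)"
proof -
  define U where "U = {1..n} - S"
  \<comment> \<open>A vertex coloured like its root gets a multiple of the root vector, and one of
    the other colour a vector orthogonal to it, solved for the y-coordinate with
    \<open>e * e = 1\<close>.\<close>
  define \<alpha> :: "lss_var \<Rightarrow> 'k mpoly fract" where
    "\<alpha> v = (case v of
       XV i \<Rightarrow> if i \<in> U then Fract (xvar i) 1 else 0
     | YV i \<Rightarrow> if i \<notin> U then 0
         else if col i = col (rho i) then Fract (xvar i * yvar (rho i)) (xvar (rho i))
         else Fract (- e * (xvar i * xvar (rho i))) (yvar (rho i)))" for v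
  define c where "c a = Fract (mconst a) 1" for a :: 'k
  have Fr: "rhom (\<lambda>a :: 'k mpoly. Fract a 1)"
    by (simp add: rhom_def Zero_fract_def One_fract_def)
  have c: "rhom c" unfolding c_def by (rule rhom_comp[OF Fr rhom_mconst])
  define \<phi> where "\<phi> = ev c \<alpha>"
  have \<phi>: "rhom \<phi>" unfolding \<phi>_def by (rule rhom_ev[OF c])
  have \<phi>_var: "\<phi> (mvar v) = \<alpha> v" for v unfolding \<phi>_def by (rule ev_mvar[OF c])
  have \<phi>_const: "\<phi> (mconst a) = Fract (mconst a) 1" for a unfolding \<phi>_def c_def[symmetric] by (rule ev_mconst[OF c])
  have \<phi>_e: "\<phi> e = Fract e 1"
    using e_cases rhomD(2)[OF \<phi>] rhom_uminus[OF \<phi>, of 1] by (auto simp: One_fract_def)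
  have var_nz: "mvar v \<noteq> (0 :: 'k mpoly)" for v
    unfolding mvar_def by (metis lookup_single_eq lookup_zero one_neq_zero)
  define P where "P = {g \<in> A. \<phi> g \<in> {0}}"
  have "prime_in (UNIV :: 'k mpoly fract set) {0}"
    by (auto simp: prime_in_def ideal_in_def)
  then have P: "prime_in A P"
    unfolding P_def by (rule prime_in_contract[OF subring_in_polys \<phi>]) auto
  have "edge_gens E e \<subseteq> P"
  proof
    fix g assume "g \<in> edge_gens E e"
    then obtain i j where g: "g = bf i j" and ij: "{i, j} \<in> E" by (auto simp: edge_gens_def)
    have v: "i \<in> {1..n}" "j \<in> {1..n}" using edge_verts[OF ij] by auto
    have val: "\<phi> (bf i j) = \<alpha> (XV i) * \<alpha> (XV j) + Fract e 1 * (\<alpha> (YV i) * \<alpha> (YV j))" for i j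
      by (simp add: bform_def rhomD[OF \<phi>] \<phi>_var \<phi>_e)
    have "\<phi> (bf i j) = 0"
    proof (cases "i \<in> U \<and> j \<in> U")
      case True
      then have ij': "rho i = rho j" "col i \<noteq> col j" using edge[OF ij] by (auto simp: U_def)
      have "\<phi> (bf i j) = 0" if "i \<in> U" "j \<in> U" "rho i = rho j" "col i = col (rho i)" "col j \<noteq> col (rho j)" for i j
        unfolding val using that var_nz[of "XV (rho j)"] var_nz[of "YV (rho j)"]
        by (simp add: \<alpha>_def Zero_fract_def eq_fract algebra_simps eea)
      then show ?thesis
        using True ij' bform_commute[of e i j] by (cases "col i = col (rho i)") (metis (full_types))+
    next
      case False
      then show ?thesis unfolding val by (auto simp: \<alpha>_def)
    qed
    then show "g \<in> P" using bfA[OF v] g by (simp add: P_def)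
  qed
  with P have "edge_prime n E e P" by (simp add: edge_prime_def edge_prime_axioms_def edge_ring_axioms)
  then have "ht (xy_poly_ring n) I \<le> prime_height (xy_poly_ring n) P"
    unfolding ht_xy_poly_ring by (intro Inf_lower) blast
  also have "\<dots> \<le> enat (n + card S - card R)"
    unfolding xy_poly_ring_eq
  proof (rule prime_height_le[OF subring_in_polys])
    fix k f assume ch: "prime_chain A k f P"
    define W where "W = XV ` U \<union> YV ` R"
    have "P \<inter> polys W \<subseteq> {0}"
    proof
      fix g assume g: "g \<in> P \<inter> polys W"
      have "\<phi> g = Fract g 1"
      proof (rule rhom_eqI[OF _ \<phi> Fr])
        show "g \<in> polys W" using g by blast
        fix v assume "v \<in> W"
        then show "\<phi> (mvar v) = Fract (mvar v) 1"
          using rho R var_nz by (auto simp: W_def \<phi>_var \<alpha>_def U_def eq_fract mult.commute)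
      qed (rule \<phi>_const)
      then show "g \<in> {0}" using g by (simp add: P_def Zero_fract_def eq_fract)
    qed
    then have "k + card W \<le> card (xy_vars n)"
      using ch R by (intro chain_length_le[of _ _ k f]) (auto simp: prime_chain_def xy_vars_def W_def U_def)
    moreover have "card W = card U + card R"
    proof -
      have "finite U" "finite R" using R by (auto simp: U_def intro: finite_subset)
      then have "card W = card (XV ` U) + card (YV ` R)" unfolding W_def by (intro card_Un_disjoint) auto
      then show ?thesis by (simp add: card_image inj_on_def)
    qed
    moreover have "card U + card S = n"
    proof -
      have "card ({1..n} - S) = card {1..n} - card S" using S by (intro card_Diff_subset finite_subset[OF S]) auto
      moreover have "card S \<le> card {1..n}" using S by (intro card_mono) auto
      ultimately show ?thesis by (simp add: U_def)
    qed
    ultimately show "k \<le> n + card S - card R" using card_xy_vars(1)[of n] by linarith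
  qed
  finally show ?thesis .
qed

text \<open>If \<open>\<pi>\<close> never led from a bipartite component into \<open>S\<close>, the
  orbit of its root would be a closed odd walk. So some vertex of each such component is mapped into
  \<open>S\<close>, to different elements for different components.\<close>

lemma card_roots_le:
  fixes \<pi> :: "nat \<Rightarrow> nat"
  assumes "edge_prime n E e q"
    and edge: "\<And>i. i \<in> {1..n} \<Longrightarrow> {i, \<pi> i} \<in> E" and inj: "inj_on \<pi> {1..n}"
    and orbit: "\<And>i. i \<in> {1..n} \<Longrightarrow> \<exists>k. odd k \<and> (\<pi> ^^ k) i = i"
  shows "n \<le> card (edge_prime.Z n E q)"
proof -
  interpret edge_prime n E e q by fact
  have "\<exists>v\<in>U. rt v = r \<and> \<pi> v \<in> S" if r: "r \<in> Rs" for r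
  proof (rule ccontr)
    assume *: "\<not> ?thesis"
    have rU: "r \<in> U" "r \<notin> Od" "rt r = r" using r bip_roots_sub[of E U] root_rel[OF r] by auto
    have "walk r (odd k) ((\<pi> ^^ k) r)" for k
    proof (induction k)
      case 0
      show ?case using pwalk.start[OF rU(1)] by simp
    next
      case (Suc k)
      let ?v = "(\<pi> ^^ k) r"
      have v: "?v \<in> U" "rt ?v = r" using pwalk_in[OF Suc] comp_root_eq[OF Suc] rU by auto
      have vn: "?v \<in> {1..n}" by (rule U_verts(1)[OF v(1)])
      then have "\<pi> ?v \<in> U" using * v edge_verts[OF edge[OF vn]] by (auto simp: U_def)
      from pwalk.step[OF Suc edge[OF vn] this] show ?case by simp
    qed
    then have "walk r True r" using orbit[OF U_verts(1)[OF rU(1)]] by metis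
    with rU show False by (simp add: odd_verts_def)
  qed
  then obtain f where f: "\<And>r. r \<in> Rs \<Longrightarrow> f r \<in> U \<and> rt (f r) = r \<and> \<pi> (f r) \<in> S" by metis
  have "inj_on (\<lambda>r. \<pi> (f r)) Rs"
  proof (rule inj_onI)
    fix r r' assume *: "r \<in> Rs" "r' \<in> Rs" "\<pi> (f r) = \<pi> (f r')"
    then have "f r = f r'" using f U_verts(1) inj_onD[OF inj] by blast
    then show "r = r'" using f * by metis
  qed
  then have "card Rs \<le> card S" using f finite_sets(1) by (intro card_inj_on_le) auto
  then show ?thesis using card_Z by linarith
qed

lemma ht_ge:
  fixes \<pi> :: "nat \<Rightarrow> nat"
  assumes "\<And>i. i \<in> {1..n} \<Longrightarrow> {i, \<pi> i} \<in> E" "inj_on \<pi> {1..n}"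
    and "\<And>i. i \<in> {1..n} \<Longrightarrow> \<exists>k. odd k \<and> (\<pi> ^^ k) i = i"
  shows "enat n \<le> ht (xy_poly_ring n) I"
  unfolding ht_xy_poly_ring
proof (rule Inf_greatest)
  fix x assume "x \<in> {prime_height (xy_poly_ring n) p | p. edge_prime n E e p}"
  then obtain q where q: "edge_prime n E e q" and x: "x = prime_height (xy_poly_ring n) q" by blast
  obtain c where "prime_chain A (card (edge_prime.Z n E q)) c q"
    using edge_prime.ex_chain[OF q] unfolding prime_chain_def by blast
  then have "enat (card (edge_prime.Z n E q)) \<le> x"
    unfolding x xy_poly_ring_eq by (rule prime_height_ge[OF subring_in_polys])
  moreover have "n \<le> card (edge_prime.Z n E q)" by (rule card_roots_le[OF q assms])
  ultimately show "enat n \<le> x" by (meson enat_ord_simps(1) order_trans)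
qed

end

section \<open>Cycles, transversals and colourings\<close>

definition con :: "'a set set \<Rightarrow> ('a \<times> 'a) set" where
  "con E = {(u, v). {u, v} \<in> E}\<^sup>*"

lemma con_refl: "(u, u) \<in> con E"
  by (simp add: con_def)

lemma con_edge: "{u, v} \<in> E \<Longrightarrow> (u, v) \<in> con E"
  by (auto simp: con_def)

lemma con_trans: "(u, v) \<in> con E \<Longrightarrow> (v, w) \<in> con E \<Longrightarrow> (u, w) \<in> con E"
  unfolding con_def by (rule rtrancl_trans)

lemma con_sym: "(u, v) \<in> con E \<Longrightarrow> (v, u) \<in> con E"
proof -
  have "sym {(u, v). {u, v} \<in> E}" by (auto simp: sym_def insert_commute)
  then have "sym (con E)" unfolding con_def by (rule sym_rtrancl)
  then show "(u, v) \<in> con E \<Longrightarrow> (v, u) \<in> con E" by (rule symD)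
qed

lemma con_induct [consumes 1, case_names base step]:
  assumes "(u, v) \<in> con E" "P u" "\<And>x y. (u, x) \<in> con E \<Longrightarrow> {x, y} \<in> E \<Longrightarrow> P x \<Longrightarrow> P y"
  shows "P v"
  using assms(1) unfolding con_def
  by (induction rule: rtrancl_induct) (use assms(2,3) in \<open>auto simp: con_def\<close>)

lemma con_subset:
  assumes "\<And>u v. {u, v} \<in> E \<Longrightarrow> (u, v) \<in> con F"
  shows "con E \<subseteq> con F"
proof
  fix x assume "x \<in> con E"
  then obtain u v where x: "x = (u, v)" "(u, v) \<in> con E" by (cases x) auto
  from x(2) have "(u, v) \<in> con F"
    by (induction rule: con_induct) (auto intro: con_refl con_trans assms)
  then show "x \<in> con F" using x by simp
qed

lemma con_mono: "E \<subseteq> F \<Longrightarrow> con E \<subseteq> con F"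
  by (rule con_subset) (auto intro: con_edge)

definition proper :: "'a set set \<Rightarrow> ('a \<Rightarrow> bool) \<Rightarrow> bool" where
  "proper E col \<longleftrightarrow> (\<forall>u v. {u, v} \<in> E \<longrightarrow> col u \<noteq> col v)"

text \<open>A shortest walk from \<open>u\<close> to \<open>v\<close> has distinct vertices and
  closes up with \<open>{u, v}\<close>. A proper colouring of \<open>E\<close> alternates along it
  and so reads off the parity of the cycle.\<close>

lemma cycle_through_edge:
  fixes u v :: 'a
  assumes uv: "(u, v) \<in> con E" "u \<noteq> v" "{u, v} \<notin> E"
  obtains C :: "'a graph" where "is_cycle C" "edges C \<subseteq> insert {u, v} E" "{u, v} \<in> edges C"
    "\<And>col. proper E col \<Longrightarrow> odd (card (verts C)) \<longleftrightarrow> col u = col v"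
proof -
  define r where "r = {(u, v). {u, v} \<in> E}"
  have "\<exists>l. (u, v) \<in> r ^^ l" using uv(1) by (auto simp: con_def r_def rtrancl_power)
  define l where "l = (LEAST l. (u, v) \<in> r ^^ l)"
  have l: "(u, v) \<in> r ^^ l" unfolding l_def by (rule LeastI_ex) fact
  have least: "l \<le> m" if "(u, v) \<in> r ^^ m" for m unfolding l_def using that by (rule Least_le)
  obtain p where p: "p 0 = u" "p l = v" "\<And>i. i < l \<Longrightarrow> (p i, p (Suc i)) \<in> r"
    using l unfolding relpow_fun_conv by blast
  have sub: "(p a, p b) \<in> r ^^ (b - a)" if "a \<le> b" "b \<le> l" for a b
    unfolding relpow_fun_conv using p(3) that by (intro exI[of _ "\<lambda>i. p (a + i)"]) auto
  have neq: "p a \<noteq> p b" if "a < b" "b \<le> l" for a b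
  proof
    assume eq: "p a = p b"
    have "(u, p a) \<in> r ^^ a" "(p a, v) \<in> r ^^ (l - b)"
      using sub[of 0 a] sub[of b l] that p eq by auto
    then have "(u, v) \<in> r ^^ (a + (l - b))" by (auto simp: relpow_add)
    then have "l \<le> a + (l - b)" by (rule least)
    then show False using that by linarith
  qed
  have inj: "inj_on p {..<Suc l}"
  proof (rule inj_onI)
    fix a b assume "a \<in> {..<Suc l}" "b \<in> {..<Suc l}" "p a = p b"
    then show "a = b" using neq[of a b] neq[of b a] by (cases a b rule: linorder_cases) auto
  qed
  have "l \<noteq> 0" using p(1,2) uv(2) by (cases l) auto
  moreover have "l \<noteq> 1" using p(3)[of 0] p(1,2) uv(3) by (auto simp: r_def)
  ultimately have l2: "2 \<le> l" by linarith
  define C where "C = (p ` {..<Suc l}, {{p i, p (Suc i mod Suc l)} | i. i < Suc l})"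
  have cyc: "is_cycle C"
    unfolding is_cycle_def using l2 inj by (intro exI[of _ "Suc l"] exI[of _ p]) (auto simp: C_def bij_betw_def)
  have edgesC: "edges C = {{p i, p (Suc i)} | i. i < l} \<union> {{p l, p 0}}"
  proof -
    have "{{p i, p (Suc i mod Suc l)} | i. i < Suc l} = (\<lambda>i. {p i, p (Suc i mod Suc l)}) ` {..<Suc l}" by auto
    also have "\<dots> = (\<lambda>i. {p i, p (Suc i)}) ` {..<l} \<union> {{p l, p 0}}"
      by (auto simp: lessThan_Suc image_iff)
    finally show ?thesis by (auto simp: C_def)
  qed
  have par: "col (p i) = (col u = even i)" if "proper E col" "i \<le> l" for col i
    using that(2)
  proof (induction i)
    case (Suc i)
    then have "{p i, p (Suc i)} \<in> E" using p(3)[of i] by (auto simp: r_def)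
    then have "col (p (Suc i)) \<noteq> col (p i)" using that(1) by (auto simp: proper_def)
    then show ?case using Suc by auto
  qed (simp add: p)
  show thesis
  proof (rule that[OF cyc])
    show "edges C \<subseteq> insert {u, v} E" using p by (auto simp: edgesC r_def insert_commute)
    show "{u, v} \<in> edges C" using p by (auto simp: edgesC insert_commute)
    fix col assume "proper E col"
    then have "col v = (col u = even l)" using par[of col l] p by simp
    moreover have "card (verts C) = Suc l" using card_image[OF inj] by (simp add: C_def)
    ultimately show "odd (card (verts C)) \<longleftrightarrow> col u = col v" by auto
  qed
qed

definition edge_set_on :: "'a set \<Rightarrow> 'a set set \<Rightarrow> bool" where
  "edge_set_on V E \<longleftrightarrow> finite V \<and> (\<forall>d\<in>E. \<exists>u v. d = {u, v} \<and> u \<in> V \<and> v \<in> V \<and> u \<noteq> v)"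

lemma finite_edge_set: "edge_set_on V E \<Longrightarrow> finite E"
  by (rule finite_subset[of _ "Pow V"]) (auto simp: edge_set_on_def)

text \<open>\<open>R\<close> has exactly one vertex in each component and \<open>rho\<close>
  projects onto it, so \<open>card R\<close> counts components in a form suited to adding edges one
  by one.\<close>

definition transversal :: "'a set \<Rightarrow> 'a set set \<Rightarrow> 'a set \<Rightarrow> ('a \<Rightarrow> 'a) \<Rightarrow> bool" where
  "transversal V E R rho \<longleftrightarrow> R \<subseteq> V \<and> (\<forall>v\<in>V. rho v \<in> R \<and> (v, rho v) \<in> con E) \<and>
     (\<forall>r\<in>R. rho r = r) \<and> (\<forall>u v. (u, v) \<in> con E \<longrightarrow> rho u = rho v)"

definition acyc :: "'a set set \<Rightarrow> bool" where
  "acyc E \<longleftrightarrow> (\<nexists>C. is_cycle C \<and> edges C \<subseteq> E)"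

text \<open>A new edge either merges two components or joins connected ends and closes a cycle;
  hence an inequality in general and equality for forests.\<close>

lemma ex_transversal:
  fixes E :: "'a set set"
  assumes "edge_set_on V E"
  shows "\<exists>R rho. transversal V E R rho \<and> card V \<le> card R + card E \<and> (acyc E \<longrightarrow> card V = card R + card E)"
proof -
  have fV: "finite V" using assms by (simp add: edge_set_on_def)
  show ?thesis
    using finite_edge_set[OF assms] assms
  proof (induction E rule: finite_induct)
    case empty
    have "con {} = (Id :: ('a \<times> 'a) set)" by (simp add: con_def)
    then show ?case by (intro exI[of _ V] exI[of _ "\<lambda>v. v"]) (auto simp: transversal_def)
  next
    case (insert d E)
    obtain u v where d: "d = {u, v}" "u \<in> V" "v \<in> V" "u \<noteq> v"
      using insert.prems by (auto simp: edge_set_on_def)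
    have "edge_set_on V E" using insert.prems by (auto simp: edge_set_on_def)
    then obtain R rho where T: "transversal V E R rho" and cards: "card V \<le> card R + card E"
      "acyc E \<Longrightarrow> card V = card R + card E" using insert.IH by blast
    note T' = T[unfolded transversal_def]
    have fR: "finite R" using T' fV by (auto intro: finite_subset)
    have mono: "con E \<subseteq> con (insert d E)" by (rule con_mono) auto
    have ex: "(u, v) \<in> con (insert d E)" using d by (auto intro: con_edge)
    have acE: "acyc E" if "acyc (insert d E)" using that by (auto simp: acyc_def)
    have cong: "h x = h y" if "(x, y) \<in> con (insert d E)" "h u = h v" "\<And>x y. (x, y) \<in> con E \<Longrightarrow> h x = h y"
      for h :: "'a \<Rightarrow> 'a" and x y
      using that(1)
    proof (induction rule: con_induct)
      case (step a b)
      then have "{a, b} = {u, v} \<or> {a, b} \<in> E" using d by auto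
      then have "h a = h b" using that(2) that(3)[OF con_edge] by (auto simp: doubleton_eq_iff)
      with step show ?case by simp
    qed simp
    show ?case
    proof (cases "rho u = rho v")
      case True
      have "\<not> acyc (insert d E)"
      proof -
        have "(u, v) \<in> con E" using T' d True con_trans con_sym by metis
        then obtain C :: "'a graph" where C: "is_cycle C" "edges C \<subseteq> insert {u, v} E" "{u, v} \<in> edges C"
          "\<And>col. proper E col \<Longrightarrow> odd (card (verts C)) \<longleftrightarrow> col u = col v"
          by (rule cycle_through_edge[OF _ d(4)]) (use d insert.hyps(2) in auto)
        then show ?thesis using d unfolding acyc_def by blast
      qed
      moreover have "transversal V (insert d E) R rho"
        using T' mono cong[of _ _ rho] True unfolding transversal_def by blast
      moreover have "card V \<le> card R + card (insert d E)" using cards(1) insert.hyps by simp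
      ultimately show ?thesis by blast
    next
      case False
      define rho' where "rho' x = (if rho x = rho v then rho u else rho x)" for x
      have in_R: "rho u \<in> R" "rho v \<in> R" using T' d by auto
      have "rho' x = rho' y" if "(x, y) \<in> con (insert d E)" for x y
      proof (rule cong[OF that])
        fix x y assume "(x, y) \<in> con E"
        then have "rho x = rho y" using T' by blast
        then show "rho' x = rho' y" by (simp add: rho'_def)
      qed (simp add: rho'_def)
      moreover have "rho' x \<in> R - {rho v} \<and> (x, rho' x) \<in> con (insert d E)" if "x \<in> V" for x
      proof -
        have x: "rho x \<in> R" "(x, rho x) \<in> con (insert d E)" using T' that mono by auto
        have "(u, rho u) \<in> con (insert d E)" "(v, rho v) \<in> con (insert d E)" using T' d mono by auto
        then have "(rho v, rho u) \<in> con (insert d E)" using ex con_trans con_sym by metis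
        then show ?thesis using x False in_R con_trans by (auto simp: rho'_def)
      qed
      moreover have "rho' r = r" if "r \<in> R - {rho v}" for r
        using T' that by (auto simp: rho'_def)
      ultimately have "transversal V (insert d E) (R - {rho v}) rho'"
        using T' unfolding transversal_def by blast
      moreover have "card (R - {rho v}) + card (insert d E) = card R + card E"
        using in_R fR insert.hyps card_Suc_Diff1[OF fR in_R(2)] by simp
      ultimately show ?thesis using cards acE by (intro exI conjI impI) (assumption | simp)+
    qed
  qed
qed

lemma ex_proper_coloring:
  fixes E :: "'a set set"
  assumes "edge_set_on V E" "\<And>C. is_cycle C \<Longrightarrow> edges C \<subseteq> E \<Longrightarrow> even (card (verts C))"
  shows "\<exists>col. proper E col"
  using finite_edge_set[OF assms(1)] assms
proof (induction E rule: finite_induct)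
  case empty
  show ?case by (simp add: proper_def)
next
  case (insert d E)
  obtain u v where d: "d = {u, v}" "u \<noteq> v"
    using insert.prems(1) by (auto simp: edge_set_on_def)
  have "edge_set_on V E" using insert.prems by (auto simp: edge_set_on_def)
  then obtain col where col: "proper E col" using insert.IH insert.prems(2) by blast
  show ?case
  proof (cases "(u, v) \<in> con E")
    case True
    then obtain C :: "'a graph" where C: "is_cycle C" "edges C \<subseteq> insert {u, v} E" "{u, v} \<in> edges C"
      "\<And>col. proper E col \<Longrightarrow> odd (card (verts C)) \<longleftrightarrow> col u = col v"
      by (rule cycle_through_edge[OF _ d(2)]) (use d insert.hyps(2) in auto)
    then have "col u \<noteq> col v" using insert.prems(2)[of C] d col by auto
    then have "proper (insert d E) col"
      using col d by (auto simp: proper_def doubleton_eq_iff)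
    then show ?thesis by blast
  next
    case False
    \<comment> \<open>The ends lie in different components, so the colours on the component of
      \<open>v\<close> may be flipped when both ends have the same colour.\<close>
    define col' where "col' x = (if (v, x) \<in> con E then col x \<noteq> (col u = col v) else col x)" for x
    have "col' a \<noteq> col' b" if "{a, b} \<in> insert d E" for a b
    proof (cases "{a, b} \<in> E")
      case True
      then have "(v, a) \<in> con E \<longleftrightarrow> (v, b) \<in> con E" using con_trans con_edge con_sym by metis
      then show ?thesis using col True by (auto simp: col'_def proper_def)
    next
      case False
      then have "{a, b} = {u, v}" using that d by auto
      moreover have "col' u \<noteq> col' v" using \<open>(u, v) \<notin> con E\<close> con_sym[of v u E] con_refl[of v E] by (auto simp: col'_def)
      ultimately show ?thesis by (auto simp: doubleton_eq_iff)
    qed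
    then show ?thesis by (auto simp: proper_def)
  qed
qed

lemma bipartite_of_proper:
  assumes "simple_graph G" "proper (edges G) col"
  shows "bipartite G"
  unfolding bipartite_def
proof (intro exI conjI ballI)
  show "{v \<in> verts G. col v} \<union> {v \<in> verts G. \<not> col v} = verts G"
    "{v \<in> verts G. col v} \<inter> {v \<in> verts G. \<not> col v} = {}" by auto
  fix d assume d: "d \<in> edges G"
  then obtain a b where ab: "d = {a, b}" "d \<subseteq> verts G"
    using assms(1) by (auto simp: simple_graph_def card_2_iff)
  then have "col a \<noteq> col b" using assms(2) d by (auto simp: proper_def)
  then show "\<exists>u\<in>{v \<in> verts G. col v}. \<exists>v\<in>{v \<in> verts G. \<not> col v}. d = {u, v}"
    using ab by (cases "col a") (auto simp: insert_commute)
qed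

section \<open>The structure of a cycle\<close>

lemma cycle_from:
  assumes "is_cycle C" "v \<in> verts C"
  obtains k h where "k \<ge> 3" "bij_betw h {..<k} (verts C)" "h 0 = v"
    "edges C = {{h a, h (Suc a mod k)} | a. a < k}"
proof -
  obtain k f where k: "k \<ge> 3" and f: "bij_betw f {..<k} (verts C)" and E: "edges C = {{f i, f (Suc i mod k)} | i. i < k}"
    using assms(1) by (auto simp: is_cycle_def)
  obtain i where i: "i < k" "f i = v" using f assms(2)
    by (metis (no_types) bij_betw_imp_surj_on imageE lessThan_iff)
  define h where "h a = f ((i + a) mod k)" for a
  have wrap: "(i + (j + (k - i)) mod k) mod k = j" if "j < k" for j
  proof -
    have "(i + (j + (k - i)) mod k) mod k = (j + k) mod k" using i by (simp add: mod_add_right_eq)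
    then show ?thesis using that by simp
  qed
  have "bij_betw (\<lambda>a. (i + a) mod k) {..<k} {..<k}"
  proof (rule bij_betwI[where g = "\<lambda>j. (j + (k - i)) mod k"])
    fix a assume a: "a \<in> {..<k}"
    have "((i + a) mod k + (k - i)) mod k = ((i + a) + (k - i)) mod k" by (rule mod_add_left_eq)
    also have "(i + a) + (k - i) = a + k" using i by simp
    finally show "((i + a) mod k + (k - i)) mod k = a" using a by simp
  qed (use i wrap k in auto)
  then have "bij_betw h {..<k} (verts C)"
    using bij_betw_trans[OF _ f] unfolding h_def comp_def by blast
  moreover have "h 0 = v" using i by (simp add: h_def)
  moreover have "edges C = {{h a, h (Suc a mod k)} | a. a < k}"
  proof -
    have step: "{h a, h (Suc a mod k)} = {f ((i + a) mod k), f (Suc ((i + a) mod k) mod k)}" for a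
      by (simp add: h_def mod_simps)
    show ?thesis
    proof (intro subset_antisym subsetI)
      fix d assume "d \<in> edges C"
      then obtain j where j: "j < k" "d = {f j, f (Suc j mod k)}" unfolding E by blast
      then have "d = {h ((j + (k - i)) mod k), h (Suc ((j + (k - i)) mod k) mod k)}"
        unfolding step by (simp add: wrap)
      then show "d \<in> {{h a, h (Suc a mod k)} | a. a < k}" using k by auto
    next
      fix d assume "d \<in> {{h a, h (Suc a mod k)} | a. a < k}"
      then obtain a where "d = {f ((i + a) mod k), f (Suc ((i + a) mod k) mod k)}" unfolding step by blast
      then show "d \<in> edges C" unfolding E using k by auto
    qed
  qed
  ultimately show ?thesis using that k by blast
qed

text \<open>Starting the enumeration at \<open>v\<close> and splitting off the closing edge turns
  the rest into a path, free of \<open>mod\<close>.\<close>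

lemma cycle_from_path:
  assumes "is_cycle C" "v \<in> verts C"
  obtains l h where "l \<ge> 2" "inj_on h {..l}" "verts C = h ` {..l}" "h 0 = v"
    "edges C = (\<lambda>a. {h a, h (Suc a)}) ` {..<l} \<union> {{h l, h 0}}"
proof -
  obtain k h where k: "k \<ge> 3" and h: "bij_betw h {..<k} (verts C)" "h 0 = v"
    and E: "edges C = {{h a, h (Suc a mod k)} | a. a < k}" using cycle_from[OF assms] .
  define l where "l = k - 1"
  have l: "k = Suc l" "l \<ge> 2" using k by (auto simp: l_def)
  have "edges C = (\<lambda>a. {h a, h (Suc a mod Suc l)}) ` {..<Suc l}" unfolding E l(1) by auto
  also have "\<dots> = (\<lambda>a. {h a, h (Suc a)}) ` {..<l} \<union> {{h l, h 0}}"
    by (auto simp: lessThan_Suc image_iff)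
  finally have "edges C = (\<lambda>a. {h a, h (Suc a)}) ` {..<l} \<union> {{h l, h 0}}" .
  then show ?thesis using that[of l h] l h by (auto simp: bij_betw_def lessThan_Suc_atMost)
qed

lemma cycle_edges_at:
  assumes C: "is_cycle C" "v \<in> verts C"
  shows "finite {d \<in> edges C. v \<in> d}" "card {d \<in> edges C. v \<in> d} = 2"
proof -
  obtain l h where h: "l \<ge> 2" "inj_on h {..l}" "verts C = h ` {..l}" "h 0 = v"
    "edges C = (\<lambda>a. {h a, h (Suc a)}) ` {..<l} \<union> {{h l, h 0}}" using cycle_from_path[OF C] .
  have eq: "h a = h b \<longleftrightarrow> a = b" if "a \<le> l" "b \<le> l" for a b
    using inj_on_eq_iff[OF h(2)] that by auto
  have "{d \<in> edges C. v \<in> d} = {{h 0, h 1}, {h l, h 0}}"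
  proof (intro subset_antisym subsetI)
    fix d assume d: "d \<in> {d \<in> edges C. v \<in> d}"
    then consider a where "a < l" "d = {h a, h (Suc a)}" | "d = {h l, h 0}" unfolding h(5) by blast
    then show "d \<in> {{h 0, h 1}, {h l, h 0}}"
    proof cases
      case 1
      then have "h 0 = h a \<or> h 0 = h (Suc a)" using d h(4) by auto
      then have "a = 0" using eq[of 0 a] eq[of 0 "Suc a"] 1(1) by auto
      then show ?thesis using 1 by simp
    qed simp
  next
    fix d assume "d \<in> {{h 0, h 1}, {h l, h 0}}"
    moreover have "{h 0, h 1} \<in> edges C"
      unfolding h(5) by (intro UnI1 image_eqI[of _ _ 0]) (use h(1) in simp_all)
    moreover have "{h l, h 0} \<in> edges C" unfolding h(5) by simp
    ultimately show "d \<in> {d \<in> edges C. v \<in> d}" using h(4) by (elim insertE emptyE) simp_all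
  qed
  moreover have "{h 0, h 1} \<noteq> {h l, h 0}"
    using eq[of 1 l] eq[of 0 l] eq[of 0 1] h(1) by (auto simp: doubleton_eq_iff)
  ultimately show "finite {d \<in> edges C. v \<in> d}" "card {d \<in> edges C. v \<in> d} = 2" by auto
qed

lemma cycle_edge_verts:
  assumes C: "is_cycle C"
  shows "verts C \<noteq> {}" "finite (verts C)" "d \<in> edges C \<Longrightarrow> d \<subseteq> verts C \<and> card d = 2" "\<Union> (edges C) = verts C"
proof -
  obtain k f where k: "k \<ge> 3" and f: "bij_betw f {..<k} (verts C)" and E: "edges C = {{f i, f (Suc i mod k)} | i. i < k}"
    using assms(1) by (auto simp: is_cycle_def)
  have "f 0 \<in> verts C" using k f by (auto simp: bij_betw_def)
  then show "verts C \<noteq> {}" by blast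
  show "finite (verts C)" using bij_betw_finite[OF f] by simp
  show sub: "d \<subseteq> verts C \<and> card d = 2" if d: "d \<in> edges C" for d
  proof -
    obtain i where i: "i < k" "d = {f i, f (Suc i mod k)}" using d unfolding E by blast
    have "Suc i mod k \<noteq> i" using i k by (cases "Suc i = k") auto
    moreover have "Suc i mod k < k" using k by simp
    ultimately have "f i \<noteq> f (Suc i mod k)" using f i by (auto simp: bij_betw_def inj_on_def)
    then show ?thesis using f i k by (auto simp: bij_betw_def)
  qed
  show "\<Union> (edges C) = verts C"
  proof
    show "\<Union> (edges C) \<subseteq> verts C" using sub by blast
    show "verts C \<subseteq> \<Union> (edges C)"
    proof
      fix v assume "v \<in> verts C"
      from cycle_edges_at(2)[OF C this] have "{d \<in> edges C. v \<in> d} \<noteq> {}"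
        by (metis card.empty zero_neq_numeral)
      then show "v \<in> \<Union> (edges C)" by blast
    qed
  qed
qed

lemma path_con:
  assumes "\<And>a. i \<le> a \<Longrightarrow> a < j \<Longrightarrow> {h a, h (Suc a)} \<in> E" "i \<le> j"
  shows "(h i, h j) \<in> con E"
  using assms(2,1)
proof (induction j rule: dec_induct)
  case (step m)
  then have "(h i, h m) \<in> con E" "{h m, h (Suc m)} \<in> E" by auto
  then show ?case by (blast intro: con_trans con_edge)
qed (rule con_refl)

lemma cycle_minus_edge:
  assumes C: "is_cycle C" and d: "{u, v} \<in> edges C"
  shows "(u, v) \<in> con (edges C - {{u, v}})"
proof -
  have "u \<in> verts C" using cycle_edge_verts(4)[OF C] d by blast
  then obtain l h where h: "l \<ge> 2" "inj_on h {..l}" "verts C = h ` {..l}" "h 0 = u"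
    "edges C = (\<lambda>a. {h a, h (Suc a)}) ` {..<l} \<union> {{h l, h 0}}" by (rule cycle_from_path[OF C])
  have eq: "h a = h b \<longleftrightarrow> a = b" if "a \<le> l" "b \<le> l" for a b
    using inj_on_eq_iff[OF h(2)] that by auto
  have "v = h 1 \<or> v = h l"
    using d h(1) eq[of 0] unfolding h(5) h(4)[symmetric]
    by (auto simp: doubleton_eq_iff)
  then show ?thesis
  proof
    assume v: "v = h l"
    have "{h a, h (Suc a)} \<in> edges C - {{u, v}}" if "a < l" for a
      using that h(1) eq[of a l] eq[of a 0] eq[of "Suc a" l] eq[of "Suc a" 0] unfolding h(5) v h(4)[symmetric]
      by (auto simp: doubleton_eq_iff)
    then have "(h 0, h l) \<in> con (edges C - {{u, v}})" by (intro path_con) auto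
    then show ?thesis using h(4) v by simp
  next
    assume v: "v = h 1"
    have "{h a, h (Suc a)} \<in> edges C - {{u, v}}" if "1 \<le> a" "a < l" for a
      using that h(1) eq[of a 1] eq[of a 0] eq[of "Suc a" 1] eq[of "Suc a" 0] unfolding h(5) v h(4)[symmetric]
      by (auto simp: doubleton_eq_iff)
    then have "(h 1, h l) \<in> con (edges C - {{u, v}})" using h(1) by (intro path_con) auto
    moreover have "{h l, h 0} \<in> edges C - {{u, v}}"
      using h(1) eq[of l 1] eq[of l 0] unfolding h(5) v h(4)[symmetric] by (auto simp: doubleton_eq_iff)
    ultimately have "(h 1, h 0) \<in> con (edges C - {{u, v}})" by (blast intro: con_trans con_edge)
    then show ?thesis using h(4) v con_sym by metis
  qed
qed

lemma cycle_minus_vertex: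
  assumes C: "is_cycle C" and w: "w \<in> verts C" and uv: "u \<in> verts C - {w}" "v \<in> verts C - {w}"
  shows "(u, v) \<in> con {d \<in> edges C. w \<notin> d}"
proof -
  obtain l h where h: "l \<ge> 2" "inj_on h {..l}" "verts C = h ` {..l}" "h 0 = w"
    "edges C = (\<lambda>a. {h a, h (Suc a)}) ` {..<l} \<union> {{h l, h 0}}" using cycle_from_path[OF C w] .
  have eq: "h a = h b \<longleftrightarrow> a = b" if "a \<le> l" "b \<le> l" for a b
    using inj_on_eq_iff[OF h(2)] that by auto
  have reach: "(h 1, x) \<in> con {d \<in> edges C. w \<notin> d}" if x: "x \<in> verts C - {w}" for x
  proof -
    obtain j where j: "j \<le> l" "x = h j" "j \<noteq> 0" using x h by auto
    have "{h a, h (Suc a)} \<in> {d \<in> edges C. w \<notin> d}" if "1 \<le> a" "a < j" for a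
      using that j eq[of a 0] eq[of "Suc a" 0] unfolding h(5) h(4)[symmetric] by auto
    then show ?thesis using j by (auto intro!: path_con)
  qed
  show ?thesis by (rule con_trans[OF con_sym[OF reach[OF uv(1)]] reach[OF uv(2)]])
qed

lemma cycle_con:
  assumes C: "is_cycle C" and uv: "u \<in> verts C" "v \<in> verts C"
  shows "(u, v) \<in> con (edges C)"
proof -
  obtain l h where h: "l \<ge> 2" "inj_on h {..l}" "verts C = h ` {..l}" "h 0 = u"
    "edges C = (\<lambda>a. {h a, h (Suc a)}) ` {..<l} \<union> {{h l, h 0}}" using cycle_from_path[OF C uv(1)] .
  obtain j where j: "j \<le> l" "v = h j" using uv(2) h by auto
  have "(h 0, h j) \<in> con (edges C)" using j unfolding h(5) by (intro path_con) auto
  then show ?thesis using h(4) j by simp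
qed

text \<open>Both cycles have two edges at each of their vertices, so at the vertices of
  \<open>C\<close> their edges coincide; since \<open>B\<close> is connected, nothing is left
  over.\<close>

lemma cycle_subset_eq:
  assumes C: "is_cycle C" and B: "is_cycle B" and sub: "edges C \<subseteq> edges B"
  shows "C = B"
proof -
  have at: "{d \<in> edges C. v \<in> d} = {d \<in> edges B. v \<in> d}" if "v \<in> verts C" for v
  proof (rule card_subset_eq)
    have "v \<in> verts B" using that cycle_edge_verts(4)[OF C] cycle_edge_verts(4)[OF B] sub by blast
    then show "finite {d \<in> edges B. v \<in> d}" "card {d \<in> edges C. v \<in> d} = card {d \<in> edges B. v \<in> d}"
      using cycle_edges_at[OF C that] cycle_edges_at[OF B] by auto
  qed (use sub in auto)
  obtain x where x: "x \<in> verts C" using cycle_edge_verts(1)[OF C] by blast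
  then have xB: "x \<in> verts B" using cycle_edge_verts(4)[OF C] cycle_edge_verts(4)[OF B] sub by blast
  have "verts B \<subseteq> verts C"
  proof
    fix y assume "y \<in> verts B"
    from cycle_con[OF B xB this] show "y \<in> verts C"
    proof (induction rule: con_induct)
      case (step a b)
      then have "{a, b} \<in> edges C" using at[of a] by blast
      then show ?case using cycle_edge_verts(4)[OF C] by blast
    qed (rule x)
  qed
  moreover have "verts C \<subseteq> verts B" using cycle_edge_verts(4)[OF C] cycle_edge_verts(4)[OF B] sub by blast
  moreover have "edges B \<subseteq> edges C"
  proof
    fix d assume d: "d \<in> edges B"
    then have "d \<subseteq> verts B" "d \<noteq> {}" using cycle_edge_verts(3)[OF B d] by auto
    then obtain v where "v \<in> d" "v \<in> verts C" using \<open>verts B \<subseteq> verts C\<close> by blast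
    then show "d \<in> edges C" using at[of v] d by blast
  qed
  ultimately show ?thesis using sub by (simp add: prod_eq_iff)
qed

text \<open>Rotation by one step; going once around returns to the start, so an odd cycle supplies
  the odd exponent that \<open>ht_ge\<close> asks for.\<close>

lemma cycle_permutation:
  assumes C: "is_cycle C"
  shows "\<exists>\<pi>. bij_betw \<pi> (verts C) (verts C) \<and> (\<forall>v\<in>verts C. {v, \<pi> v} \<in> edges C \<and> (\<pi> ^^ card (verts C)) v = v)"
proof -
  obtain k f where k: "k \<ge> 3" and f: "bij_betw f {..<k} (verts C)" and E: "edges C = {{f i, f (Suc i mod k)} | i. i < k}"
    using assms(1) by (auto simp: is_cycle_def)
  have card: "card (verts C) = k" using bij_betw_same_card[OF f] by simp
  define g where "g = the_inv_into {..<k} f"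
  have g: "g v < k" "f (g v) = v" if "v \<in> verts C" for v
    using the_inv_into_into[OF bij_betw_imp_inj_on[OF f], of v "{..<k}"] f_the_inv_into_f_bij_betw[OF f, of v] that f
    by (auto simp: g_def bij_betw_def)
  have gf: "g (f i) = i" if "i < k" for i
    unfolding g_def using the_inv_into_f_f[OF bij_betw_imp_inj_on[OF f]] that by auto
  define \<pi> where "\<pi> v = f (Suc (g v) mod k)" for v
  have in_C: "f i \<in> verts C" if "i < k" for i using f that by (auto simp: bij_betw_def)
  have pow: "(\<pi> ^^ m) (f i) = f ((i + m) mod k)" if "i < k" for i m
  proof (induction m)
    case (Suc m)
    have "(i + m) mod k < k" using k by simp
    then show ?case using Suc k by (simp add: \<pi>_def gf mod_Suc_eq)
  qed (use that in simp)
  have fix_pow: "(\<pi> ^^ k) v = v" if "v \<in> verts C" for v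
    using pow[of "g v" k] g[OF that] by simp
  have into: "\<pi> v \<in> verts C" if "v \<in> verts C" for v using in_C k by (simp add: \<pi>_def)
  have inj: "inj_on \<pi> (verts C)"
  proof (rule inj_onI)
    fix a b assume ab: "a \<in> verts C" "b \<in> verts C" "\<pi> a = \<pi> b"
    have "(\<pi> ^^ k) x = (\<pi> ^^ (k - 1)) (\<pi> x)" for x
      using k by (metis Suc_diff_1 funpow_simps_right(2) comp_apply gr0I not_numeral_le_zero)
    then show "a = b" using fix_pow[OF ab(1)] fix_pow[OF ab(2)] ab(3) by metis
  qed
  then have "bij_betw \<pi> (verts C) (verts C)"
    using into cycle_edge_verts(2)[OF C] by (simp add: bij_betw_def endo_inj_surj image_subsetI)
  moreover have "{v, \<pi> v} \<in> edges C" if "v \<in> verts C" for v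
    unfolding E using g[OF that] by (auto simp: \<pi>_def intro!: exI[of _ "g v"])
  ultimately show ?thesis using fix_pow card by blast
qed

section \<open>Bicyclic cactus graphs\<close>

lemma joined_con: "joined G = con (edges G) \<inter> verts G \<times> verts G"
  by (simp add: joined_def con_def)

lemma components_connected:
  assumes "\<And>u v. u \<in> verts G \<Longrightarrow> v \<in> verts G \<Longrightarrow> (u, v) \<in> joined G"
  shows "components G \<subseteq> {verts G}"
proof -
  have "joined G `` {x} = verts G" if "x \<in> verts G" for x
    using assms that by (auto simp: joined_def)
  then show ?thesis by (auto simp: components_def quotient_def)
qed

section \<open>Cycles as blocks of a cactus\<close>

lemma nonseparable_cycle:
  assumes C: "is_cycle C"
  shows "nonseparable C"
  unfolding nonseparable_def
proof
  have joined: "(u, v) \<in> joined C" if "u \<in> verts C" "v \<in> verts C" for u v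
    using cycle_con[OF C that] that by (simp add: joined_con)
  then show "connected_graph C"
    using cycle_edge_verts(1)[OF C] by (simp add: connected_graph_def)
  obtain x where x: "x \<in> verts C" using cycle_edge_verts(1)[OF C] by blast
  have "joined C `` {x} \<in> components C" using x by (auto simp: components_def quotient_def)
  moreover have "components C \<subseteq> {verts C}" using components_connected[of C] joined by blast
  ultimately have "components C = {verts C}" by (metis subset_singletonD empty_iff)
  then have 1: "card (components C) = 1" by simp
  show "\<nexists>w. cut_vertex C w"
  proof
    assume "\<exists>w. cut_vertex C w"
    then obtain w where w: "w \<in> verts C" "card (components (delete_vertex C w)) > 1"
      using 1 by (auto simp: cut_vertex_def)
    have "components (delete_vertex C w) \<subseteq> {verts (delete_vertex C w)}"
      using cycle_minus_vertex[OF C w(1)]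
      by (intro components_connected) (simp add: joined_con delete_vertex_def)
    then have "card (components (delete_vertex C w)) \<le> 1"
      using card_mono[of "{verts (delete_vertex C w)}"] by simp
    with w(2) show False by simp
  qed
qed

lemma cycle_subgraph:
  assumes "simple_graph G" "is_cycle C" "edges C \<subseteq> edges G"
  shows "subgraph C G"
proof -
  have "d \<subseteq> verts G" if "d \<in> edges C" for d
    using assms(1,3) that unfolding simple_graph_def by blast
  then have "verts C \<subseteq> verts G" using cycle_edge_verts(4)[OF assms(2)] by blast
  moreover have "simple_graph C"
    unfolding simple_graph_def using cycle_edge_verts(2,3)[OF assms(2)] by blast
  ultimately show ?thesis using assms(3) by (simp add: subgraph_def)
qed

lemma subgraph_trans: "subgraph A B \<Longrightarrow> subgraph B C \<Longrightarrow> subgraph A C"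
  by (auto simp: subgraph_def)

lemma nonseparable_in_block:
  assumes G: "simple_graph G" and C: "subgraph C G" "nonseparable C"
  obtains B where "is_block G B" "subgraph C B"
proof -
  define size where "size H = card (verts H) + card (edges H)" for H :: "'a graph"
  define Sub where "Sub = {H. subgraph H G \<and> nonseparable H \<and> subgraph C H}"
  have fin: "finite (verts G)" "finite (edges G)"
    using G by (auto simp: simple_graph_def intro: finite_subset[of _ "Pow (verts G)"])
  have "Sub \<subseteq> Pow (verts G) \<times> Pow (edges G)" by (auto simp: Sub_def subgraph_def)
  then have "finite Sub" using fin by (auto intro: finite_subset)
  moreover have "C \<in> Sub" using C by (auto simp: Sub_def subgraph_def)
  ultimately obtain B where B: "B \<in> Sub" "\<And>H. H \<in> Sub \<Longrightarrow> size H \<le> size B"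
    using Max_in[of "size ` Sub"] Max_ge[of "size ` Sub"] by fastforce
  have "is_block G B"
    unfolding is_block_def
  proof (intro conjI allI impI)
    fix H assume H: "subgraph H G \<and> nonseparable H \<and> subgraph B H"
    then have "H \<in> Sub" using B(1) subgraph_trans[of C B H] by (auto simp: Sub_def)
    then have le: "size H \<le> size B" by (rule B(2))
    have sub: "verts B \<subseteq> verts H" "edges B \<subseteq> edges H" using H by (auto simp: subgraph_def)
    have fH: "finite (verts H)" "finite (edges H)"
      using H fin by (auto simp: subgraph_def intro: finite_subset)
    have "card (verts B) \<le> card (verts H)" "card (edges B) \<le> card (edges H)"
      using sub fH by (auto intro: card_mono)
    then have "card (verts B) = card (verts H)" "card (edges B) = card (edges H)"
      using le by (auto simp: size_def)
    then show "H = B" using sub fH card_subset_eq by (metis prod_eq_iff)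
  qed (use B(1) in \<open>auto simp: Sub_def\<close>)
  then show ?thesis using that B(1) by (auto simp: Sub_def)
qed

text \<open>Excludes that a block containing a cycle is a single edge.\<close>

lemma card_cycle_edges: "is_cycle C \<Longrightarrow> v \<in> verts C \<Longrightarrow> \<not> edges C \<subseteq> {d}"
  using cycle_edges_at(2)[of C v] card_mono[of "{d}" "{d \<in> edges C. v \<in> d}"] by fastforce

text \<open>The block around the cycle is a cycle or an edge; an edge is too small, and nested
  cycles coincide. So counting cyclic blocks is counting cycles.\<close>

lemma cactus_cycle_is_block:
  assumes G: "simple_graph G" and cactus: "cactus G" and C: "is_cycle C" "edges C \<subseteq> edges G"
  shows "is_block G C"
proof -
  obtain B where B: "is_block G B" "subgraph C B"
    using nonseparable_in_block[OF G cycle_subgraph[OF G C] nonseparable_cycle[OF C(1)]] .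
  have sub: "edges C \<subseteq> edges B" using B(2) by (simp add: subgraph_def)
  obtain v where v: "v \<in> verts C" using cycle_edge_verts(1)[OF C(1)] by blast
  have "is_cycle B \<or> is_edge_graph B" using cactus B(1) unfolding cactus_def by blast
  then have "is_cycle B"
    using sub card_cycle_edges[OF C(1) v] by (auto simp: is_edge_graph_def)
  then have "C = B" by (rule cycle_subset_eq[OF C(1) _ sub])
  with B(1) show ?thesis by simp
qed

lemma bicyclic_cactus_cycles:
  assumes G: "simple_graph G" and bi: "bicyclic_cactus G"
  obtains C D where "C \<noteq> D" "is_cycle C" "is_cycle D" "edges C \<subseteq> edges G" "edges D \<subseteq> edges G"
    "\<And>H. is_cycle H \<Longrightarrow> edges H \<subseteq> edges G \<Longrightarrow> H = C \<or> H = D"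
proof -
  have "card {B. is_block G B \<and> is_cycle B} = 2" and cactus: "cactus G"
    using bi by (auto simp: bicyclic_cactus_def)
  then obtain C D where CD: "{B. is_block G B \<and> is_cycle B} = {C, D}" "C \<noteq> D"
    by (auto simp: card_2_iff)
  have sub: "edges B \<subseteq> edges G" if "is_block G B" for B
    using that by (simp add: is_block_def subgraph_def)
  have blocks: "is_block G C" "is_cycle C" "is_block G D" "is_cycle D" using CD(1) by blast+
  show ?thesis
  proof (rule that[OF CD(2) blocks(2,4) sub[OF blocks(1)] sub[OF blocks(3)]])
    fix H assume "is_cycle H" "edges H \<subseteq> edges G"
    then have "H \<in> {B. is_block G B \<and> is_cycle B}" using cactus_cycle_is_block[OF G cactus] by blast
    then show "H = C \<or> H = D" unfolding CD(1) by blast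
  qed
qed

lemma con_remove_cycle_edge:
  assumes C: "is_cycle C" "edges C \<subseteq> E" and d: "d \<in> edges C"
  shows "con (E - {d}) = con E"
proof
  show "con E \<subseteq> con (E - {d})"
  proof (rule con_subset)
    fix u v assume uv: "{u, v} \<in> E"
    show "(u, v) \<in> con (E - {d})"
    proof (cases "{u, v} = d")
      case True
      then have "(u, v) \<in> con (edges C - {{u, v}})" using cycle_minus_edge[OF C(1)] d by blast
      moreover have "edges C - {{u, v}} \<subseteq> E - {d}" using C(2) True by blast
      ultimately show ?thesis using con_mono by blast
    qed (use uv in \<open>auto intro: con_edge\<close>)
  qed
qed (rule con_mono, blast)

lemma transversal_connected:
  assumes "transversal V E R rho" "V \<noteq> {}" "\<And>u v. u \<in> V \<Longrightarrow> v \<in> V \<Longrightarrow> (u, v) \<in> con E"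
  shows "card R = 1"
proof -
  note T = assms(1)[unfolded transversal_def]
  obtain v where v: "v \<in> V" using assms(2) by blast
  have "r = rho v" if "r \<in> R" for r
  proof -
    have "r \<in> V" using T that by blast
    then have "rho r = rho v" using T assms(3) v by blast
    then show ?thesis using T that by auto
  qed
  then have "R = {rho v}" using T v by blast
  then show ?thesis by simp
qed

section \<open>Counting in a connected graph with exactly two cycles\<close>

locale two_cycles =
  fixes G :: "'a graph" and C D :: "'a graph"
  assumes G: "simple_graph G" "connected_graph G"
    and CD: "C \<noteq> D" "is_cycle C" "is_cycle D" "edges C \<subseteq> edges G" "edges D \<subseteq> edges G"
    and only: "\<And>H. is_cycle H \<Longrightarrow> edges H \<subseteq> edges G \<Longrightarrow> H = C \<or> H = D"
begin

lemma edge_set_G: "edge_set_on (verts G) (edges G)"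
  using G(1) by (fastforce simp: simple_graph_def edge_set_on_def card_2_iff)

lemma finite_G: "finite (verts G)" "finite (edges G)"
  using edge_set_G finite_edge_set by (auto simp: edge_set_on_def)

lemma con_G: "u \<in> verts G \<Longrightarrow> v \<in> verts G \<Longrightarrow> (u, v) \<in> con (edges G)"
  using G(2) by (simp add: connected_graph_def joined_con)

lemma verts_CD: "verts C \<subseteq> verts G" "verts D \<subseteq> verts G"
  using cycle_subgraph[OF G(1)] CD by (auto simp: subgraph_def)

lemma tree_count:
  assumes "E \<subseteq> edges G" "con E = con (edges G)" "acyc E"
  shows "card (verts G) = 1 + card E"
proof -
  have "edge_set_on (verts G) E" using edge_set_G assms(1) by (auto simp: edge_set_on_def)
  then obtain R rho where R: "transversal (verts G) E R rho" "card (verts G) = card R + card E"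
    using ex_transversal assms(3) by blast
  have "card R = 1"
    using G(2) con_G assms(2) by (intro transversal_connected[OF R(1)]) (auto simp: connected_graph_def)
  with R(2) show ?thesis by simp
qed

text \<open>Deleting an edge of \<open>C\<close> outside \<open>D\<close>, and then one of
  \<open>D\<close>, leaves a spanning tree: each lies on an intact cycle when it is deleted, and no
  cycle survives.\<close>

lemma card_edges: "card (edges G) = card (verts G) + 1"
proof -
  have "\<not> edges C \<subseteq> edges D" using cycle_subset_eq CD by blast
  then obtain c where c: "c \<in> edges C" "c \<notin> edges D" by blast
  obtain d where d: "d \<in> edges D" using cycle_edge_verts(1,4)[OF CD(3)] by blast
  define E where "E = edges G - {c} - {d}"
  have "con E = con (edges G - {c})"
    unfolding E_def using c d CD by (intro con_remove_cycle_edge[of D]) auto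
  also have "\<dots> = con (edges G)" using c CD by (intro con_remove_cycle_edge[of C])
  finally have "con E = con (edges G)" .
  moreover have "acyc E"
    unfolding acyc_def
  proof
    assume "\<exists>H. is_cycle H \<and> edges H \<subseteq> E"
    then obtain H where "is_cycle H" "edges H \<subseteq> E" by blast
    then show False using only[of H] c d by (auto simp: E_def)
  qed
  ultimately have "card (verts G) = 1 + card E" by (intro tree_count) (auto simp: E_def)
  moreover have "card E + 2 = card (edges G)"
  proof -
    have "c \<in> edges G" "d \<in> edges G - {c}" using c d CD by auto
    then have "Suc (card E) = card (edges G - {c})" "Suc (card (edges G - {c})) = card (edges G)"
      unfolding E_def using finite_G(2) by (auto intro!: card_Suc_Diff1 simp del: card_Diff_insert)
    then show ?thesis by simp
  qed
  ultimately show ?thesis by simp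
qed

text \<open>Deleting a common edge would break both cycles at once and already leave a spanning
  tree, against \<open>card_edges\<close>.\<close>

lemma edges_disjoint: "edges C \<inter> edges D = {}"
proof (rule ccontr)
  assume "edges C \<inter> edges D \<noteq> {}"
  then obtain d where d: "d \<in> edges C" "d \<in> edges D" by blast
  have "con (edges G - {d}) = con (edges G)" using d CD by (intro con_remove_cycle_edge[of C])
  moreover have "acyc (edges G - {d})"
    unfolding acyc_def using only d by blast
  ultimately have "card (verts G) = 1 + card (edges G - {d})" by (intro tree_count) auto
  moreover have "Suc (card (edges G - {d})) = card (edges G)"
    using d CD finite_G by (intro card_Suc_Diff1) auto
  ultimately show False using card_edges by simp
qed

text \<open>Since \<open>G\<close> has one edge more than a unicyclic graph, deleting \<open>S\<close> leaves at least \<open>card (touched S) - card S - 1\<close> components.\<close>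

definition touched :: "'a set \<Rightarrow> 'a set set" where
  "touched S = {d \<in> edges G. d \<inter> S \<noteq> {}}"

definition avoiding :: "'a set \<Rightarrow> 'a set set" where
  "avoiding S = {d \<in> edges G. d \<inter> S = {}}"

lemma finite_touched: "finite (touched S)"
  using finite_G by (simp add: touched_def)

lemma card_avoiding: "card (avoiding S) + card (touched S) = card (verts G) + 1"
proof -
  have "avoiding S \<union> touched S = edges G" "avoiding S \<inter> touched S = {}"
    by (auto simp: avoiding_def touched_def)
  then show ?thesis using finite_G card_edges card_Un_disjoint[of "avoiding S" "touched S"]
    by (auto simp: avoiding_def touched_def)
qed

lemma edge_set_avoiding: "edge_set_on (verts G - S) (avoiding S)"
  using edge_set_G by (fastforce simp: edge_set_on_def avoiding_def)

lemma ex_coloring_avoiding: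
  assumes "\<And>H. H = C \<or> H = D \<Longrightarrow> odd (card (verts H)) \<Longrightarrow> S \<inter> verts H \<noteq> {}"
  shows "\<exists>col. proper (avoiding S) col"
proof (rule ex_proper_coloring[OF edge_set_avoiding])
  fix H :: "'a graph" assume H: "is_cycle H" "edges H \<subseteq> avoiding S"
  then have "H = C \<or> H = D" using only[of H] by (auto simp: avoiding_def)
  moreover have "S \<inter> verts H = {}"
    using H cycle_edge_verts(4)[OF H(1)] by (fastforce simp: avoiding_def)
  ultimately show "even (card (verts H))" using assms by blast
qed

lemma ex_transversal_avoiding:
  assumes S: "S \<subseteq> verts G"
  shows "\<exists>R rho. transversal (verts G - S) (avoiding S) R rho \<and> card (touched S) \<le> card R + card S + 1"
    and "is_cycle H \<Longrightarrow> edges H \<subseteq> avoiding S \<Longrightarrow>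
      \<exists>R rho. transversal (verts G - S) (avoiding S) R rho \<and> card (touched S) \<le> card R + card S"
proof -
  have card: "card (verts G - S) + card S = card (verts G)"
    using S finite_G(1) by (metis card_Diff_subset card_mono finite_subset le_add_diff_inverse2)
  obtain R rho where "transversal (verts G - S) (avoiding S) R rho" "card (verts G - S) \<le> card R + card (avoiding S)"
    using ex_transversal[OF edge_set_avoiding] by blast
  with card card_avoiding[of S]
  show "\<exists>R rho. transversal (verts G - S) (avoiding S) R rho \<and> card (touched S) \<le> card R + card S + 1"
    by (intro exI[of _ R] exI[of _ rho]) auto
  assume H: "is_cycle H" "edges H \<subseteq> avoiding S"
  obtain d where d: "d \<in> edges H" using cycle_edge_verts(1,4)[OF H(1)] by blast
  have con: "con (avoiding S - {d}) = con (avoiding S)" by (rule con_remove_cycle_edge[OF H d])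
  have "edge_set_on (verts G - S) (avoiding S - {d})"
    using edge_set_avoiding[of S] by (auto simp: edge_set_on_def)
  then obtain R rho where R: "transversal (verts G - S) (avoiding S - {d}) R rho"
    "card (verts G - S) \<le> card R + card (avoiding S - {d})"
    using ex_transversal by blast
  have "Suc (card (avoiding S - {d})) = card (avoiding S)"
    using d H finite_edge_set[OF edge_set_avoiding] by (intro card_Suc_Diff1) auto
  with R card card_avoiding[of S] con
  show "\<exists>R rho. transversal (verts G - S) (avoiding S) R rho \<and> card (touched S) \<le> card R + card S"
    by (intro exI[of _ R] exI[of _ rho]) (auto simp: transversal_def)
qed

lemma card_touched_ge: "F \<subseteq> touched S \<Longrightarrow> card F \<le> card (touched S)"
  by (rule card_mono[OF finite_touched])

definition extra :: "'a set set" where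
  "extra = edges G - edges C - edges D"

lemma at_C: "a \<in> verts C \<Longrightarrow> finite {d \<in> edges C. a \<in> d} \<and> card {d \<in> edges C. a \<in> d} = 2"
  using cycle_edges_at[OF CD(2)] by blast

lemma at_D: "a \<in> verts D \<Longrightarrow> finite {d \<in> edges D. a \<in> d} \<and> card {d \<in> edges D. a \<in> d} = 2"
  using cycle_edges_at[OF CD(3)] by blast

lemma touched_shared:
  assumes "a \<in> verts C" "a \<in> verts D"
  shows "4 \<le> card (touched {a})"
proof -
  have "card ({d \<in> edges C. a \<in> d} \<union> {d \<in> edges D. a \<in> d}) = card {d \<in> edges C. a \<in> d} + card {d \<in> edges D. a \<in> d}"
    using at_C[OF assms(1)] at_D[OF assms(2)] edges_disjoint by (intro card_Un_disjoint) blast+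
  then have card: "card ({d \<in> edges C. a \<in> d} \<union> {d \<in> edges D. a \<in> d}) = 4"
    using at_C[OF assms(1)] at_D[OF assms(2)] by simp
  have "{d \<in> edges C. a \<in> d} \<union> {d \<in> edges D. a \<in> d} \<subseteq> touched {a}"
    using CD(4,5) unfolding touched_def by blast
  from card_touched_ge[OF this] show ?thesis by (simp only: card)
qed

lemma touched_extra:
  assumes "a \<in> verts C" "d \<in> extra" "a \<in> d"
  shows "3 \<le> card (touched {a})"
proof -
  have "d \<notin> {d \<in> edges C. a \<in> d}" using assms(2) by (simp add: extra_def)
  with at_C[OF assms(1)] have "card (insert d {d \<in> edges C. a \<in> d}) = Suc 2"
    using card_insert_disjoint[of "{d \<in> edges C. a \<in> d}" d] by metis
  then have card: "card (insert d {d \<in> edges C. a \<in> d}) = 3" by simp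
  have "insert d {d \<in> edges C. a \<in> d} \<subseteq> touched {a}"
    using CD(4) assms unfolding touched_def extra_def by blast
  from card_touched_ge[OF this] show ?thesis by (simp only: card)
qed

lemma touched_pair:
  assumes "verts C \<inter> verts D = {}" "a \<in> verts C" "b \<in> verts D" "finite F" "F \<subseteq> extra"
    "\<And>d. d \<in> F \<Longrightarrow> d \<inter> {a, b} \<noteq> {}"
  shows "4 + card F \<le> card (touched {a, b})"
proof -
  let ?C = "{d \<in> edges C. a \<in> d}" and ?D = "{d \<in> edges D. b \<in> d}"
  have fin: "finite ?C" "finite ?D" "card ?C = 2" "card ?D = 2"
    using at_C[OF assms(2)] at_D[OF assms(3)] by blast+
  have "card (?C \<union> ?D) = card ?C + card ?D"
    using fin edges_disjoint by (intro card_Un_disjoint) blast+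
  moreover have "card (?C \<union> ?D \<union> F) = card (?C \<union> ?D) + card F"
  proof (rule card_Un_disjoint)
    show "finite (?C \<union> ?D)" using fin by blast
    show "(?C \<union> ?D) \<inter> F = {}" using assms(5) unfolding extra_def by blast
  qed fact
  ultimately have card: "card (?C \<union> ?D \<union> F) = 4 + card F" using fin by simp
  have "?C \<union> ?D \<union> F \<subseteq> touched {a, b}"
  proof
    fix d assume "d \<in> ?C \<union> ?D \<union> F"
    then have "d \<in> edges G" "d \<inter> {a, b} \<noteq> {}"
      using CD(4,5) assms(5,6) unfolding extra_def by blast+
    then show "d \<in> touched {a, b}" by (simp add: touched_def)
  qed
  from card_touched_ge[OF this] show ?thesis by (simp only: card)
qed

text \<open>Without such an edge no walk could leave \<open>C\<close>, as the cycles are disjoint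
  and the graph is connected.\<close>

lemma ex_extra:
  assumes "verts C \<inter> verts D = {}"
  shows "\<exists>d\<in>extra. d \<inter> verts C \<noteq> {}"
proof (rule ccontr)
  assume none: "\<not> ?thesis"
  obtain a b where ab: "a \<in> verts C" "b \<in> verts D"
    using cycle_edge_verts(1)[OF CD(2)] cycle_edge_verts(1)[OF CD(3)] by blast
  have "(a, b) \<in> con (edges G)" using con_G ab verts_CD by blast
  then have "b \<in> verts C"
  proof (induction rule: con_induct)
    case (step x y)
    have x: "x \<in> verts C" by fact
    have "{x, y} \<notin> extra" using none x by auto
    moreover have "{x, y} \<notin> edges D"
    proof
      assume "{x, y} \<in> edges D"
      then have "x \<in> \<Union> (edges D)" by auto
      then have "x \<in> verts D" by (simp only: cycle_edge_verts(4)[OF CD(3)])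
      with x assms show False by blast
    qed
    ultimately have "{x, y} \<in> edges C" using step(2) by (simp add: extra_def)
    then have "y \<in> \<Union> (edges C)" by auto
    then show ?case by (simp only: cycle_edge_verts(4)[OF CD(2)])
  qed (rule ab(1))
  with ab assms show False by blast
qed

end

lemma two_cycles_sym: "two_cycles G C D \<Longrightarrow> two_cycles G D C"
  by (auto simp: two_cycles_def)

lemma (in two_cycles) extra_sym: "two_cycles.extra G D C = extra"
  unfolding extra_def two_cycles.extra_def[OF two_cycles_sym[OF two_cycles_axioms]] by blast

text \<open>Two different extra edges, one at \<open>a\<close> in \<open>C\<close> and one at
  \<open>b\<close> in \<open>D\<close>, make six edges meeting \<open>{a, b}\<close> together with
  the two cycle edges at each. If this never happens, all extra edges at either cycle are one edge,
  and connectedness leaves room for nothing else.\<close>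

lemma (in two_cycles) joined_odd_cycles_or_large:
  assumes odd: "odd (card (verts C))" "odd (card (verts D))" and dis: "verts C \<inter> verts D = {}"
  shows "two_odd_cycles_joined_by_edge G \<or> (\<exists>a\<in>verts C. \<exists>b\<in>verts D. 6 \<le> card (touched {a, b}))"
proof (rule disjCI)
  assume none: "\<not> (\<exists>a\<in>verts C. \<exists>b\<in>verts D. 6 \<le> card (touched {a, b}))"
  have small: "card (touched {a, b}) \<le> 5" if "a \<in> verts C" "b \<in> verts D" for a b
  proof -
    have "\<not> 6 \<le> card (touched {a, b})" using that none by blast
    then show ?thesis by simp
  qed
  have unique: "c = d"
    if cd: "c \<in> extra" "d \<in> extra" "c \<inter> verts C \<noteq> {}" "d \<inter> verts D \<noteq> {}" for c d
  proof (rule ccontr)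
    assume "c \<noteq> d"
    obtain a b where ab: "a \<in> c" "a \<in> verts C" "b \<in> d" "b \<in> verts D" using cd by blast
    have "4 + card {c, d} \<le> card (touched {a, b})"
      by (rule touched_pair[OF dis ab(2,4)]) (use ab cd in auto)
    with small[OF ab(2,4)] \<open>c \<noteq> d\<close> show False by simp
  qed
  obtain c where c: "c \<in> extra" "c \<inter> verts C \<noteq> {}" using ex_extra[OF dis] by blast
  interpret DC: two_cycles G D C by (rule two_cycles_sym[OF two_cycles_axioms])
  have "verts D \<inter> verts C = {}" using dis by blast
  from DC.ex_extra[OF this] obtain d where "d \<in> extra" "d \<inter> verts D \<noteq> {}"
    unfolding extra_sym by blast
  with unique c have cD: "c \<inter> verts D \<noteq> {}" by blast
  obtain a b where ab: "a \<in> c" "a \<in> verts C" "b \<in> c" "b \<in> verts D" using c cD by blast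
  have "a \<noteq> b" using ab dis by blast
  moreover have "card c = 2" using c(1) G(1) by (auto simp: extra_def simple_graph_def)
  ultimately have c_eq: "c = {a, b}" using ab by (auto simp: card_2_iff)
  have only_c: "x = c" if x: "x \<in> extra" "x \<inter> (verts C \<union> verts D) \<noteq> {}" for x
    using unique[of x c] unique[of c x] x c cD by blast
  have verts: "verts G = verts C \<union> verts D"
  proof
    show "verts G \<subseteq> verts C \<union> verts D"
    proof
      fix y assume "y \<in> verts G"
      then have "(a, y) \<in> con (edges G)" using con_G ab(2) verts_CD by blast
      then show "y \<in> verts C \<union> verts D"
      proof (induction rule: con_induct)
        case (step x y)
        then consider "{x, y} \<in> edges C" | "{x, y} \<in> edges D" | "{x, y} \<in> extra" by (auto simp: extra_def)
        then show ?case
        proof cases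
          case 3
          then have "{x, y} = c" using step.IH by (intro only_c) auto
          then show ?thesis using c_eq ab by (auto simp: doubleton_eq_iff)
        qed (use cycle_edge_verts(4)[OF CD(2)] cycle_edge_verts(4)[OF CD(3)] in blast)+
      qed (use ab in blast)
    qed
  qed (use verts_CD in blast)
  have "extra = {c}"
  proof
    show "extra \<subseteq> {c}"
    proof
      fix x assume x: "x \<in> extra"
      then have "x \<subseteq> verts G" "card x = 2" using G(1) by (auto simp: extra_def simple_graph_def)
      moreover from this have "x \<noteq> {}" by auto
      ultimately have "x \<inter> (verts C \<union> verts D) \<noteq> {}" using verts by blast
      with only_c[OF x] show "x \<in> {c}" by blast
    qed
  qed (use c in blast)
  then have "edges G = edges C \<union> edges D \<union> {{a, b}}" using CD c_eq by (auto simp: extra_def)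
  then show "two_odd_cycles_joined_by_edge G"
    unfolding two_odd_cycles_joined_by_edge_def odd_cycle_def
    using CD odd dis ab verts by blast
qed

text \<open>A vertex on both cycles meets four edges. Disjoint odd cycles in a graph of another
  shape have two vertices meeting six. If \<open>D\<close> is even and disjoint from
  \<open>C\<close>, a vertex of \<open>C\<close> on an extra edge meets three edges, and
  \<open>D\<close> survives.\<close>

lemma (in two_cycles) ex_separator_aux:
  assumes odd: "odd (card (verts C))" and not: "\<not> two_odd_cycles_joined_by_edge G"
  shows "\<exists>S R rho col. S \<subseteq> verts G \<and> proper (avoiding S) col \<and> transversal (verts G - S) (avoiding S) R rho \<and>
    card S < card R"
proof -
  \<comment> \<open>The thresholds make \<open>card (touched S) - card S - 1\<close>, or one more
    when a cycle survives, exceed \<open>card S\<close>.\<close>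
  have fin: ?thesis
    if S: "S \<subseteq> verts G" "\<And>H. H = C \<or> H = D \<Longrightarrow> odd (card (verts H)) \<Longrightarrow> S \<inter> verts H \<noteq> {}"
      and t: "2 * card S + 2 \<le> card (touched S) \<or>
        2 * card S + 1 \<le> card (touched S) \<and> (\<exists>H. is_cycle H \<and> edges H \<subseteq> avoiding S)" for S
  proof -
    obtain col where col: "proper (avoiding S) col" using ex_coloring_avoiding[OF S(2)] by blast
    have "\<exists>R rho. transversal (verts G - S) (avoiding S) R rho \<and> card S < card R"
      using t
    proof
      assume "2 * card S + 2 \<le> card (touched S)"
      then show ?thesis using ex_transversal_avoiding(1)[OF S(1)] by fastforce
    next
      assume "2 * card S + 1 \<le> card (touched S) \<and> (\<exists>H. is_cycle H \<and> edges H \<subseteq> avoiding S)"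
      then show ?thesis using ex_transversal_avoiding(2)[OF S(1)] by fastforce
    qed
    with S(1) col show ?thesis by blast
  qed
  show ?thesis
  proof (cases "verts C \<inter> verts D = {}")
    case False
    then obtain a where a: "a \<in> verts C" "a \<in> verts D" by blast
    then show ?thesis
      using touched_shared[OF a] verts_CD by (intro fin[of "{a}"]) auto
  next
    case dis: True
    show ?thesis
    proof (cases "odd (card (verts D))")
      case True
      then obtain a b where ab: "a \<in> verts C" "b \<in> verts D" "6 \<le> card (touched {a, b})"
        using joined_odd_cycles_or_large[OF odd True dis] not by blast
      moreover have "card {a, b} = 2" using ab dis by (auto simp: card_insert_if)
      ultimately show ?thesis using verts_CD by (intro fin[of "{a, b}"]) auto
    next
      case False
      obtain d a where d: "d \<in> extra" "a \<in> d" "a \<in> verts C" using ex_extra[OF dis] by blast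
      have "edges D \<subseteq> avoiding {a}"
        using CD d dis cycle_edge_verts(4)[OF CD(3)] by (auto simp: avoiding_def)
      with CD(3) have "\<exists>H. is_cycle H \<and> edges H \<subseteq> avoiding {a}" by blast
      moreover have "2 * card {a} + 1 \<le> card (touched {a})"
        using touched_extra[OF d(3,1,2)] by simp
      ultimately show ?thesis using verts_CD d False by (intro fin[of "{a}"] disjI2) auto
    qed
  qed
qed

lemma (in two_cycles) ex_separator:
  assumes nonbip: "\<not> bipartite G" and not: "\<not> two_odd_cycles_joined_by_edge G"
  shows "\<exists>S R rho col. S \<subseteq> verts G \<and> proper (avoiding S) col \<and> transversal (verts G - S) (avoiding S) R rho \<and>
    card S < card R"
proof (cases "odd (card (verts C))")
  case True
  then show ?thesis by (rule ex_separator_aux[OF _ not])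
next
  case False
  interpret DC: two_cycles G D C by (rule two_cycles_sym[OF two_cycles_axioms])
  have "odd (card (verts D))"
  proof (rule ccontr)
    assume "\<not> odd (card (verts D))"
    then have "\<exists>col. proper (edges G) col"
      using False only by (intro ex_proper_coloring[OF edge_set_G]) auto
    with bipartite_of_proper[OF G(1)] nonbip show False by blast
  qed
  from DC.ex_separator_aux[OF this not] show ?thesis
    by (simp add: DC.avoiding_def avoiding_def)
qed

text \<open>The ends of the joining edge meet five edges, four on the cycles and that edge, so at
  least \<open>5 - 2 - 1 = 2\<close> components remain. The empty set would not do, since
  \<open>ht_le\<close> needs a proper colouring off the set.\<close>

lemma (in two_cycles) joined_odd_cycles_separator:
  assumes "two_odd_cycles_joined_by_edge G"
  shows "\<exists>S R rho col. S \<subseteq> verts G \<and> proper (avoiding S) col \<and> transversal (verts G - S) (avoiding S) R rho \<and>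
    card S \<le> card R"
proof -
  obtain A B u v where AB: "is_cycle A" "is_cycle B" "verts A \<inter> verts B = {}" "u \<in> verts A" "v \<in> verts B"
    and E: "edges G = edges A \<union> edges B \<union> {{u, v}}"
    using assms by (auto simp: two_odd_cycles_joined_by_edge_def odd_cycle_def)
  have "A \<noteq> B" using AB by auto
  have AB_CD: "A = C \<or> A = D" "B = C \<or> B = D" using only[of A] only[of B] AB E by blast+
  have "two_cycles G A B"
  proof
    fix H :: "'a graph" assume "is_cycle H" "edges H \<subseteq> edges G"
    from only[OF this] AB_CD \<open>A \<noteq> B\<close> show "H = A \<or> H = B" by blast
  qed (use G AB E \<open>A \<noteq> B\<close> in auto)
  then interpret AB: two_cycles G A B .
  have "{u, v} \<notin> edges A" "{u, v} \<notin> edges B"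
    using cycle_edge_verts(4)[OF AB(1)] cycle_edge_verts(4)[OF AB(2)] AB by blast+
  then have "{u, v} \<in> AB.extra" using E by (auto simp: AB.extra_def)
  then have "4 + card {{u, v}} \<le> card (AB.touched {u, v})"
    by (intro AB.touched_pair AB(3,4,5)) auto
  then have "5 \<le> card (touched {u, v})" by (simp add: touched_def AB.touched_def)
  moreover have S: "{u, v} \<subseteq> verts G" using AB AB.verts_CD by blast
  moreover have "card {u, v} = 2" using AB by (auto simp: card_insert_if)
  ultimately obtain R rho where "transversal (verts G - {u, v}) (avoiding {u, v}) R rho" "card {u, v} \<le> card R"
    using ex_transversal_avoiding(1)[OF S] by fastforce
  moreover have "\<exists>col. proper (avoiding {u, v}) col"
    using AB.ex_coloring_avoiding[of "{u, v}"] AB by (auto simp: avoiding_def AB.avoiding_def)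
  ultimately show ?thesis using S by blast
qed

lemma joined_odd_cycles_permutation:
  assumes "two_odd_cycles_joined_by_edge G"
  shows "\<exists>\<pi>. inj_on \<pi> (verts G) \<and> (\<forall>v\<in>verts G. {v, \<pi> v} \<in> edges G \<and> (\<exists>k. odd k \<and> (\<pi> ^^ k) v = v))"
proof -
  obtain A B u v where AB: "is_cycle A" "is_cycle B" "odd (card (verts A))" "odd (card (verts B))" "verts A \<inter> verts B = {}"
    and G: "verts G = verts A \<union> verts B" "edges G = edges A \<union> edges B \<union> {{u, v}}"
    using assms by (auto simp: two_odd_cycles_joined_by_edge_def odd_cycle_def)
  obtain f where f': "bij_betw f (verts A) (verts A) \<and>
      (\<forall>v\<in>verts A. {v, f v} \<in> edges A \<and> (f ^^ card (verts A)) v = v)"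
    using cycle_permutation[OF AB(1)] ..
  then have f: "bij_betw f (verts A) (verts A)" "\<And>v. v \<in> verts A \<Longrightarrow> {v, f v} \<in> edges A"
    "\<And>v. v \<in> verts A \<Longrightarrow> (f ^^ card (verts A)) v = v" by simp_all
  obtain g where g': "bij_betw g (verts B) (verts B) \<and>
      (\<forall>v\<in>verts B. {v, g v} \<in> edges B \<and> (g ^^ card (verts B)) v = v)"
    using cycle_permutation[OF AB(2)] ..
  then have g: "bij_betw g (verts B) (verts B)" "\<And>v. v \<in> verts B \<Longrightarrow> {v, g v} \<in> edges B"
    "\<And>v. v \<in> verts B \<Longrightarrow> (g ^^ card (verts B)) v = v" by simp_all
  define \<pi> where "\<pi> v = (if v \<in> verts A then f v else g v)" for v
  have fA: "f v \<in> verts A" if "v \<in> verts A" for v using f(1) that by (auto simp: bij_betw_def)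
  have gB: "g v \<in> verts B" if "v \<in> verts B" for v using g(1) that by (auto simp: bij_betw_def)
  have "inj_on \<pi> (verts G)"
    unfolding G(1)
  proof (rule inj_onI)
    fix a b assume ab: "a \<in> verts A \<union> verts B" "b \<in> verts A \<union> verts B" "\<pi> a = \<pi> b"
    have A: "\<pi> x = f x" "\<pi> x \<in> verts A" if "x \<in> verts A" for x using that fA by (simp_all add: \<pi>_def)
    have B: "\<pi> x = g x" "\<pi> x \<in> verts B" if "x \<in> verts B" for x
    proof -
      have "x \<notin> verts A" using that AB(5) by blast
      then show "\<pi> x = g x" "\<pi> x \<in> verts B" using that gB by (simp_all add: \<pi>_def)
    qed
    consider "a \<in> verts A" "b \<in> verts A" | "a \<in> verts B" "b \<in> verts B"
      using ab A(2) B(2) AB(5) by (metis Un_iff disjoint_iff)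
    then show "a = b"
    proof cases
      case 1
      with ab(3) have "f a = f b" by (simp add: A)
      then show ?thesis using 1 by (rule inj_onD[OF bij_betw_imp_inj_on[OF f(1)]])
    next
      case 2
      with ab(3) have "g a = g b" by (simp add: B)
      then show ?thesis using 2 by (rule inj_onD[OF bij_betw_imp_inj_on[OF g(1)]])
    qed
  qed
  moreover have "{v, \<pi> v} \<in> edges G" if "v \<in> verts G" for v
    using that f(2) g(2) by (auto simp: \<pi>_def G)
  moreover have "\<exists>k. odd k \<and> (\<pi> ^^ k) v = v" if "v \<in> verts G" for v
  proof (cases "v \<in> verts A")
    case True
    have "(\<pi> ^^ k) v = (f ^^ k) v \<and> (f ^^ k) v \<in> verts A" for k
      by (induction k) (auto simp: True fA \<pi>_def)
    then show ?thesis using f(3)[OF True] AB(3) by metis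
  next
    case False
    then have v: "v \<in> verts B" using that G by blast
    have "(\<pi> ^^ k) v = (g ^^ k) v \<and> (g ^^ k) v \<in> verts B" for k
      using AB(5) by (induction k) (auto simp: v gB \<pi>_def)
    then show ?thesis using g(3)[OF v] AB(4) by metis
  qed
  ultimately show ?thesis by blast
qed

section \<open>The main theorem\<close>

lemma ht_le_separator:
  fixes e :: "'k::field mpoly"
  assumes "edge_ring n (edges G) e" and n: "verts G = {1..n}" and cycles: "two_cycles G C D" and S: "S \<subseteq> verts G"
    and col: "proper (two_cycles.avoiding G S) col"
    and R: "transversal (verts G - S) (two_cycles.avoiding G S) R rho"
  shows "ht (xy_poly_ring n) (edge_ring.I n (edges G) e) \<le> enat (n + card S - card R)"
proof -
  interpret edge_ring n "edges G" e by fact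
  interpret two_cycles G C D by fact
  note R' = R[unfolded transversal_def n]
  show ?thesis
  proof (rule ht_le[of S R rho col])
    fix i j assume "{i, j} \<in> edges G" "i \<notin> S" "j \<notin> S"
    then have "{i, j} \<in> avoiding S" by (simp add: avoiding_def)
    then show "rho i = rho j \<and> col i \<noteq> col j"
      using R' col con_edge[of i j] unfolding proper_def by blast
  qed (use R' S n in auto)
qed

lemma almost_complete_intersection_iff_joined_odd_cycles:
  fixes e :: "'k::field mpoly"
  assumes ring: "edge_ring n (edges G) e" and gr: "simple_graph G" "verts G = {1..n}" "connected_graph G"
    "\<not> bipartite G" "bicyclic_cactus G"
  shows "almost_complete_intersection n (edge_ring.I n (edges G) e) \<longleftrightarrow> two_odd_cycles_joined_by_edge G"
proof -
  interpret edge_ring n "edges G" e by fact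
  obtain C D where CD: "C \<noteq> D" "is_cycle C" "is_cycle D" "edges C \<subseteq> edges G" "edges D \<subseteq> edges G"
    and only: "\<And>H. is_cycle H \<Longrightarrow> edges H \<subseteq> edges G \<Longrightarrow> H = C \<or> H = D"
    by (rule bicyclic_cactus_cycles[OF gr(1,5)]) blast
  interpret two_cycles G C D
    using gr(1,3) CD only by unfold_locales auto
  have "card (edges G) = n + 1" using card_edges by (simp add: gr(2))
  moreover have "card d = 2" if "d \<in> edges G" for d using gr(1) that by (simp add: simple_graph_def)
  ultimately have aci: "almost_complete_intersection n I \<longleftrightarrow> enat (n + 1) = ht (xy_poly_ring n) I + 1"
    using almost_complete_intersection_iff by metis
  show ?thesis
  proof
    assume joined: "two_odd_cycles_joined_by_edge G"
    obtain \<pi> where \<pi>: "inj_on \<pi> (verts G)"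
      "\<forall>v\<in>verts G. {v, \<pi> v} \<in> edges G \<and> (\<exists>k. odd k \<and> (\<pi> ^^ k) v = v)"
      using joined_odd_cycles_permutation[OF joined] by blast
    have "enat n \<le> ht (xy_poly_ring n) I"
      by (rule ht_ge[of \<pi>]) (use \<pi> gr(2) in auto)
    moreover obtain S R rho col where "S \<subseteq> verts G" "proper (avoiding S) col"
      "transversal (verts G - S) (avoiding S) R rho" "card S \<le> card R"
      using joined_odd_cycles_separator[OF joined] by blast
    then have "ht (xy_poly_ring n) I \<le> enat (n + card S - card R)" "n + card S - card R \<le> n"
      using ht_le_separator[OF ring gr(2) two_cycles_axioms] by auto
    ultimately have "ht (xy_poly_ring n) I = enat n" by (meson antisym enat_ord_simps(1) order_trans)
    then show "almost_complete_intersection n I" unfolding aci by (simp add: one_enat_def)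
  next
    assume "almost_complete_intersection n I"
    then have ht: "ht (xy_poly_ring n) I = enat n"
      unfolding aci by (cases "ht (xy_poly_ring n) I") (auto simp: one_enat_def)
    show "two_odd_cycles_joined_by_edge G"
    proof (rule ccontr)
      assume "\<not> ?thesis"
      then obtain S R rho col where S: "S \<subseteq> verts G" "proper (avoiding S) col"
        "transversal (verts G - S) (avoiding S) R rho" "card S < card R"
        using ex_separator[OF gr(4)] by blast
      then have "enat n \<le> enat (n + card S - card R)" using ht_le_separator[OF ring gr(2) two_cycles_axioms] ht by metis
      \<comment> \<open>Subtraction truncates: with \<open>n = 0\<close> the preceding inequality
        would not be contradictory.\<close>
      moreover have "n \<noteq> 0" using gr(2,3) by (auto simp: connected_graph_def)
      ultimately show False using S(4) by simp
    qed
  qed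
qed

theorem theorem3p9:
  fixes n :: nat and G :: "nat graph"
  assumes "simple_graph G" and "verts G = {1..n}"
    and "connected_graph G" and "\<not> bipartite G" and "bicyclic_cactus G"
    and "CHAR('k::field) \<noteq> 2"
  shows "(almost_complete_intersection n (LSS_ideal n G :: 'k mpoly set) \<longleftrightarrow>
          almost_complete_intersection n (parity_binomial_edge_ideal n G :: 'k mpoly set)) \<and>
         (almost_complete_intersection n (parity_binomial_edge_ideal n G :: 'k mpoly set) \<longleftrightarrow>
          two_odd_cycles_joined_by_edge G)"
proof -
  have "(2 :: 'k) \<noteq> 0"
  proof
    assume "(2 :: 'k) = 0"
    then have "CHAR('k) dvd 2" using of_nat_eq_0_iff_char_dvd[of 2, where 'a = 'k] by simp
    moreover have "CHAR('k) \<noteq> 1" by simp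
    ultimately show False using assms(6) prime_nat_iff[of 2] two_is_prime_nat by blast
  qed
  moreover have "i \<in> {1..n} \<and> j \<in> {1..n} \<and> i \<noteq> j" if "{i, j} \<in> edges G" for i j
    using that assms(1,2) unfolding simple_graph_def by fastforce
  ultimately have ring: "edge_ring n (edges G) (1 :: 'k mpoly)" "edge_ring n (edges G) (- 1 :: 'k mpoly)"
    by (unfold_locales; auto)+
  have "(LSS_ideal n G :: 'k mpoly set) = edge_ring.I n (edges G) 1"
    unfolding LSS_ideal_def edge_ring.I_def[OF ring(1)] edge_gens_def bform_def by simp
  moreover have "(parity_binomial_edge_ideal n G :: 'k mpoly set) = edge_ring.I n (edges G) (- 1)"
    unfolding parity_binomial_edge_ideal_def edge_ring.I_def[OF ring(2)] edge_gens_def bform_def by simp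
  ultimately show ?thesis
    using almost_complete_intersection_iff_joined_odd_cycles[OF ring(1) assms(1-5)]
      almost_complete_intersection_iff_joined_odd_cycles[OF ring(2) assms(1-5)] by simp
qed

end
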